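(* Any positive NC measure $\mu$ has a unique Lebesgue decomposition $\mu=\mu_{ac}+\mu_s$ into positive NC measures $\mu_{ac},\mu_s\le\mu$, where $\mu_{ac}$ is the maximal absolutely continuous NC measure bounded above by $\mu$, and $\mu_s$ is a singular NC measure. That is: there is exactly one pair $(\mu_{ac},\mu_s)$ of positive NC measures with $\mu_{ac},\mu_s\le\mu$ and $\mu=\mu_{ac}+\mu_s$ such that $\mu_{ac}$ is absolutely continuous, $\lambda\le\mu_{ac}$ for every absolutely continuous positive NC measure $\lambda\le\mu$, and $\mu_s$ is singular.
   Context: Fix $d\in\mathbb N$. $\mathbb F^d$ is the free monoid of words in $1,\dots,d$. $\mathbb H^2_d=\ell^2(\mathbb F^d)$ has orthonormal basis $\{e_\alpha\}_{\alpha\in\mathbb F^d}$, and $1:=e_\emptyset$. $L_ke_\alpha=e_{k\alpha}$, $1\le k\le d$, are the left free shifts. $\mathcal A_d$ (the free disk algebra) is the norm-closed unital operator algebra generated by $L_1,\dots,L_d$; $a\in\mathcal A_d$ is identified with $a1\in\mathbb H^2_d$, so that $\mathcal A_d$ is a dense subspace of $\mathbb H^2_d$. $\mathscr A_d$ (the free disk system) is the norm closure of $\mathcal A_d+\mathcal A_d^*$; it contains $\mathcal A_d^*\mathcal A_d$. A positive NC measure is a positive linear functional on $\mathscr A_d$; $\lambda\le\mu$ means $\mu-\lambda$ is positive. Sesquilinear forms are conjugate-linear in the first argument. The form of $\mu$ is $q_\mu(a_1,a_2)=\mu(a_1^*a_2)$, with dense domain $\mathcal A_d\subset\mathbb H^2_d$.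 A densely-defined positive semi-definite form $q$ on a Hilbert space $\mathcal H$ is closed if $\mathrm{Dom}\,q$ is complete in the norm $(q(x,x)+\|x\|^2)^{1/2}$, and closable if it has a closed extension (equivalently: if $x_n\in\mathrm{Dom}\,q$, $x_n\to0$ and $q(x_n-x_m,x_n-x_m)\to0$, then $q(x_n,x_n)\to0$). For such forms $q_1\le q_2$ means $\mathrm{Dom}\,q_2\subseteq\mathrm{Dom}\,q_1$ and $q_1(h,h)\le q_2(h,h)$ for $h\in\mathrm{Dom}\,q_2$. By a theorem of B. Simon, every such $q$ has a maximal closable positive semi-definite form $q_{ac}\le q$ (with domain $\mathrm{Dom}\,q$), its absolutely continuous part. $\mu$ is absolutely continuous if $q_\mu$ is closable, and singular if the absolutely continuous part $(q_\mu)_{ac}$ is identically zero. *)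

theory Defs
  imports "HOL-Analysis.Analysis"
begin

section \<open>The Hilbert space of square-summable complex families\<close>

typedef 'i ell2 = "{x :: 'i \<Rightarrow> complex. (\<lambda>i. (cmod (x i))\<^sup>2) summable_on UNIV}"
  morphisms ell2_coeff Abs_ell2
  by (rule exI[of _ "\<lambda>_. 0"]) simp

setup_lifting type_definition_ell2

lemma summable_ell2_coeff: "(\<lambda>i. (cmod (ell2_coeff x i))\<^sup>2) summable_on UNIV"
  using ell2_coeff[of x] by simp

lemma summable_norm_sq_add:
  assumes "(\<lambda>i. (cmod (x i))\<^sup>2) summable_on UNIV" "(\<lambda>i. (cmod (y i))\<^sup>2) summable_on UNIV"
  shows "(\<lambda>i. (cmod (x i + y i))\<^sup>2) summable_on UNIV"
proof (rule summable_on_comparison_test)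
  show "(\<lambda>i. 2 * (cmod (x i))\<^sup>2 + 2 * (cmod (y i))\<^sup>2) summable_on UNIV"
    using assms by (intro summable_on_add summable_on_cmult_right)
  show "(cmod (x i + y i))\<^sup>2 \<le> 2 * (cmod (x i))\<^sup>2 + 2 * (cmod (y i))\<^sup>2" for i
  proof -
    have "(cmod (x i + y i))\<^sup>2 \<le> (cmod (x i) + cmod (y i))\<^sup>2"
      by (simp add: norm_triangle_ineq power_mono)
    also have "\<dots> \<le> 2 * (cmod (x i))\<^sup>2 + 2 * (cmod (y i))\<^sup>2"
      using sum_squares_bound[of "cmod (x i)" "cmod (y i)"] by (simp add: power2_sum)
    finally show ?thesis .
  qed
qed simp

lemma summable_norm_sq_scale:
  assumes "(\<lambda>i. (cmod (x i))\<^sup>2) summable_on UNIV"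
  shows "(\<lambda>i. (cmod (c * x i))\<^sup>2) summable_on UNIV"
  using summable_on_cmult_right[OF assms, of "(cmod c)\<^sup>2"]
  by (simp add: norm_mult power_mult_distrib)

lift_definition scaleC :: "complex \<Rightarrow> 'i ell2 \<Rightarrow> 'i ell2" (infixr \<open>*\<^sub>C\<close> 75)
  is "\<lambda>c x i. c * x i"
  by (simp add: summable_norm_sq_scale)

text \<open>The inner product is conjugate-linear in its first argument.\<close>

definition cinner :: "'i ell2 \<Rightarrow> 'i ell2 \<Rightarrow> complex"
  where "cinner x y = (\<Sum>\<^sub>\<infinity>i. cnj (ell2_coeff x i) * ell2_coeff y i)"

lemma summable_cinner: "(\<lambda>i. cnj (ell2_coeff x i) * ell2_coeff y i) summable_on UNIV"
proof (rule abs_summable_summable, rule summable_on_comparison_test)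
  show "(\<lambda>i. (cmod (ell2_coeff x i))\<^sup>2 + (cmod (ell2_coeff y i))\<^sup>2) summable_on UNIV"
    by (intro summable_on_add summable_ell2_coeff)
  show "norm (cnj (ell2_coeff x i) * ell2_coeff y i)
      \<le> (cmod (ell2_coeff x i))\<^sup>2 + (cmod (ell2_coeff y i))\<^sup>2" for i
  proof -
    have "cmod (ell2_coeff x i) * cmod (ell2_coeff y i) \<ge> 0" by simp
    then show ?thesis
      using sum_squares_bound[of "cmod (ell2_coeff x i)" "cmod (ell2_coeff y i)"]
      unfolding norm_mult complex_mod_cnj by linarith
  qed
qed simp

instantiation ell2 :: (type) real_vector
begin

lift_definition zero_ell2 :: "'a ell2" is "\<lambda>_. 0" by simp
lift_definition plus_ell2 :: "'a ell2 \<Rightarrow> 'a ell2 \<Rightarrow> 'a ell2" is "\<lambda>x y i. x i + y i"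
  by (simp add: summable_norm_sq_add)
lift_definition uminus_ell2 :: "'a ell2 \<Rightarrow> 'a ell2" is "\<lambda>x i. - x i" by simp
lift_definition minus_ell2 :: "'a ell2 \<Rightarrow> 'a ell2 \<Rightarrow> 'a ell2" is "\<lambda>x y i. x i - y i"
  using summable_norm_sq_add[of _ "\<lambda>i. - _ i"] by simp
lift_definition scaleR_ell2 :: "real \<Rightarrow> 'a ell2 \<Rightarrow> 'a ell2" is "\<lambda>r x i. complex_of_real r * x i"
  using summable_norm_sq_scale by auto

instance
proof
  fix x y z :: "'a ell2" and a b :: real
  show "x + y + z = x + (y + z)" by transfer (simp add: add.assoc)
  show "x + y = y + x" by transfer (simp add: add.commute)
  show "0 + x = x" by transfer simp
  show "- x + x = 0" by transfer simp
  show "x - y = x + - y" by transfer simp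
  show "a *\<^sub>R (x + y) = a *\<^sub>R x + a *\<^sub>R y" by transfer (simp add: distrib_left)
  show "(a + b) *\<^sub>R x = a *\<^sub>R x + b *\<^sub>R x" by transfer (simp add: distrib_right)
  show "a *\<^sub>R b *\<^sub>R x = (a * b) *\<^sub>R x" by transfer (simp add: mult.assoc)
  show "1 *\<^sub>R x = x" by transfer simp
qed

end

instantiation ell2 :: (type) real_inner
begin

definition inner_ell2 :: "'a ell2 \<Rightarrow> 'a ell2 \<Rightarrow> real"
  where "inner_ell2 x y = Re (cinner x y)"
definition norm_ell2 :: "'a ell2 \<Rightarrow> real"
  where "norm_ell2 x = sqrt (\<Sum>\<^sub>\<infinity>i. (cmod (ell2_coeff x i))\<^sup>2)"
definition dist_ell2 :: "'a ell2 \<Rightarrow> 'a ell2 \<Rightarrow> real"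
  where "dist_ell2 x y = norm (x - y)"
definition sgn_ell2 :: "'a ell2 \<Rightarrow> 'a ell2"
  where "sgn_ell2 x = x /\<^sub>R norm x"
definition uniformity_ell2 :: "('a ell2 \<times> 'a ell2) filter"
  where "uniformity_ell2 = (INF e\<in>{0<..}. principal {(x, y). dist x y < e})"
definition open_ell2 :: "'a ell2 set \<Rightarrow> bool"
  where "open_ell2 U = (\<forall>x\<in>U. \<forall>\<^sub>F (x', y) in uniformity. x' = x \<longrightarrow> y \<in> U)"

instance
proof
  fix x y z :: "'a ell2" and r :: real and U :: "'a ell2 set"
  show "dist x y = norm (x - y)" by (rule dist_ell2_def)
  show "sgn x = x /\<^sub>R norm x" by (rule sgn_ell2_def)
  show "uniformity = (INF e\<in>{0<..}. principal {(x, y :: 'a ell2). dist x y < e})"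
    by (rule uniformity_ell2_def)
  show "open U = (\<forall>x\<in>U. \<forall>\<^sub>F (x', y) in uniformity. x' = x \<longrightarrow> y \<in> U)"
    by (rule open_ell2_def)
  have Re: "inner u v = (\<Sum>\<^sub>\<infinity>i. Re (cnj (ell2_coeff u i) * ell2_coeff v i))" for u v :: "'a ell2"
    unfolding inner_ell2_def cinner_def using summable_cinner by (rule infsum_Re[symmetric])
  have cc: "cinner x x = of_real (\<Sum>\<^sub>\<infinity>i. (cmod (ell2_coeff x i))\<^sup>2)"
  proof -
    have "cinner x x = (\<Sum>\<^sub>\<infinity>i. of_real ((cmod (ell2_coeff x i))\<^sup>2))"
      unfolding cinner_def by (rule infsum_cong) (simp add: complex_norm_square[symmetric] mult.commute)
    also have "\<dots> = of_real (\<Sum>\<^sub>\<infinity>i. (cmod (ell2_coeff x i))\<^sup>2)"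
      by (intro infsumI has_sum_of_real has_sum_infsum summable_ell2_coeff)
    finally show ?thesis .
  qed
  have sq: "inner x x = (\<Sum>\<^sub>\<infinity>i. (cmod (ell2_coeff x i))\<^sup>2)"
    by (simp add: inner_ell2_def cc)
  show "inner x y = inner y x"
    unfolding Re by (rule infsum_cong) (simp add: mult.commute)
  have "cinner (x + y) z = cinner x z + cinner y z"
    unfolding cinner_def using infsum_add[OF summable_cinner[of x z] summable_cinner[of y z]]
    by (simp add: plus_ell2.rep_eq distrib_right)
  then show "inner (x + y) z = inner x z + inner y z"
    by (simp add: inner_ell2_def)
  have "cinner (r *\<^sub>R x) y = of_real r * cinner x y"
    unfolding cinner_def by (simp add: scaleR_ell2.rep_eq mult.assoc infsum_cmult_right')
  then show "inner (r *\<^sub>R x) y = r * inner x y"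
    by (simp add: inner_ell2_def)
  show "0 \<le> inner x x"
    unfolding sq by (rule infsum_nonneg) simp
  show "inner x x = 0 \<longleftrightarrow> x = 0"
  proof
    assume "inner x x = 0"
    then have "(cmod (ell2_coeff x i))\<^sup>2 = 0" for i
      unfolding sq using nonneg_infsum_le_0D[OF _ summable_ell2_coeff, of x i] by simp
    then have "ell2_coeff x = (\<lambda>_. 0)" by auto
    then show "x = 0" by (simp add: ell2_coeff_inject[symmetric] zero_ell2.rep_eq)
  qed (simp add: inner_ell2_def cinner_def zero_ell2.rep_eq)
  show "norm x = sqrt (inner x x)"
    by (simp add: sq norm_ell2_def)
qed

end

lift_definition ell2_basis :: "'i \<Rightarrow> 'i ell2" is "\<lambda>i j. if j = i then 1 else 0"
proof -
  fix i :: 'i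
  have "(\<lambda>j. (cmod (if j = i then 1 else 0))\<^sup>2) summable_on {i}" by simp
  then have "(\<lambda>j. (cmod (if j = i then 1 else 0))\<^sup>2) summable_on UNIV"
    by (rule summable_on_cong_neutral[THEN iffD1, rotated -1]) auto
  then show "(\<lambda>j. (cmod (if j = i then 1 else 0))\<^sup>2) summable_on UNIV" .
qed

lemma norm_scaleC: "norm (c *\<^sub>C x) = cmod c * norm x"
  by (simp add: norm_ell2_def scaleC.rep_eq norm_mult power_mult_distrib infsum_cmult_right'
      real_sqrt_mult)

lemma bounded_linear_scaleC: "bounded_linear (scaleC c)"
proof (rule bounded_linear_intro[where K = "cmod c"])
  show "c *\<^sub>C (x + y) = c *\<^sub>C x + c *\<^sub>C y" for x y :: "'i ell2"
    by transfer (simp add: distrib_left)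
  show "c *\<^sub>C (r *\<^sub>R x) = r *\<^sub>R (c *\<^sub>C x)" for r and x :: "'i ell2"
    by transfer (simp add: mult.left_commute)
qed (simp add: norm_scaleC mult.commute)


section \<open>The full Fock space and the free disk system\<close>

text \<open>The letters \<open>1, \<dots>, d\<close> are the elements of a finite type \<open>'d\<close>, so that \<open>'d list\<close>, with
  concatenation, is the free monoid on \<open>d = CARD('d)\<close> generators.\<close>

type_synonym 'd fock = "'d list ell2"

text \<open>Operators are bounded \<^emph>\<open>real\<close>-linear maps with the operator norm. All operators in the
  algebra and in the operator system below are complex-linear, since the complex-linear maps form
  a norm-closed unital algebra containing the shifts.\<close>

type_synonym 'd fock_op = "'d fock \<Rightarrow>\<^sub>L 'd fock"

definition scaleC_op :: "complex \<Rightarrow> 'd fock_op \<Rightarrow> 'd fock_op"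
  where "scaleC_op c T = Blinfun (\<lambda>x. c *\<^sub>C blinfun_apply T x)"

lemma scaleC_op_apply: "blinfun_apply (scaleC_op c T) x = c *\<^sub>C blinfun_apply T x"
  unfolding scaleC_op_def
  by (subst bounded_linear_Blinfun_apply)
    (auto intro: bounded_linear_compose[OF bounded_linear_scaleC] blinfun.bounded_linear_right)

lemma infsum_shift:
  fixes f :: "'d list \<Rightarrow> real"
  shows "(\<Sum>\<^sub>\<infinity>w. case w of [] \<Rightarrow> 0 | j # v \<Rightarrow> if j = k then f v else 0) = infsum f UNIV" (is ?eq)
    and "f summable_on UNIV \<Longrightarrow>
      (\<lambda>w. case w of [] \<Rightarrow> 0 | j # v \<Rightarrow> if j = k then f v else 0) summable_on UNIV" (is "_ \<Longrightarrow> ?sum")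
proof -
  let ?g = "\<lambda>w. case w of [] \<Rightarrow> 0 | j # v \<Rightarrow> if j = k then f v else 0"
  have inj: "inj ((#) k)" by simp
  have comp: "?g \<circ> (#) k = f" by auto
  have zero: "?g w = 0" if "w \<notin> range ((#) k)" for w
    using that by (auto split: list.split)
  have "infsum ?g UNIV = infsum ?g (range ((#) k))"
    by (rule infsum_cong_neutral) (use zero in auto)
  then show ?eq
    using infsum_reindex[OF inj, of ?g] comp by simp
  assume "f summable_on UNIV"
  then have "?g summable_on (range ((#) k))"
    using summable_on_reindex[OF inj, of ?g] comp by simp
  then show ?sum
    by (rule summable_on_cong_neutral[THEN iffD1, rotated -1]) (use zero in auto)
qed

lift_definition shift_fun :: "'d \<Rightarrow> 'd fock \<Rightarrow> 'd fock"
  is "\<lambda>k x w. case w of [] \<Rightarrow> 0 | j # v \<Rightarrow> if j = k then x v else 0"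
proof -
  fix k :: 'd and x :: "'d list \<Rightarrow> complex"
  assume "(\<lambda>v. (cmod (x v))\<^sup>2) summable_on UNIV"
  from infsum_shift(2)[OF this, of k]
  show "(\<lambda>w. (cmod (case w of [] \<Rightarrow> 0 | j # v \<Rightarrow> if j = k then x v else 0))\<^sup>2) summable_on UNIV"
    by (rule summable_on_cong[THEN iffD1, rotated]) (auto split: list.split)
qed

lemma norm_shift_fun: "norm (shift_fun k x) = norm x"
proof -
  have "(\<Sum>\<^sub>\<infinity>w. (cmod (ell2_coeff (shift_fun k x) w))\<^sup>2)
      = (\<Sum>\<^sub>\<infinity>w. case w of [] \<Rightarrow> 0 | j # v \<Rightarrow> if j = k then (cmod (ell2_coeff x v))\<^sup>2 else 0)"
    by (rule infsum_cong) (auto simp: shift_fun.rep_eq split: list.split)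
  then show ?thesis by (simp add: norm_ell2_def infsum_shift(1))
qed

definition left_shift :: "'d \<Rightarrow> 'd fock_op"
  where "left_shift k = Blinfun (shift_fun k)"

lemma left_shift_apply: "blinfun_apply (left_shift k) = shift_fun k"
  unfolding left_shift_def
proof (rule bounded_linear_Blinfun_apply)
  show "bounded_linear (shift_fun k)"
  proof (rule bounded_linear_intro[where K = 1])
    show "shift_fun k (x + y) = shift_fun k x + shift_fun k y" for x y
      by transfer (auto split: list.split)
    show "shift_fun k (r *\<^sub>R x) = r *\<^sub>R shift_fun k x" for r x
      by transfer (auto split: list.split)
  qed (simp add: norm_shift_fun)
qed

lemma left_shift_basis: "blinfun_apply (left_shift k) (ell2_basis w) = ell2_basis (k # w)"
proof -
  have "shift_fun k (ell2_basis w) = ell2_basis (k # w)"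
    by transfer (auto split: list.split)
  then show ?thesis by (simp add: left_shift_apply)
qed

definition is_adjoint :: "'d fock_op \<Rightarrow> 'd fock_op \<Rightarrow> bool"
  where "is_adjoint T S \<longleftrightarrow>
    (\<forall>x y. cinner (blinfun_apply S x) y = cinner x (blinfun_apply T y))"

text \<open>Used for complex-linear operators only; the others have no adjoint in this sense.\<close>

definition adj :: "'d fock_op \<Rightarrow> 'd fock_op"
  where "adj T = (THE S. is_adjoint T S)"

definition op_positive :: "'d fock_op \<Rightarrow> bool"
  where "op_positive T \<longleftrightarrow> (\<forall>x. cinner x (blinfun_apply T x) \<in> \<real>\<^sub>\<ge>\<^sub>0)"

definition unital_subalgebra :: "'d fock_op set \<Rightarrow> bool"
  where "unital_subalgebra A \<longleftrightarrow>
    id_blinfun \<in> A \<and>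
    (\<forall>S\<in>A. \<forall>T\<in>A. S + T \<in> A) \<and>
    (\<forall>c. \<forall>T\<in>A. scaleC_op c T \<in> A) \<and>
    (\<forall>S\<in>A. \<forall>T\<in>A. S o\<^sub>L T \<in> A)"

definition free_disk_algebra :: "'d fock_op set"
  where "free_disk_algebra = (\<lambda>A. unital_subalgebra A \<and> closed A) hull range left_shift"

definition free_disk_system :: "'d fock_op set"
  where "free_disk_system =
    closure {a + adj b | a b. a \<in> free_disk_algebra \<and> b \<in> free_disk_algebra}"


section \<open>Positive NC measures\<close>

definition linear_on_system :: "('d fock_op \<Rightarrow> complex) \<Rightarrow> bool"
  where "linear_on_system \<mu> \<longleftrightarrow>
    (\<forall>S\<in>free_disk_system. \<forall>T\<in>free_disk_system. \<mu> (S + T) = \<mu> S + \<mu> T) \<and>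
    (\<forall>c. \<forall>T\<in>free_disk_system. \<mu> (scaleC_op c T) = c * \<mu> T)"

definition positive_on_system :: "('d fock_op \<Rightarrow> complex) \<Rightarrow> bool"
  where "positive_on_system \<mu> \<longleftrightarrow> (\<forall>T\<in>free_disk_system. op_positive T \<longrightarrow> \<mu> T \<in> \<real>\<^sub>\<ge>\<^sub>0)"

text \<open>A functional on the free disk system is represented by its extension by \<open>0\<close> to all
  operators, so that equality of functions is equality of functionals.\<close>

definition nc_measure :: "('d fock_op \<Rightarrow> complex) \<Rightarrow> bool"
  where "nc_measure \<mu> \<longleftrightarrow>
    linear_on_system \<mu> \<and> positive_on_system \<mu> \<and> (\<forall>T. T \<notin> free_disk_system \<longrightarrow> \<mu> T = 0)"

definition nc_le :: "('d fock_op \<Rightarrow> complex) \<Rightarrow> ('d fock_op \<Rightarrow> complex) \<Rightarrow> bool"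
  where "nc_le \<kappa> \<mu> \<longleftrightarrow> positive_on_system (\<lambda>T. \<mu> T - \<kappa> T)"


section \<open>Positive semi-definite sesquilinear forms\<close>

text \<open>A form with domain \<open>D\<close> is represented by a function \<open>q\<close> that is \<open>0\<close> off \<open>D \<times> D\<close>.\<close>

definition psd_form :: "'i ell2 set \<Rightarrow> ('i ell2 \<Rightarrow> 'i ell2 \<Rightarrow> complex) \<Rightarrow> bool"
  where "psd_form D q \<longleftrightarrow>
    0 \<in> D \<and> (\<forall>x\<in>D. \<forall>y\<in>D. x + y \<in> D) \<and> (\<forall>c. \<forall>x\<in>D. c *\<^sub>C x \<in> D) \<and> closure D = UNIV \<and>
    (\<forall>x\<in>D. \<forall>y\<in>D. \<forall>z\<in>D. q (x + y) z = q x z + q y z \<and> q z (x + y) = q z x + q z y) \<and>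
    (\<forall>c. \<forall>x\<in>D. \<forall>y\<in>D. q (c *\<^sub>C x) y = cnj c * q x y \<and> q x (c *\<^sub>C y) = c * q x y) \<and>
    (\<forall>x\<in>D. q x x \<in> \<real>\<^sub>\<ge>\<^sub>0) \<and>
    (\<forall>x y. x \<notin> D \<or> y \<notin> D \<longrightarrow> q x y = 0)"

definition form_norm :: "('i ell2 \<Rightarrow> 'i ell2 \<Rightarrow> complex) \<Rightarrow> 'i ell2 \<Rightarrow> real"
  where "form_norm q x = sqrt (Re (q x x) + (norm x)\<^sup>2)"

definition closed_form :: "'i ell2 set \<Rightarrow> ('i ell2 \<Rightarrow> 'i ell2 \<Rightarrow> complex) \<Rightarrow> bool"
  where "closed_form D q \<longleftrightarrow> psd_form D q \<and>
    (\<forall>X :: nat \<Rightarrow> 'i ell2.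
      (\<forall>n. X n \<in> D) \<and> (\<forall>e>0. \<exists>N. \<forall>m\<ge>N. \<forall>n\<ge>N. form_norm q (X m - X n) < e) \<longrightarrow>
      (\<exists>x\<in>D. (\<lambda>n. form_norm q (X n - x)) \<longlonglongrightarrow> 0))"

definition closable_form :: "'i ell2 set \<Rightarrow> ('i ell2 \<Rightarrow> 'i ell2 \<Rightarrow> complex) \<Rightarrow> bool"
  where "closable_form D q \<longleftrightarrow> psd_form D q \<and>
    (\<exists>D' q'. closed_form D' q' \<and> D \<subseteq> D' \<and> (\<forall>x\<in>D. \<forall>y\<in>D. q' x y = q x y))"

definition form_le ::
    "'i ell2 set \<Rightarrow> ('i ell2 \<Rightarrow> 'i ell2 \<Rightarrow> complex) \<Rightarrow>
     'i ell2 set \<Rightarrow> ('i ell2 \<Rightarrow> 'i ell2 \<Rightarrow> complex) \<Rightarrow> bool"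
  where "form_le D1 q1 D2 q2 \<longleftrightarrow> D2 \<subseteq> D1 \<and> (\<forall>h\<in>D2. Re (q1 h h) \<le> Re (q2 h h))"

text \<open>The largest closable form below \<open>q\<close>, which has domain \<open>D\<close>; it exists by a theorem of
  B. Simon, and is unique by polarization.\<close>

definition is_form_ac_part ::
    "'i ell2 set \<Rightarrow> ('i ell2 \<Rightarrow> 'i ell2 \<Rightarrow> complex) \<Rightarrow> ('i ell2 \<Rightarrow> 'i ell2 \<Rightarrow> complex) \<Rightarrow> bool"
  where "is_form_ac_part D q r \<longleftrightarrow>
    closable_form D r \<and> form_le D r D q \<and>
    (\<forall>D' p. closable_form D' p \<and> form_le D' p D q \<longrightarrow> form_le D' p D r)"

definition form_ac_part ::
    "'i ell2 set \<Rightarrow> ('i ell2 \<Rightarrow> 'i ell2 \<Rightarrow> complex) \<Rightarrow> 'i ell2 \<Rightarrow> 'i ell2 \<Rightarrow> complex"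
  where "form_ac_part D q = (THE r. is_form_ac_part D q r)"


section \<open>Absolutely continuous and singular NC measures\<close>

definition disk_vectors :: "'d fock set"
  where "disk_vectors = (\<lambda>a. blinfun_apply a (ell2_basis [])) ` free_disk_algebra"

text \<open>The inverse of the identification \<open>a \<mapsto> a 1\<close> of the algebra with a space of vectors; this map
  is injective because the elements of the algebra commute with the right free shifts.\<close>

definition disk_operator :: "'d fock \<Rightarrow> 'd fock_op"
  where "disk_operator = inv_into free_disk_algebra (\<lambda>a. blinfun_apply a (ell2_basis []))"

definition nc_form :: "('d fock_op \<Rightarrow> complex) \<Rightarrow> 'd fock \<Rightarrow> 'd fock \<Rightarrow> complex"
  where "nc_form \<mu> x y =
    (if x \<in> disk_vectors \<and> y \<in> disk_vectors
     then \<mu> (adj (disk_operator x) o\<^sub>L disk_operator y) else 0)"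

definition nc_absolutely_continuous :: "('d fock_op \<Rightarrow> complex) \<Rightarrow> bool"
  where "nc_absolutely_continuous \<mu> \<longleftrightarrow> closable_form disk_vectors (nc_form \<mu>)"

definition nc_singular :: "('d fock_op \<Rightarrow> complex) \<Rightarrow> bool"
  where "nc_singular \<mu> \<longleftrightarrow>
    (\<forall>x\<in>disk_vectors. \<forall>y\<in>disk_vectors. form_ac_part disk_vectors (nc_form \<mu>) x y = 0)"

end

theory Submission
  imports Defs
begin

text \<open>
  Write \<open>Q\<close> for the quadratic form of \<open>\<mu>\<close> on the dense subspace of Fock space formed by the vectors
  \<open>a vacuum\<close>, with \<open>a\<close> in the free disk algebra. The absolutely continuous part of a form is its
  lower semicontinuous hull, \<open>hull_value x = liminf Q y\<close> as \<open>y\<close> tends to \<open>x\<close> in Fock space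
  (\<open>hull_on_dom_is_ac_part\<close>, a form of Simon's theorem). The point of the decomposition is that this
  hull again comes from a positive functional, and everything rests on recovery sequences: sequences
  \<open>X\<close> in the domain with \<open>X \<longlonglongrightarrow> x\<close> and \<open>Q (X n) \<longlonglongrightarrow> hull_value x\<close>.

  Recovery sequences are characterized by a linear condition: they are the form-bounded
  sequences tending to \<open>x\<close> that are asymptotically orthogonal, for the form, to every form-bounded
  sequence tending to \<open>0\<close> in Fock space (\<open>recovers_orthogonal\<close>, \<open>recoversI\<close>).
  In the Hilbert space of the Gelfand-Naimark-Segal construction they converge to the image of \<open>x\<close> under the projection that kills the limits of such
  null sequences. The linear condition makes the hull a sesquilinear form, and a lower
  semicontinuous form on its full domain is closed. Conversely a closed form equals its hull,
  because recovery sequences are Cauchy for the form. Hence the hull is the largest closable minorant.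

  The free disk algebra maps recovery sequences to recovery sequences (\<open>recovers_apply\<close>). For a left
  shift one has to know that the hull is invariant: the shift preserves \<open>Q\<close>, and a sequence tending
  to a shifted vector can be shifted back, after its constant term, which tends to \<open>0\<close>, has been
  removed. The orthogonality condition extends this to the closed algebra generated by the shifts.

  Now let \<open>b n\<close> be elements of the algebra for which \<open>b n vacuum\<close> is a recovery sequence of the
  vacuum. The compressions \<open>\<mu> (adj (b n) T (b n))\<close> are positive functionals of \<open>T\<close>, so their limit
  \<open>ac_part\<close> is one; its form is the hull of \<open>Q\<close> since \<open>a (b n) vacuum\<close> recovers
  \<open>a vacuum\<close>. The remainder \<open>\<mu> - ac_part\<close> is the limit of the compressions by \<open>1 - b n\<close>, because the mixed terms vanish by orthogonality; so it is
  positive as well (\<open>singular_part_tendsto\<close>). It is singular: along a recovery sequence of \<open>x\<close> its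
  form, \<open>Q\<close> minus the hull, tends to \<open>0\<close>. If \<open>\<kappa> \<le> \<mu>\<close> is absolutely continuous then \<open>b n\<close> tends to
  \<open>1\<close> for the form of \<open>\<kappa>\<close>, so \<open>\<kappa>\<close> is the limit of its own compressions and lies below \<open>ac_part\<close>
  (\<open>ac_part_maximal\<close>). Maximality gives uniqueness, as the positive elements span the system.
\<close>

section \<open>Square-summable families as a complex Hilbert space\<close>

lemma scaleC_add_right: "c *\<^sub>C (x + y) = c *\<^sub>C x + c *\<^sub>C y"
  by transfer (simp add: distrib_left)

lemma scaleC_add_left: "(a + b) *\<^sub>C x = a *\<^sub>C x + b *\<^sub>C x"
  by transfer (simp add: distrib_right)

lemma scaleC_scaleC: "a *\<^sub>C b *\<^sub>C x = (a * b) *\<^sub>C x"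
  by transfer (simp add: mult.assoc)

lemma scaleC_one [simp]: "1 *\<^sub>C x = x"
  by transfer simp

lemma scaleC_zero_left [simp]: "0 *\<^sub>C x = 0"
  by transfer simp

lemma scaleC_zero_right [simp]: "c *\<^sub>C 0 = 0"
  by transfer simp

lemma scaleC_minus_one: "(-1) *\<^sub>C x = - x"
  by transfer simp

lemma scaleC_of_real: "complex_of_real r *\<^sub>C x = r *\<^sub>R x"
  by transfer simp

lemma diff_eq_add_scaleC: "x - y = x + (-1) *\<^sub>C y"
  by (simp add: scaleC_minus_one)

lemma scaleC_diff_right: "c *\<^sub>C (x - y) = c *\<^sub>C x - c *\<^sub>C y"
  by transfer (simp add: right_diff_distrib)

lemma scaleC_diff_left: "(a - b) *\<^sub>C x = a *\<^sub>C x - b *\<^sub>C x"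
  by transfer (simp add: left_diff_distrib)

lemma cinner_add_left: "cinner (x + y) z = cinner x z + cinner y z"
  unfolding cinner_def using infsum_add[OF summable_cinner[of x z] summable_cinner[of y z]]
  by (simp add: plus_ell2.rep_eq distrib_right)

lemma cinner_add_right: "cinner x (y + z) = cinner x y + cinner x z"
  unfolding cinner_def using infsum_add[OF summable_cinner[of x y] summable_cinner[of x z]]
  by (simp add: plus_ell2.rep_eq distrib_left)

lemma cinner_scaleC_left: "cinner (c *\<^sub>C x) y = cnj c * cinner x y"
  by (simp add: cinner_def scaleC.rep_eq mult.assoc infsum_cmult_right')

lemma cinner_scaleC_right: "cinner x (c *\<^sub>C y) = c * cinner x y"
  by (simp add: cinner_def scaleC.rep_eq mult.left_commute infsum_cmult_right')

lemma cinner_diff_left: "cinner (x - y) z = cinner x z - cinner y z"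
  by (simp add: diff_eq_add_scaleC cinner_add_left cinner_scaleC_left)

lemma cinner_diff_right: "cinner x (y - z) = cinner x y - cinner x z"
  by (simp add: diff_eq_add_scaleC cinner_add_right cinner_scaleC_right)

lemma cinner_zero_left [simp]: "cinner 0 x = 0"
  by (simp add: cinner_def zero_ell2.rep_eq)

lemma cinner_zero_right [simp]: "cinner x 0 = 0"
  by (simp add: cinner_def zero_ell2.rep_eq)

lemma cnj_cinner: "cnj (cinner x y) = cinner y x"
  unfolding cinner_def infsum_cnj[symmetric] by (rule infsum_cong) (simp add: mult.commute)

lemma norm_sq_ell2: "(norm x)\<^sup>2 = (\<Sum>\<^sub>\<infinity>i. (cmod (ell2_coeff x i))\<^sup>2)"
  by (simp add: norm_ell2_def infsum_nonneg)

lemma cinner_self: "cinner x x = of_real ((norm x)\<^sup>2)"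
proof -
  have "Re (cinner x x) = (norm x)\<^sup>2"
    using dot_square_norm[of x] by (simp add: inner_ell2_def)
  moreover have "Im (cinner x x) = 0"
    using cnj_cinner[of x x] by (metis complex_cnj_cancel_iff Reals_cnj_iff complex_is_Real_iff)
  ultimately show ?thesis by (simp add: complex_eq_iff)
qed

text \<open>Rotating \<open>y\<close> by the phase of \<open>cinner x y\<close> reduces the complex inequality to the
  Cauchy-Schwarz inequality of the underlying real inner product.\<close>

lemma cmod_cinner_le: "cmod (cinner x y) \<le> norm x * norm y"
proof (cases "cinner x y = 0")
  case False
  define c where "c = cnj (cinner x y) / of_real (cmod (cinner x y))"
  have c: "cmod c = 1" using False by (simp add: c_def norm_divide)
  have "c * cinner x y = of_real (cmod (cinner x y))"
    using False complex_norm_square[of "cinner x y"]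
    by (simp add: c_def power2_eq_square mult.commute nonzero_divide_eq_eq)
  then have "inner x (c *\<^sub>C y) = cmod (cinner x y)"
    by (simp add: inner_ell2_def cinner_scaleC_right)
  moreover have "inner x (c *\<^sub>C y) \<le> norm x * norm (c *\<^sub>C y)" by (rule norm_cauchy_schwarz)
  ultimately show ?thesis by (simp add: norm_scaleC c)
qed simp

lemma bounded_linear_cinner_right: "bounded_linear (cinner x)"
proof (rule bounded_linear_intro[where K = "norm x"])
  show "cinner x (r *\<^sub>R y) = r *\<^sub>R cinner x y" for r y
    using cinner_scaleC_right[of x "of_real r" y] by (simp add: scaleC_of_real scaleR_conv_of_real)
  show "norm (cinner x y) \<le> norm y * norm x" for y
    using cmod_cinner_le[of x y] by (simp add: mult.commute)
qed (rule cinner_add_right)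

lemma bounded_linear_cinner_left: "bounded_linear (\<lambda>x. cinner x y)"
proof (rule bounded_linear_intro[where K = "norm y"])
  show "cinner (r *\<^sub>R x) y = r *\<^sub>R cinner x y" for r x
    using cinner_scaleC_left[of "of_real r" x y] by (simp add: scaleC_of_real scaleR_conv_of_real)
qed (rule cinner_add_left, rule cmod_cinner_le)

lemmas tendsto_cinner_left = bounded_linear.tendsto[OF bounded_linear_cinner_left]
lemmas tendsto_cinner_right = bounded_linear.tendsto[OF bounded_linear_cinner_right]
lemmas tendsto_scaleC = bounded_linear.tendsto[OF bounded_linear_scaleC]

lemma cinner_ell2_basis: "cinner (ell2_basis i) x = ell2_coeff x i"
proof -
  have "cinner (ell2_basis i) x = (\<Sum>\<^sub>\<infinity>j\<in>{i}. cnj (ell2_coeff (ell2_basis i) j) * ell2_coeff x j)"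
    unfolding cinner_def by (rule infsum_cong_neutral) (auto simp: ell2_basis.rep_eq)
  also have "\<dots> = ell2_coeff x i" by (simp add: ell2_basis.rep_eq)
  finally show ?thesis .
qed

lemma cinner_ext: "x = y" if "\<And>z. cinner z x = cinner z y"
  using that[of "ell2_basis _"]
  by (simp add: cinner_ell2_basis ell2_coeff_inject[symmetric] fun_eq_iff)

lemma norm_ell2_basis [simp]: "norm (ell2_basis i) = 1"
proof -
  have "of_real ((norm (ell2_basis i))\<^sup>2) = (1::complex)"
    unfolding cinner_self[symmetric] by (simp add: cinner_ell2_basis ell2_basis.rep_eq)
  then show ?thesis by (simp only: of_real_eq_1_iff power2_eq_1_iff) (use norm_ge_zero[of "ell2_basis i"] in linarith)
qed

lemma sum_coeff_le_norm_sq: "finite F \<Longrightarrow> (\<Sum>i\<in>F. (cmod (ell2_coeff x i))\<^sup>2) \<le> (norm x)\<^sup>2"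
  unfolding norm_sq_ell2 by (rule finite_sum_le_infsum) (auto simp: summable_ell2_coeff)

text \<open>A bound on all finite partial sums passes to coordinatewise limits; this produces the limit of
  a Cauchy sequence and shows that the convergence is in norm.\<close>

instance ell2 :: (type) banach
proof
  fix X :: "nat \<Rightarrow> 'a ell2"
  assume C: "Cauchy X"
  have "Cauchy (\<lambda>n. ell2_coeff (X n) i)" for i
    using bounded_linear.Cauchy[OF bounded_linear_cinner_right C, of "ell2_basis i"]
    by (simp add: cinner_ell2_basis)
  then have "\<exists>l. (\<lambda>n. ell2_coeff (X n) i) \<longlonglongrightarrow> l" for i
    using Cauchy_convergent_iff convergent_def by blast
  then obtain x where x: "\<And>i. (\<lambda>n. ell2_coeff (X n) i) \<longlonglongrightarrow> x i" by metis
  have part: "(\<Sum>i\<in>F. (cmod (ell2_coeff (X n) i - x i))\<^sup>2) \<le> e\<^sup>2"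
    if F: "finite F" and N: "\<And>m. m \<ge> N \<Longrightarrow> norm (X n - X m) \<le> e" for F n e N
  proof (rule tendsto_upperbound)
    show "(\<lambda>m. \<Sum>i\<in>F. (cmod (ell2_coeff (X n) i - ell2_coeff (X m) i))\<^sup>2)
        \<longlonglongrightarrow> (\<Sum>i\<in>F. (cmod (ell2_coeff (X n) i - x i))\<^sup>2)"
      by (intro tendsto_intros x)
    show "\<forall>\<^sub>F m in sequentially.
        (\<Sum>i\<in>F. (cmod (ell2_coeff (X n) i - ell2_coeff (X m) i))\<^sup>2) \<le> e\<^sup>2"
      using eventually_ge_at_top[of N]
    proof eventually_elim
      case (elim m)
      have "(\<Sum>i\<in>F. (cmod (ell2_coeff (X n - X m) i))\<^sup>2) \<le> (norm (X n - X m))\<^sup>2"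
        by (rule sum_coeff_le_norm_sq[OF F])
      also have "\<dots> \<le> e\<^sup>2" using N[OF elim] by (simp add: power_mono)
      finally show ?case by (simp add: minus_ell2.rep_eq)
    qed
  qed simp
  have tail: "\<exists>N. \<forall>n\<ge>N. \<forall>m\<ge>N. norm (X n - X m) \<le> e" if "e > 0" for e
    using C that by (meson CauchyD less_imp_le)
  have diff: "(\<lambda>i. (cmod (ell2_coeff (X n) i - x i))\<^sup>2) summable_on UNIV"
    if "\<And>m. m \<ge> N \<Longrightarrow> norm (X n - X m) \<le> e" for n e N
    using part[OF _ that] by (intro nonneg_bounded_partial_sums_imp_summable_on[where C = "e\<^sup>2"]) auto
  obtain N1 where "\<And>n m. n \<ge> N1 \<Longrightarrow> m \<ge> N1 \<Longrightarrow> norm (X n - X m) \<le> 1"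
    using tail[of 1] by auto
  then have "(\<lambda>i. (cmod (ell2_coeff (X N1) i - x i))\<^sup>2) summable_on UNIV"
    using diff[of N1 N1 1] by auto
  then have "(\<lambda>i. (cmod (- 1 * (ell2_coeff (X N1) i - x i)))\<^sup>2) summable_on UNIV"
    by (rule summable_norm_sq_scale)
  then have "(\<lambda>i. (cmod (ell2_coeff (X N1) i + - 1 * (ell2_coeff (X N1) i - x i)))\<^sup>2) summable_on UNIV"
    by (rule summable_norm_sq_add[OF summable_ell2_coeff])
  then have sx: "(\<lambda>i. (cmod (x i))\<^sup>2) summable_on UNIV" by simp
  define y where "y = Abs_ell2 x"
  have y: "ell2_coeff y = x" unfolding y_def using sx by (simp add: Abs_ell2_inverse)
  have "X \<longlonglongrightarrow> y"
  proof (rule LIMSEQ_I)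
    fix r :: real assume r: "r > 0"
    obtain N where N: "\<And>n m. n \<ge> N \<Longrightarrow> m \<ge> N \<Longrightarrow> norm (X n - X m) \<le> r / 2"
      using tail[of "r / 2"] r by auto
    have "norm (X n - y) < r" if n: "n \<ge> N" for n
    proof -
      have "(norm (X n - y))\<^sup>2 = (\<Sum>\<^sub>\<infinity>i. (cmod (ell2_coeff (X n) i - x i))\<^sup>2)"
        by (simp add: norm_sq_ell2 minus_ell2.rep_eq y)
      also have "\<dots> \<le> (r / 2)\<^sup>2"
        by (intro infsum_le_finite_sums diff[of N n "r / 2"] part[of _ N n "r / 2"] N[OF n])
      finally have "norm (X n - y) \<le> r / 2" by (rule power2_le_imp_le) (use r in simp)
      then show ?thesis using r by simp
    qed
    then show "\<exists>no. \<forall>n\<ge>no. norm (X n - y) < r" by blast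
  qed
  then show "convergent X" by (auto simp: convergent_def)
qed

lemma ell2_basis_sum_approx:
  assumes "e > 0"
  shows "\<exists>F. finite F \<and> norm (x - (\<Sum>i\<in>F. ell2_coeff x i *\<^sub>C ell2_basis i)) < e"
proof -
  let ?f = "\<lambda>i. (cmod (ell2_coeff x i))\<^sup>2"
  have "(?f has_sum (norm x)\<^sup>2) UNIV"
    unfolding norm_sq_ell2 by (rule has_sum_infsum[OF summable_ell2_coeff])
  then have "\<forall>\<^sub>F F in finite_subsets_at_top UNIV. dist (sum ?f F) ((norm x)\<^sup>2) < e\<^sup>2"
    using assms by (simp add: has_sum_def tendsto_iff)
  then obtain F where F: "finite F" and d: "dist (sum ?f F) ((norm x)\<^sup>2) < e\<^sup>2"
    by (auto simp: eventually_finite_subsets_at_top)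
  define s where "s = (\<Sum>i\<in>F. ell2_coeff x i *\<^sub>C ell2_basis i)"
  have s: "ell2_coeff s j = (if j \<in> F then ell2_coeff x j else 0)" for j
    unfolding s_def using F
    by (induction F rule: finite_induct)
      (auto simp: zero_ell2.rep_eq plus_ell2.rep_eq scaleC.rep_eq ell2_basis.rep_eq)
  have "(norm (x - s))\<^sup>2 + sum ?f F = (norm x)\<^sup>2"
  proof -
    have "(norm (x - s))\<^sup>2 = infsum ?f (UNIV - F)"
      unfolding norm_sq_ell2 by (rule infsum_cong_neutral) (auto simp: minus_ell2.rep_eq s)
    moreover have "infsum ?f (UNIV - F) = infsum ?f UNIV - infsum ?f F"
      using F by (intro infsum_Diff summable_ell2_coeff) auto
    ultimately show ?thesis using F by (simp add: norm_sq_ell2)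
  qed
  then have "(norm (x - s))\<^sup>2 < e\<^sup>2" using d by (simp add: dist_real_def)
  then have "norm (x - s) < e" by (rule power_less_imp_less_base) (use assms in simp)
  then show ?thesis using F by (auto simp: s_def)
qed

section \<open>Positive semi-definite forms\<close>

locale semidefinite_form =
  fixes D :: "'i ell2 set" and q :: "'i ell2 \<Rightarrow> 'i ell2 \<Rightarrow> complex"
  assumes psd: "psd_form D q"
begin

definition Q :: "'i ell2 \<Rightarrow> real"
  where "Q x = Re (q x x)"

lemma zero_mem: "0 \<in> D"
  and add_mem: "x \<in> D \<Longrightarrow> y \<in> D \<Longrightarrow> x + y \<in> D"
  and scaleC_mem: "x \<in> D \<Longrightarrow> c *\<^sub>C x \<in> D"
  and dense: "closure D = UNIV"
  and add_left: "x \<in> D \<Longrightarrow> y \<in> D \<Longrightarrow> z \<in> D \<Longrightarrow> q (x + y) z = q x z + q y z"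
  and add_right: "x \<in> D \<Longrightarrow> y \<in> D \<Longrightarrow> z \<in> D \<Longrightarrow> q z (x + y) = q z x + q z y"
  and scaleC_left: "x \<in> D \<Longrightarrow> y \<in> D \<Longrightarrow> q (c *\<^sub>C x) y = cnj c * q x y"
  and scaleC_right: "x \<in> D \<Longrightarrow> y \<in> D \<Longrightarrow> q x (c *\<^sub>C y) = c * q x y"
  and outside: "x \<notin> D \<or> y \<notin> D \<Longrightarrow> q x y = 0"
  using psd unfolding psd_form_def by blast+

lemma self_nonneg: "x \<in> D \<Longrightarrow> q x x \<in> \<real>\<^sub>\<ge>\<^sub>0"
  using psd unfolding psd_form_def by blast

lemma Q_nonneg: "0 \<le> Q x"
  using self_nonneg[of x] outside[of x x]
  by (cases "x \<in> D") (auto simp: Q_def complex_nonneg_Reals_iff)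

lemma q_self: "q x x = of_real (Q x)"
  using self_nonneg[of x] outside[of x x]
  by (cases "x \<in> D") (auto simp: Q_def complex_nonneg_Reals_iff complex_eq_iff)

lemma diff_mem: "x \<in> D \<Longrightarrow> y \<in> D \<Longrightarrow> x - y \<in> D"
  by (simp add: diff_eq_add_scaleC add_mem scaleC_mem)

lemma diff_left: "x \<in> D \<Longrightarrow> y \<in> D \<Longrightarrow> z \<in> D \<Longrightarrow> q (x - y) z = q x z - q y z"
  by (simp add: diff_eq_add_scaleC add_left scaleC_left scaleC_mem)

lemma diff_right: "x \<in> D \<Longrightarrow> y \<in> D \<Longrightarrow> z \<in> D \<Longrightarrow> q z (x - y) = q z x - q z y"
  by (simp add: diff_eq_add_scaleC add_right scaleC_right scaleC_mem)

lemma hermitian: "q y x = cnj (q x y)"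
proof (cases "x \<in> D \<and> y \<in> D")
  case True
  have expand: "q (x + c *\<^sub>C y) (x + c *\<^sub>C y)
      = q x x + cnj c * c * q y y + (c * q x y + cnj c * q y x)" for c
    using True by (simp add: add_left add_right scaleC_left scaleC_right scaleC_mem add_mem
        algebra_simps)
  have real: "Im (q z z) = 0" for z by (simp add: q_self)
  have "Im (q x y + q y x) = 0"
    using arg_cong[OF expand[of 1], of Im] real by simp
  moreover have "Im (\<i> * q x y + cnj \<i> * q y x) = 0"
    using arg_cong[OF expand[of \<i>], of Im] real by simp
  ultimately show ?thesis by (simp add: complex_eq_iff)
qed (use outside[of x y] outside[of y x] in auto)

lemma Q_add_scaleC:
  assumes "x \<in> D" "y \<in> D"
  shows "Q (x + c *\<^sub>C y) = Q x + (cmod c)\<^sup>2 * Q y + 2 * Re (c * q x y)"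
proof -
  have "q (x + c *\<^sub>C y) (x + c *\<^sub>C y) = q x x + (cnj c * c) * q y y + (c * q x y + cnj (c * q x y))"
    using assms hermitian[of y x]
    by (simp add: add_left add_right scaleC_left scaleC_right scaleC_mem add_mem algebra_simps)
  also have "cnj c * c = of_real ((cmod c)\<^sup>2)"
    using complex_norm_square[of c] by (simp add: mult.commute)
  finally show ?thesis unfolding q_self by (simp add: complex_eq_iff)
qed

lemma Q_add: "x \<in> D \<Longrightarrow> y \<in> D \<Longrightarrow> Q (x + y) = Q x + Q y + 2 * Re (q x y)"
  using Q_add_scaleC[of x y 1] by simp

lemma Q_scaleC: "x \<in> D \<Longrightarrow> Q (c *\<^sub>C x) = (cmod c)\<^sup>2 * Q x"
  using Q_add_scaleC[OF zero_mem, of x c] scaleC_left[OF zero_mem, of x 0]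
    scaleC_left[OF zero_mem zero_mem, of 0] by (simp add: Q_def)

lemma Q_minus_commute: "x \<in> D \<Longrightarrow> y \<in> D \<Longrightarrow> Q (x - y) = Q (y - x)"
  using Q_scaleC[OF diff_mem, of x y "-1"] by (simp add: scaleC_minus_one)

lemma parallelogram: "x \<in> D \<Longrightarrow> y \<in> D \<Longrightarrow> Q (x + y) + Q (x - y) = 2 * Q x + 2 * Q y"
  using Q_add_scaleC[of x y 1] Q_add_scaleC[of x y "-1"] by (simp add: scaleC_minus_one)

lemma cauchy_schwarz: "(cmod (q x y))\<^sup>2 \<le> Q x * Q y"
proof (cases "x \<in> D \<and> y \<in> D")
  case True
  define b where "b = q x y"
  \<comment> \<open>The value of \<open>Q\<close> at \<open>x - t (cnj b) y\<close>, a quadratic polynomial in \<open>t\<close>.\<close>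
  have le: "0 \<le> Q x + t\<^sup>2 * (cmod b)\<^sup>2 * Q y - 2 * t * (cmod b)\<^sup>2" for t :: real
  proof -
    have "Re ((- of_real t * cnj b) * b) = - t * (cmod b)\<^sup>2"
      by (simp add: cmod_def) (simp add: algebra_simps power2_eq_square)
    then show ?thesis
      using Q_add_scaleC[of x y "- of_real t * cnj b"] True
        Q_nonneg[of "x + (- of_real t * cnj b) *\<^sub>C y"]
      by (simp add: b_def[symmetric] norm_mult power_mult_distrib)
  qed
  show ?thesis
  proof (cases "Q y = 0")
    case True
    have "b = 0"
    proof (rule ccontr)
      assume "b \<noteq> 0"
      then show False using le[of "(Q x + 1) / (cmod b)\<^sup>2"] Q_nonneg[of x] True by simp
    qed
    then show ?thesis using True by (simp add: b_def)
  next
    case False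
    then have pos: "Q y > 0" using Q_nonneg[of y] by simp
    have "0 \<le> Q x - (cmod b)\<^sup>2 / Q y"
      using le[of "1 / Q y"] pos by (simp add: power2_eq_square field_simps)
    then show ?thesis using pos by (simp add: b_def field_simps)
  qed
qed (use outside[of x y] Q_nonneg[of x] Q_nonneg[of y] in auto)

lemma cmod_q_le: "cmod (q x y) \<le> sqrt (Q x) * sqrt (Q y)"
  unfolding real_sqrt_mult[symmetric] using cauchy_schwarz by (rule real_le_rsqrt)

lemma sqrt_Q_add_le:
  assumes "x \<in> D" "y \<in> D"
  shows "sqrt (Q (x + y)) \<le> sqrt (Q x) + sqrt (Q y)"
proof (rule real_le_lsqrt)
  have "Re (q x y) \<le> sqrt (Q x) * sqrt (Q y)"
    using cmod_q_le[of x y] complex_Re_le_cmod[of "q x y"] by simp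
  then show "Q (x + y) \<le> (sqrt (Q x) + sqrt (Q y))\<^sup>2"
    using Q_add[OF assms] by (simp add: power2_sum Q_nonneg)
qed (simp_all add: Q_nonneg)

lemma q_tendsto:
  assumes D: "\<And>n. X n \<in> D" "x \<in> D" "\<And>n. Y n \<in> D" "y \<in> D"
    and X: "(\<lambda>n. Q (X n - x)) \<longlonglongrightarrow> 0" and Y: "(\<lambda>n. Q (Y n - y)) \<longlonglongrightarrow> 0"
  shows "(\<lambda>n. q (X n) (Y n)) \<longlonglongrightarrow> q x y"
proof (rule LIM_zero_cancel, rule Lim_null_comparison)
  have sX: "(\<lambda>n. sqrt (Q (X n - x))) \<longlonglongrightarrow> 0" and sY: "(\<lambda>n. sqrt (Q (Y n - y))) \<longlonglongrightarrow> 0"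
    using tendsto_real_sqrt[OF X] tendsto_real_sqrt[OF Y] by simp_all
  have "(\<lambda>n. sqrt (Q (X n - x)) * (sqrt (Q (Y n - y)) + sqrt (Q y)) + sqrt (Q x) * sqrt (Q (Y n - y)))
      \<longlonglongrightarrow> 0 * (0 + sqrt (Q y)) + sqrt (Q x) * 0"
    by (intro tendsto_intros sX sY)
  then show "(\<lambda>n. sqrt (Q (X n - x)) * (sqrt (Q (Y n - y)) + sqrt (Q y))
      + sqrt (Q x) * sqrt (Q (Y n - y))) \<longlonglongrightarrow> 0" by simp
  have "norm (q (X n) (Y n) - q x y) \<le> sqrt (Q (X n - x)) * (sqrt (Q (Y n - y)) + sqrt (Q y))
      + sqrt (Q x) * sqrt (Q (Y n - y))" for n
  proof -
    have "q (X n) (Y n) - q x y = q (X n - x) (Y n) + q x (Y n - y)"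
      using D by (simp add: diff_left diff_right)
    then have "norm (q (X n) (Y n) - q x y) \<le> cmod (q (X n - x) (Y n)) + cmod (q x (Y n - y))"
      using norm_triangle_ineq by metis
    also have "\<dots> \<le> sqrt (Q (X n - x)) * sqrt (Q (Y n)) + sqrt (Q x) * sqrt (Q (Y n - y))"
      by (intro add_mono cmod_q_le)
    also have "sqrt (Q (Y n)) \<le> sqrt (Q (Y n - y)) + sqrt (Q y)"
      using sqrt_Q_add_le[OF diff_mem[OF D(3,4)] D(4), of n] by simp
    finally show ?thesis by (simp add: mult_left_mono Q_nonneg)
  qed
  then show "\<forall>\<^sub>F n in sequentially. norm (q (X n) (Y n) - q x y)
      \<le> sqrt (Q (X n - x)) * (sqrt (Q (Y n - y)) + sqrt (Q y)) + sqrt (Q x) * sqrt (Q (Y n - y))"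
    by simp
qed

lemma polarization:
  assumes "x \<in> D" "y \<in> D"
  shows "q x y = (of_real (Q (x + y)) - of_real (Q (x - y))
    - \<i> * of_real (Q (x + \<i> *\<^sub>C y)) + \<i> * of_real (Q (x - \<i> *\<^sub>C y))) / 4"
proof -
  have "Q (x + y) - Q (x - y) = 4 * Re (q x y)"
    using Q_add_scaleC[OF assms, of 1] Q_add_scaleC[OF assms, of "-1"]
    by (simp add: scaleC_minus_one)
  moreover have "x + (- \<i>) *\<^sub>C y = x - \<i> *\<^sub>C y"
    by (simp add: diff_eq_add_scaleC scaleC_scaleC)
  then have "Q (x + \<i> *\<^sub>C y) - Q (x - \<i> *\<^sub>C y) = - 4 * Im (q x y)"
    using Q_add_scaleC[OF assms, of \<i>] Q_add_scaleC[OF assms, of "-\<i>"] by simp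
  ultimately show ?thesis by (simp add: complex_eq_iff)
qed

end

lemma psd_form_ext:
  assumes p: "psd_form D p" and r: "psd_form D r"
    and eq: "\<And>x. x \<in> D \<Longrightarrow> Re (p x x) = Re (r x x)"
  shows "p = r"
proof -
  interpret p: semidefinite_form D p by unfold_locales (rule p)
  interpret r: semidefinite_form D r by unfold_locales (rule r)
  have "p.Q x = r.Q x" if "x \<in> D" for x using eq[OF that] by (simp add: p.Q_def r.Q_def)
  then have "p x y = r x y" if "x \<in> D" "y \<in> D" for x y
    using that p.add_mem p.diff_mem p.scaleC_mem by (simp add: p.polarization r.polarization)
  moreover have "p x y = r x y" if "x \<notin> D \<or> y \<notin> D" for x y
    using p.outside[OF that] r.outside[OF that] by simp
  ultimately show ?thesis by blast
qed

section \<open>The lower semicontinuous hull of a form\<close>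

context semidefinite_form
begin

text \<open>The bound \<open>hull_le x M\<close> says that the lower limit of \<open>Q y\<close>, for \<open>y\<close> in the domain tending to \<open>x\<close>,
  is at most \<open>M\<close>. Stating it with a real bound avoids extended real values; the vectors at which the
  lower limit is finite form \<open>hull_dom\<close>, and there \<open>hull_value\<close> is the lower limit.\<close>

definition hull_le :: "'i ell2 \<Rightarrow> real \<Rightarrow> bool"
  where "hull_le x M \<longleftrightarrow> (\<forall>e>0. \<exists>y\<in>D. norm (y - x) < e \<and> Q y < M + e)"

definition hull_dom :: "'i ell2 set"
  where "hull_dom = {x. \<exists>M. hull_le x M}"

definition hull_value :: "'i ell2 \<Rightarrow> real"
  where "hull_value x = Inf {M. hull_le x M}"

lemma hull_le_nonneg: "0 \<le> M" if "hull_le x M"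
proof (rule field_le_epsilon)
  fix e :: real assume "e > 0"
  then show "0 \<le> M + e" using that Q_nonneg unfolding hull_le_def by (meson less_imp_le order_trans)
qed

lemma hull_le_Q: "x \<in> D \<Longrightarrow> hull_le x (Q x)"
  unfolding hull_le_def by (auto intro!: bexI[of _ x])

lemma dom_subset_hull_dom: "D \<subseteq> hull_dom"
  using hull_le_Q by (auto simp: hull_dom_def)

lemma hull_value_le: "hull_value x \<le> M" if "hull_le x M"
  unfolding hull_value_def
  by (rule cInf_lower) (use that hull_le_nonneg in \<open>auto intro!: bdd_belowI[of _ 0]\<close>)

lemma hull_value_le_Q: "x \<in> D \<Longrightarrow> hull_value x \<le> Q x"
  by (intro hull_value_le hull_le_Q)

lemma hull_le_hull_value:
  assumes "x \<in> hull_dom"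
  shows "hull_le x (hull_value x)"
  unfolding hull_le_def
proof (intro allI impI)
  fix e :: real assume e: "e > 0"
  have "\<exists>M\<in>{M. hull_le x M}. M < hull_value x + e / 2"
    using assms e unfolding hull_value_def hull_dom_def by (intro cInf_lessD) auto
  then obtain M where M: "hull_le x M" "M < hull_value x + e / 2" by blast
  obtain y where "y \<in> D" "norm (y - x) < e / 2" "Q y < M + e / 2"
    using M(1) e unfolding hull_le_def by (meson half_gt_zero)
  then show "\<exists>y\<in>D. norm (y - x) < e \<and> Q y < hull_value x + e"
    using M(2) e by (intro bexI[of _ y]) auto
qed

lemma hull_value_nonneg: "x \<in> hull_dom \<Longrightarrow> 0 \<le> hull_value x"
  using hull_le_hull_value hull_le_nonneg by blast

text \<open>Sublevel sets of a lower limit are closed. In this form lower semicontinuity yields completeness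
  of the domain of the hull.\<close>

lemma hull_le_limit:
  assumes "\<And>e. e > 0 \<Longrightarrow> \<exists>v. norm (v - x) < e \<and> hull_le v (M + e)"
  shows "hull_le x M"
  unfolding hull_le_def
proof (intro allI impI)
  fix e :: real assume e: "e > 0"
  obtain v where v: "norm (v - x) < e / 2" "hull_le v (M + e / 2)"
    using assms[of "e / 2"] e by auto
  obtain y where y: "y \<in> D" "norm (y - v) < e / 2" "Q y < M + e / 2 + e / 2"
    using v(2) e unfolding hull_le_def by (meson half_gt_zero)
  have "norm (y - x) \<le> norm (y - v) + norm (v - x)"
    using norm_triangle_ineq[of "y - v" "v - x"] by simp
  then show "\<exists>y\<in>D. norm (y - x) < e \<and> Q y < M + e"
    using v(1) y by (intro bexI[of _ y]) auto
qed

lemma hull_value_lower_bound: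
  assumes "e > 0"
  obtains d where "d > 0" "\<And>y. y \<in> D \<Longrightarrow> norm (y - x) < d \<Longrightarrow> hull_value x - e < Q y"
proof -
  have "\<exists>d>0. \<forall>y\<in>D. norm (y - x) < d \<longrightarrow> hull_value x - e < Q y"
  proof (rule ccontr)
    assume "\<not> ?thesis"
    then have "hull_le x (hull_value x - e)"
      unfolding hull_le_def by (smt (verit, best))
    then show False using hull_value_le[of x "hull_value x - e"] assms by simp
  qed
  then show ?thesis using that by blast
qed

lemma hull_value_lower_bound_seq:
  assumes "\<And>n. X n \<in> D" "X \<longlonglongrightarrow> x" "e > 0"
  shows "\<forall>\<^sub>F n in sequentially. hull_value x - e < Q (X n)"
proof -
  obtain d where d: "d > 0" "\<And>y. y \<in> D \<Longrightarrow> norm (y - x) < d \<Longrightarrow> hull_value x - e < Q y"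
    using hull_value_lower_bound[OF assms(3)] by blast
  have "\<forall>\<^sub>F n in sequentially. norm (X n - x) < d"
    using tendstoD[OF assms(2) d(1)] by (simp add: dist_norm)
  then show ?thesis by eventually_elim (use d assms(1) in auto)
qed

lemma hull_value_lsc:
  assumes e: "e > 0"
  obtains d where "d > 0"
    "\<And>y. y \<in> hull_dom \<Longrightarrow> norm (y - x) < d \<Longrightarrow> hull_value x - e < hull_value y"
proof -
  obtain d where d: "d > 0" "\<And>y. y \<in> D \<Longrightarrow> norm (y - x) < d \<Longrightarrow> hull_value x - e / 2 < Q y"
    using hull_value_lower_bound[of "e / 2" x] e by auto
  have "hull_value x - e < hull_value y" if y: "y \<in> hull_dom" "norm (y - x) < d" for y
  proof -
    define r where "r = min (d - norm (y - x)) (e / 2)"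
    have r: "r > 0" "r \<le> d - norm (y - x)" "r \<le> e / 2"
      unfolding r_def using y(2) e by linarith+
    obtain z where z: "z \<in> D" "norm (z - y) < r" "Q z < hull_value y + r"
      using hull_le_hull_value[OF y(1)] r(1) unfolding hull_le_def by blast
    have "norm (z - x) \<le> norm (z - y) + norm (y - x)"
      using norm_triangle_ineq[of "z - y" "y - x"] by simp
    then have "norm (z - x) < d" using z(2) r(2) by linarith
    from d(2)[OF z(1) this] show ?thesis using z(3) r(3) by linarith
  qed
  then show ?thesis using that d(1) by blast
qed

lemma hull_le_seq:
  assumes "\<And>n. X n \<in> D" "X \<longlonglongrightarrow> x" "\<And>n. Q (X n) \<le> M"
  shows "hull_le x M"
  unfolding hull_le_def
proof (intro allI impI)
  fix e :: real assume e: "e > 0"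
  then obtain n where "norm (X n - x) < e"
    using LIMSEQ_D[OF assms(2)] by blast
  then show "\<exists>y\<in>D. norm (y - x) < e \<and> Q y < M + e"
    using assms(1)[of n] assms(3)[of n] e by (intro bexI[of _ "X n"]) auto
qed

text \<open>The recovery sequences of Gamma-convergence: they attain the lower limit that defines the hull.\<close>

definition recovers :: "(nat \<Rightarrow> 'i ell2) \<Rightarrow> 'i ell2 \<Rightarrow> bool"
  where "recovers X x \<longleftrightarrow>
    x \<in> hull_dom \<and> (\<forall>n. X n \<in> D) \<and> X \<longlonglongrightarrow> x \<and> (\<lambda>n. Q (X n)) \<longlonglongrightarrow> hull_value x"

text \<open>In the Hilbert space completion of the domain for \<open>Q\<close>, the weak limits of these sequences are the
  vectors that obstruct closability: they are limits for the form of what vanishes in the ambient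
  space.\<close>

definition bounded_null :: "(nat \<Rightarrow> 'i ell2) \<Rightarrow> bool"
  where "bounded_null W \<longleftrightarrow> (\<forall>n. W n \<in> D) \<and> W \<longlonglongrightarrow> 0 \<and> (\<exists>M. \<forall>n. Q (W n) \<le> M)"

lemma recovers_exists:
  assumes "x \<in> hull_dom"
  obtains X where "recovers X x"
proof -
  have "\<exists>y\<in>D. norm (y - x) < inverse (real (Suc n)) \<and> Q y < hull_value x + inverse (real (Suc n))"
    for n
    using hull_le_hull_value[OF assms] unfolding hull_le_def by auto
  then obtain X where X: "\<And>n. X n \<in> D" "\<And>n. norm (X n - x) < inverse (real (Suc n))"
    "\<And>n. Q (X n) < hull_value x + inverse (real (Suc n))"
    by metis
  have lim: "X \<longlonglongrightarrow> x"
  proof (rule LIM_zero_cancel, rule Lim_null_comparison)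
    show "\<forall>\<^sub>F n in sequentially. norm (X n - x) \<le> inverse (real (Suc n))"
      using X(2) by (simp add: less_imp_le)
  qed (rule LIMSEQ_inverse_real_of_nat)
  have "(\<lambda>n. Q (X n)) \<longlonglongrightarrow> hull_value x"
  proof (rule order_tendstoI)
    fix a assume "a < hull_value x"
    then show "\<forall>\<^sub>F n in sequentially. a < Q (X n)"
      using hull_value_lower_bound_seq[OF X(1) lim, of "hull_value x - a"] by simp
  next
    fix a assume "hull_value x < a"
    then have "\<forall>\<^sub>F n in sequentially. inverse (real (Suc n)) < a - hull_value x"
      using order_tendstoD(2)[OF LIMSEQ_inverse_real_of_nat] by simp
    then show "\<forall>\<^sub>F n in sequentially. Q (X n) < a"
      proof eventually_elim
      case (elim n)
      then show ?case using X(3)[of n] by linarith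
    qed
  qed
  then show ?thesis using that X(1) lim assms by (auto simp: recovers_def)
qed

lemma recovers_bounded:
  assumes "recovers X x"
  obtains M where "M > 0" "\<And>n. Q (X n) \<le> M"
proof -
  have "Bseq (\<lambda>n. Q (X n))"
    using assms by (auto simp: recovers_def intro!: convergent_imp_Bseq convergentI)
  then obtain M where "M > 0" "\<And>n. norm (Q (X n)) \<le> M" by (auto elim: BseqE)
  then show ?thesis using that[of M] by (auto simp: abs_le_iff)
qed

text \<open>Adding to \<open>X\<close> a multiple of \<open>W\<close> does not change the limit in the ambient space, so it cannot
  push \<open>Q\<close> below the hull in the limit; but a suitable multiple lowers \<open>Q (X n)\<close> by a fixed proportion
  of the squared modulus of \<open>q (X n) (W n)\<close>.\<close>

lemma recovers_orthogonal:
  assumes X: "recovers X x" and W: "bounded_null W"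
  shows "(\<lambda>n. q (X n) (W n)) \<longlonglongrightarrow> 0"
proof -
  obtain K where K: "K > 0" "\<And>n. Q (X n) \<le> K" using recovers_bounded[OF X] by blast
  obtain M' where M': "\<And>n. Q (W n) \<le> M'" using W by (auto simp: bounded_null_def)
  define M where "M = max M' 1"
  have M: "M > 0" "\<And>n. Q (W n) \<le> M" using M' by (auto simp: M_def le_max_iff_disj)
  have XD: "\<And>n. X n \<in> D" and WD: "\<And>n. W n \<in> D" and Wlim: "W \<longlonglongrightarrow> 0" and Xlim: "X \<longlonglongrightarrow> x"
    and Qlim: "(\<lambda>n. Q (X n)) \<longlonglongrightarrow> hull_value x"
    using X W by (auto simp: recovers_def bounded_null_def)
  define b where "b n = q (X n) (W n)" for n
  \<comment> \<open>The coefficient minimizes the upper bound for \<open>Q (X n + c W n)\<close> in which \<open>Q (W n)\<close> is replaced by \<open>M\<close>.\<close>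
  define Y where "Y n = X n + (- of_real (1 / M) * cnj (b n)) *\<^sub>C W n" for n
  have b: "cmod (b n) \<le> sqrt (K * M)" for n
    using cauchy_schwarz[of "X n" "W n"] mult_mono[OF K(2)[of n] M(2)[of n]] K(1) Q_nonneg[of "W n"]
    by (intro real_le_rsqrt) (auto simp: b_def)
  have YD: "Y n \<in> D" for n by (simp add: Y_def add_mem scaleC_mem XD WD)
  have "(\<lambda>n. (- of_real (1 / M) * cnj (b n)) *\<^sub>C W n) \<longlonglongrightarrow> 0"
  proof (rule Lim_null_comparison)
    show "\<forall>\<^sub>F n in sequentially. norm ((- of_real (1 / M) * cnj (b n)) *\<^sub>C W n)
        \<le> (sqrt (K * M) / M) * norm (W n)"
      using b M(1) by (auto simp: norm_scaleC norm_mult norm_divide divide_right_mono mult_right_mono)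
    show "(\<lambda>n. (sqrt (K * M) / M) * norm (W n)) \<longlonglongrightarrow> 0"
      using tendsto_norm_zero[OF Wlim] by (rule tendsto_mult_right_zero)
  qed
  then have Ylim: "Y \<longlonglongrightarrow> x" unfolding Y_def using tendsto_add[OF Xlim] by fastforce
  have QY: "Q (Y n) \<le> Q (X n) - (cmod (b n))\<^sup>2 / M" for n
  proof -
    have "Re ((- of_real (1 / M) * cnj (b n)) * b n) = - (1 / M) * (cmod (b n))\<^sup>2"
      by (simp add: cmod_def) (simp add: algebra_simps power2_eq_square add_divide_distrib)
    then have "Q (Y n) = Q (X n) + (cmod (b n) / M)\<^sup>2 * Q (W n) - 2 * ((cmod (b n))\<^sup>2 / M)"
      unfolding Y_def using Q_add_scaleC[OF XD[of n] WD[of n], of "- of_real (1 / M) * cnj (b n)"] M(1)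
      by (simp add: b_def[symmetric] norm_mult norm_divide)
    moreover have "(cmod (b n) / M)\<^sup>2 * Q (W n) \<le> (cmod (b n) / M)\<^sup>2 * M"
      by (rule mult_left_mono[OF M(2)]) simp
    moreover have "(cmod (b n) / M)\<^sup>2 * M = (cmod (b n))\<^sup>2 / M"
      using M(1) by (simp add: power2_eq_square)
    ultimately show ?thesis by simp
  qed
  have "(\<lambda>n. (cmod (b n))\<^sup>2 / M) \<longlonglongrightarrow> 0"
  proof (rule order_tendstoI)
    fix a :: real assume "a < 0"
    moreover have "0 \<le> (cmod (b n))\<^sup>2 / M" for n using M(1) by simp
    ultimately show "\<forall>\<^sub>F n in sequentially. a < (cmod (b n))\<^sup>2 / M"
      by (intro always_eventually allI) (rule less_le_trans)
  next
    fix a :: real assume a: "0 < a"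
    have "\<forall>\<^sub>F n in sequentially. Q (X n) < hull_value x + a / 2"
      using order_tendstoD(2)[OF Qlim] a by simp
    moreover have "\<forall>\<^sub>F n in sequentially. hull_value x - a / 2 < Q (Y n)"
      using hull_value_lower_bound_seq[of Y, OF YD Ylim] a by simp
    ultimately show "\<forall>\<^sub>F n in sequentially. (cmod (b n))\<^sup>2 / M < a"
    proof eventually_elim
      case (elim n)
      then show ?case using QY[of n] by linarith
    qed
  qed
  from tendsto_mult_right_zero[OF this, of M] have "(\<lambda>n. (cmod (b n))\<^sup>2) \<longlonglongrightarrow> 0" using M(1) by simp
  from tendsto_real_sqrt[OF this] have "(\<lambda>n. cmod (b n)) \<longlonglongrightarrow> 0" by simp
  then show ?thesis unfolding b_def by (rule tendsto_norm_zero_cancel)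
qed

lemma Q_add_le: "x \<in> D \<Longrightarrow> y \<in> D \<Longrightarrow> Q (x + y) \<le> 2 * Q x + 2 * Q y"
  using parallelogram[of x y] Q_nonneg[of "x - y"] by simp

lemma Q_diff_le: "x \<in> D \<Longrightarrow> y \<in> D \<Longrightarrow> Q (x - y) \<le> 2 * Q x + 2 * Q y"
  using parallelogram[of x y] Q_nonneg[of "x + y"] by simp

lemma bounded_null_diff:
  assumes "\<And>n. X n \<in> D" "X \<longlonglongrightarrow> x" "\<And>n. Q (X n) \<le> K"
    and "\<And>n. Y n \<in> D" "Y \<longlonglongrightarrow> x" "\<And>n. Q (Y n) \<le> M"
  shows "bounded_null (\<lambda>n. X n - Y n)"
proof -
  have "(\<lambda>n. X n - Y n) \<longlonglongrightarrow> 0" using tendsto_diff[OF assms(2,5)] by simp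
  moreover have "Q (X n - Y n) \<le> 2 * K + 2 * M" for n
    using Q_diff_le[OF assms(1,4), of n n] assms(3,6)[of n] by linarith
  ultimately show ?thesis using assms by (auto simp: bounded_null_def diff_mem)
qed

text \<open>Conversely, let \<open>X\<close> be orthogonal to bounded null sequences and compare it with a recovery
  sequence \<open>Y\<close> of the same vector: \<open>Y - X\<close> is a bounded null sequence, both \<open>X\<close> and \<open>Y\<close> are
  orthogonal to it, hence \<open>Q (X n)\<close> and \<open>Q (Y n)\<close> have the same limit.\<close>

lemma recoversI:
  assumes XD: "\<And>n. X n \<in> D" and lim: "X \<longlonglongrightarrow> x" and M: "\<And>n. Q (X n) \<le> M"
    and orth: "\<And>W. bounded_null W \<Longrightarrow> (\<lambda>n. q (X n) (W n)) \<longlonglongrightarrow> 0"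
  shows "recovers X x"
proof -
  have x: "x \<in> hull_dom" using hull_le_seq[OF XD lim M] by (auto simp: hull_dom_def)
  obtain Y where Y: "recovers Y x" using recovers_exists[OF x] by blast
  obtain K where K: "\<And>n. Q (Y n) \<le> K" using recovers_bounded[OF Y] by blast
  have YD: "\<And>n. Y n \<in> D" and Ylim: "Y \<longlonglongrightarrow> x" and QY: "(\<lambda>n. Q (Y n)) \<longlonglongrightarrow> hull_value x"
    using Y by (auto simp: recovers_def)
  define W where "W n = Y n - X n" for n
  have WD: "W n \<in> D" for n by (simp add: W_def diff_mem XD YD)
  have W: "bounded_null W" unfolding W_def by (rule bounded_null_diff[OF YD Ylim K XD lim M])
  have XW: "(\<lambda>n. q (X n) (W n)) \<longlonglongrightarrow> 0" by (rule orth[OF W])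
  have YW: "(\<lambda>n. q (Y n) (W n)) \<longlonglongrightarrow> 0" by (rule recovers_orthogonal[OF Y W])
  have "Q (X n) = Q (Y n) - Re (q (X n) (W n)) - Re (q (Y n) (W n))" for n
  proof -
    have "Q (Y n) = Q (X n) + Q (W n) + 2 * Re (q (X n) (W n))"
      using Q_add[OF XD WD, of n n] by (simp add: W_def)
    moreover have "q (Y n) (W n) = q (X n) (W n) + q (W n) (W n)"
      using add_left[OF XD[of n] WD[of n] WD[of n]] by (simp add: W_def)
    ultimately show ?thesis by (simp add: q_self)
  qed
  moreover have "(\<lambda>n. Q (Y n) - Re (q (X n) (W n)) - Re (q (Y n) (W n))) \<longlonglongrightarrow> hull_value x - Re 0 - Re 0"
    by (intro tendsto_diff tendsto_Re QY XW YW)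
  ultimately have "(\<lambda>n. Q (X n)) \<longlonglongrightarrow> hull_value x" by simp
  then show ?thesis using x XD lim by (simp add: recovers_def)
qed

text \<open>Orthogonality to the bounded null sequences is a linear condition on \<open>X\<close>, whereas attaining the
  lower limit is not visibly one. This linearity is what turns the hull into a sesquilinear form.\<close>

lemma recovers_add_scaleC:
  assumes X: "recovers X x" and Y: "recovers Y y"
  shows "recovers (\<lambda>n. X n + c *\<^sub>C Y n) (x + c *\<^sub>C y)"
proof -
  obtain K where K: "\<And>n. Q (X n) \<le> K" using recovers_bounded[OF X] by blast
  obtain M where M: "\<And>n. Q (Y n) \<le> M" using recovers_bounded[OF Y] by blast
  have XD: "\<And>n. X n \<in> D" and YD: "\<And>n. Y n \<in> D" and lim: "X \<longlonglongrightarrow> x" "Y \<longlonglongrightarrow> y"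
    using X Y by (auto simp: recovers_def)
  show ?thesis
  proof (rule recoversI)
    show "X n + c *\<^sub>C Y n \<in> D" for n by (simp add: add_mem scaleC_mem XD YD)
    show "(\<lambda>n. X n + c *\<^sub>C Y n) \<longlonglongrightarrow> x + c *\<^sub>C y" by (intro tendsto_add tendsto_scaleC lim)
    show "Q (X n + c *\<^sub>C Y n) \<le> 2 * K + 2 * ((cmod c)\<^sup>2 * M)" for n
    proof -
      have "Q (X n + c *\<^sub>C Y n) \<le> 2 * Q (X n) + 2 * ((cmod c)\<^sup>2 * Q (Y n))"
        using Q_add_le[OF XD[of n] scaleC_mem[OF YD[of n]]] by (simp add: Q_scaleC YD)
      also have "\<dots> \<le> 2 * K + 2 * ((cmod c)\<^sup>2 * M)"
        using K M by (intro add_mono mult_left_mono) auto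
      finally show ?thesis .
    qed
    fix W assume W: "bounded_null W"
    then have WD: "\<And>n. W n \<in> D" by (auto simp: bounded_null_def)
    have "(\<lambda>n. q (X n) (W n) + cnj c * q (Y n) (W n)) \<longlonglongrightarrow> 0 + cnj c * 0"
      by (intro tendsto_intros recovers_orthogonal[OF X W] recovers_orthogonal[OF Y W])
    then show "(\<lambda>n. q (X n + c *\<^sub>C Y n) (W n)) \<longlonglongrightarrow> 0"
      by (simp add: add_left scaleC_left XD YD WD scaleC_mem)
  qed
qed

lemma recovers_add: "recovers X x \<Longrightarrow> recovers Y y \<Longrightarrow> recovers (\<lambda>n. X n + Y n) (x + y)"
  using recovers_add_scaleC[of X x Y y 1] by simp

lemma recovers_diff: "recovers X x \<Longrightarrow> recovers Y y \<Longrightarrow> recovers (\<lambda>n. X n - Y n) (x - y)"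
  using recovers_add_scaleC[of X x Y y "-1"] by (simp add: scaleC_minus_one)

lemma recovers_zero: "recovers (\<lambda>_. 0) 0"
proof (rule recoversI[where M = "Q 0"])
  show "(\<lambda>n. q 0 (W n)) \<longlonglongrightarrow> 0" for W
  proof -
    have "q 0 w = 0" for w
      using scaleC_left[OF zero_mem, of w 0] outside[of 0 w] by (cases "w \<in> D") auto
    then show ?thesis by simp
  qed
qed (auto simp: zero_mem)

lemma recovers_scaleC: "recovers X x \<Longrightarrow> recovers (\<lambda>n. c *\<^sub>C X n) (c *\<^sub>C x)"
  using recovers_add_scaleC[OF recovers_zero, of X x c] by simp

text \<open>The polarization of \<open>hull_value\<close>.\<close>

definition hull_form :: "'i ell2 \<Rightarrow> 'i ell2 \<Rightarrow> complex"
  where "hull_form x y = (if x \<in> hull_dom \<and> y \<in> hull_dom then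
    (of_real (hull_value (x + y)) - of_real (hull_value (x - y))
      - \<i> * of_real (hull_value (x + \<i> *\<^sub>C y)) + \<i> * of_real (hull_value (x - \<i> *\<^sub>C y))) / 4
    else 0)"

lemma recovers_tendsto:
  assumes X: "recovers X x" and Y: "recovers Y y"
  shows "(\<lambda>n. q (X n) (Y n)) \<longlonglongrightarrow> hull_form x y"
proof -
  have lim: "(\<lambda>n. Q (V n)) \<longlonglongrightarrow> hull_value v" if "recovers V v" for V v
    using that by (simp add: recovers_def)
  have D: "\<And>n. X n \<in> D" "\<And>n. Y n \<in> D" and dom: "x \<in> hull_dom" "y \<in> hull_dom"
    using X Y by (auto simp: recovers_def)
  note Y' = recovers_scaleC[OF Y, of \<i>]
  show ?thesis
    using D dom unfolding hull_form_def
    by (simp add: polarization)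
      (intro tendsto_intros lim recovers_add recovers_diff X Y Y'; simp)
qed

lemma add_mem_hull_dom: "x \<in> hull_dom \<Longrightarrow> y \<in> hull_dom \<Longrightarrow> x + y \<in> hull_dom"
  using recovers_exists recovers_add by (metis recovers_def)

lemma scaleC_mem_hull_dom: "x \<in> hull_dom \<Longrightarrow> c *\<^sub>C x \<in> hull_dom"
  using recovers_exists recovers_scaleC by (metis recovers_def)

lemma hull_form_self:
  assumes "x \<in> hull_dom"
  shows "hull_form x x = of_real (hull_value x)"
proof -
  obtain X where X: "recovers X x" using recovers_exists[OF assms] by blast
  have "(\<lambda>n. q (X n) (X n)) \<longlonglongrightarrow> of_real (hull_value x)"
    unfolding q_self using X by (intro tendsto_of_real) (simp add: recovers_def)
  then show ?thesis using recovers_tendsto[OF X X] LIMSEQ_unique by blast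
qed

lemma hull_form_psd: "psd_form hull_dom hull_form"
proof -
  have add: "hull_form (x + y) z = hull_form x z + hull_form y z \<and>
      hull_form z (x + y) = hull_form z x + hull_form z y"
    if xyz: "x \<in> hull_dom" "y \<in> hull_dom" "z \<in> hull_dom" for x y z
  proof -
    obtain X Y Z where R: "recovers X x" "recovers Y y" "recovers Z z"
      using recovers_exists xyz by metis
    have D: "\<And>n. X n \<in> D" "\<And>n. Y n \<in> D" "\<And>n. Z n \<in> D" using R by (auto simp: recovers_def)
    have "(\<lambda>n. q (X n + Y n) (Z n)) \<longlonglongrightarrow> hull_form x z + hull_form y z"
      using D by (simp add: add_left) (intro tendsto_add recovers_tendsto R)
    moreover have "(\<lambda>n. q (Z n) (X n + Y n)) \<longlonglongrightarrow> hull_form z x + hull_form z y"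
      using D by (simp add: add_right) (intro tendsto_add recovers_tendsto R)
    ultimately show ?thesis
      using recovers_tendsto[OF recovers_add[OF R(1,2)] R(3)]
        recovers_tendsto[OF R(3) recovers_add[OF R(1,2)]] LIMSEQ_unique by blast
  qed
  have scale: "hull_form (c *\<^sub>C x) y = cnj c * hull_form x y \<and> hull_form x (c *\<^sub>C y) = c * hull_form x y"
    if xy: "x \<in> hull_dom" "y \<in> hull_dom" for c x y
  proof -
    obtain X Y where R: "recovers X x" "recovers Y y"
      using recovers_exists xy by metis
    have D: "\<And>n. X n \<in> D" "\<And>n. Y n \<in> D" using R by (auto simp: recovers_def)
    have "(\<lambda>n. q (c *\<^sub>C X n) (Y n)) \<longlonglongrightarrow> cnj c * hull_form x y"
      using D by (simp add: scaleC_left) (intro tendsto_mult_left recovers_tendsto R)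
    moreover have "(\<lambda>n. q (X n) (c *\<^sub>C Y n)) \<longlonglongrightarrow> c * hull_form x y"
      using D by (simp add: scaleC_right) (intro tendsto_mult_left recovers_tendsto R)
    ultimately show ?thesis
      using recovers_tendsto[OF recovers_scaleC[OF R(1)] R(2)]
        recovers_tendsto[OF R(1) recovers_scaleC[OF R(2)]] LIMSEQ_unique by blast
  qed
  have "closure hull_dom = UNIV"
    using closure_mono[OF dom_subset_hull_dom] dense by auto
  moreover have "0 \<in> hull_dom" using zero_mem dom_subset_hull_dom by blast
  moreover have "hull_form x x \<in> \<real>\<^sub>\<ge>\<^sub>0" if "x \<in> hull_dom" for x
    using hull_value_nonneg[OF that] by (simp add: hull_form_self[OF that])
  moreover have "hull_form x y = 0" if "x \<notin> hull_dom \<or> y \<notin> hull_dom" for x y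
    using that by (auto simp: hull_form_def)
  ultimately show ?thesis
    unfolding psd_form_def using add scale add_mem_hull_dom scaleC_mem_hull_dom
    by (intro conjI) simp_all
qed

text \<open>The midpoint of two late members of \<open>X\<close> is close to \<open>x\<close>, so \<open>Q\<close> is not much below the hull there;
  by the parallelogram law the difference of the two members is small.\<close>

lemma recovers_Cauchy:
  assumes X: "recovers X x" and e: "e > 0"
  shows "\<exists>N. \<forall>m\<ge>N. \<forall>n\<ge>N. Q (X m - X n) < e"
proof -
  have XD: "\<And>n. X n \<in> D" and lim: "X \<longlonglongrightarrow> x" and Qlim: "(\<lambda>n. Q (X n)) \<longlonglongrightarrow> hull_value x"
    using X by (auto simp: recovers_def)
  obtain d where d: "d > 0" "\<And>y. y \<in> D \<Longrightarrow> norm (y - x) < d \<Longrightarrow> hull_value x - e / 8 < Q y"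
    using hull_value_lower_bound[of "e / 8" x] e by auto
  have "\<forall>\<^sub>F n in sequentially. norm (X n - x) < d \<and> Q (X n) < hull_value x + e / 8"
    using tendstoD[OF lim d(1)] order_tendstoD(2)[OF Qlim, of "hull_value x + e / 8"] e
    by (simp add: dist_norm eventually_conj_iff)
  then obtain N where N: "\<And>n. n \<ge> N \<Longrightarrow> norm (X n - x) < d"
    "\<And>n. n \<ge> N \<Longrightarrow> Q (X n) < hull_value x + e / 8"
    by (auto simp: eventually_sequentially)
  have "Q (X m - X n) < e" if m: "m \<ge> N" and n: "n \<ge> N" for m n
  proof -
    let ?y = "(1/2) *\<^sub>R (X m + X n)"
    have yC: "?y = (1/2) *\<^sub>C (X m + X n)"
      using scaleC_of_real[of "1/2" "X m + X n"] by simp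
    have "?y - x = (1/2) *\<^sub>R ((X m - x) + (X n - x))"
      by (simp add: algebra_simps flip: scaleR_add_left)
    then have "norm (?y - x) \<le> (norm (X m - x) + norm (X n - x)) / 2"
      using norm_triangle_ineq[of "X m - x" "X n - x"] by simp
    then have "norm (?y - x) < d" using N(1)[OF m] N(1)[OF n] by simp
    then have "hull_value x - e / 8 < Q ?y"
      using XD by (intro d(2)) (auto simp: yC scaleC_mem add_mem)
    also have "Q ?y = Q (X m + X n) / 4"
      unfolding yC using XD by (simp add: Q_scaleC add_mem norm_divide power2_eq_square)
    finally show ?thesis
      using parallelogram[OF XD[of m] XD[of n]] N(2)[OF m] N(2)[OF n] by simp
  qed
  then show ?thesis by blast
qed

text \<open>A Cauchy sequence for the hull has a limit \<open>x\<close> in the ambient space, and lower semicontinuity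
  bounds the hull at \<open>X m - x\<close> by its values at \<open>X m - X n\<close> for late \<open>n\<close>.\<close>

lemma hull_form_closed: "closed_form hull_dom hull_form"
  unfolding closed_form_def
proof (intro conjI allI impI)
  show "psd_form hull_dom hull_form" by (rule hull_form_psd)
  interpret H: semidefinite_form hull_dom hull_form by unfold_locales (rule hull_form_psd)
  fix X :: "nat \<Rightarrow> 'i ell2"
  assume "(\<forall>n. X n \<in> hull_dom) \<and> (\<forall>e>0. \<exists>N. \<forall>m\<ge>N. \<forall>n\<ge>N. form_norm hull_form (X m - X n) < e)"
  then have XD: "\<And>n. X n \<in> hull_dom"
    and C: "\<And>e. e > 0 \<Longrightarrow> \<exists>N. \<forall>m\<ge>N. \<forall>n\<ge>N. form_norm hull_form (X m - X n) < e" by auto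
  have fn: "form_norm hull_form v = sqrt (H.Q v + (norm v)\<^sup>2)" for v
    by (simp add: form_norm_def H.Q_def)
  have HQ: "H.Q v = hull_value v" if "v \<in> hull_dom" for v
    using that by (simp add: H.Q_def hull_form_self)
  have norm_le: "norm v \<le> form_norm hull_form v" for v
    unfolding fn by (rule real_le_rsqrt) (simp add: H.Q_nonneg)
  have Q_le: "H.Q v \<le> (form_norm hull_form v)\<^sup>2" for v
    unfolding fn by (simp add: H.Q_nonneg)
  have "Cauchy X"
    unfolding Cauchy_iff using C norm_le by (meson le_less_trans)
  then obtain x where lim: "X \<longlonglongrightarrow> x" using Cauchy_convergent_iff convergent_def by blast
  have tail: "\<exists>N. \<forall>m\<ge>N. X m - x \<in> hull_dom \<and> form_norm hull_form (X m - x) \<le> 2 * e" if e: "e > 0" for e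
  proof -
    obtain N where N: "\<And>m n. m \<ge> N \<Longrightarrow> n \<ge> N \<Longrightarrow> form_norm hull_form (X m - X n) < e"
      using C[OF e] by blast
    have "X m - x \<in> hull_dom \<and> form_norm hull_form (X m - x) \<le> 2 * e" if m: "m \<ge> N" for m
    proof -
      have diff_lim: "(\<lambda>n. X m - X n) \<longlonglongrightarrow> X m - x" by (intro tendsto_diff tendsto_const lim)
      have le: "hull_le (X m - x) (e\<^sup>2)"
      proof (rule hull_le_limit)
        fix d :: real assume d: "d > 0"
        have "\<forall>\<^sub>F n in sequentially. norm ((X m - X n) - (X m - x)) < d \<and> n \<ge> N"
          using tendstoD[OF diff_lim d] eventually_ge_at_top[of N]
          unfolding dist_norm by eventually_elim simp
        then obtain n where n: "norm ((X m - X n) - (X m - x)) < d" "n \<ge> N"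
          by (metis (mono_tags, lifting) eventually_sequentially le_refl)
        have mem: "X m - X n \<in> hull_dom" using H.diff_mem XD by blast
        have "hull_value (X m - X n) \<le> (form_norm hull_form (X m - X n))\<^sup>2"
          using Q_le HQ[OF mem] by metis
        also have "\<dots> \<le> e\<^sup>2"
          using N[OF m n(2)] norm_le[of "X m - X n"] norm_ge_zero[of "X m - X n"]
          by (intro power_mono) linarith+
        finally have "hull_le (X m - X n) (e\<^sup>2 + d)"
          using hull_le_hull_value[OF mem] d unfolding hull_le_def by (smt (verit))
        then show "\<exists>v. norm (v - (X m - x)) < d \<and> hull_le v (e\<^sup>2 + d)" using n(1) by blast
      qed
      then have mem: "X m - x \<in> hull_dom" by (auto simp: hull_dom_def)
      have "norm (X m - x) \<le> e"
      proof (rule tendsto_upperbound[OF tendsto_norm[OF diff_lim]])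
        show "\<forall>\<^sub>F n in sequentially. norm (X m - X n) \<le> e"
          using eventually_ge_at_top[of N]
          by eventually_elim (use N[OF m] norm_le in \<open>meson less_imp_le order_trans\<close>)
      qed simp
      then have "(norm (X m - x))\<^sup>2 \<le> e\<^sup>2" by (simp add: power_mono)
      moreover have "H.Q (X m - x) \<le> e\<^sup>2" using hull_value_le[OF le] HQ[OF mem] by simp
      ultimately have "H.Q (X m - x) + (norm (X m - x))\<^sup>2 \<le> (2 * e)\<^sup>2"
        using zero_le_power2[of e] unfolding power_mult_distrib power2_eq_square[of 2] by linarith
      then have "form_norm hull_form (X m - x) \<le> 2 * e"
        unfolding fn using e by (intro real_le_lsqrt) auto
      then show ?thesis using mem by blast
    qed
    then show ?thesis by blast
  qed
  obtain m where "X m - x \<in> hull_dom" using tail[of 1] by auto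
  then have "X m - (X m - x) \<in> hull_dom" using XD H.diff_mem by blast
  then have x: "x \<in> hull_dom" by simp
  have "(\<lambda>n. form_norm hull_form (X n - x)) \<longlonglongrightarrow> 0"
  proof (rule LIMSEQ_I)
    fix r :: real assume r: "r > 0"
    obtain N where N: "\<And>m. m \<ge> N \<Longrightarrow> form_norm hull_form (X m - x) \<le> 2 * (r / 3)"
      using tail[of "r / 3"] r by auto
    have "norm (form_norm hull_form (X m - x) - 0) < r" if "m \<ge> N" for m
      using N[OF that] r norm_le[of "X m - x"] norm_ge_zero[of "X m - x"]
      unfolding real_norm_def by linarith
    then show "\<exists>no. \<forall>n\<ge>no. norm (form_norm hull_form (X n - x) - 0) < r" by blast
  qed
  then show "\<exists>x\<in>hull_dom. (\<lambda>n. form_norm hull_form (X n - x)) \<longlonglongrightarrow> 0" using x by blast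
qed

lemma tendsto_of_form_norm:
  assumes "(\<lambda>n. form_norm q (X n - x)) \<longlonglongrightarrow> 0"
  shows "X \<longlonglongrightarrow> x" "(\<lambda>n. Q (X n - x)) \<longlonglongrightarrow> 0"
proof -
  have fn: "form_norm q v = sqrt (Q v + (norm v)\<^sup>2)" for v
    by (simp add: form_norm_def Q_def)
  show "X \<longlonglongrightarrow> x"
  proof (rule LIM_zero_cancel, rule Lim_null_comparison[OF _ assms])
    show "\<forall>\<^sub>F n in sequentially. norm (X n - x) \<le> form_norm q (X n - x)"
      unfolding fn by (intro always_eventually allI real_le_rsqrt) (simp add: Q_nonneg)
  qed
  show "(\<lambda>n. Q (X n - x)) \<longlonglongrightarrow> 0"
  proof (rule Lim_null_comparison)
    show "\<forall>\<^sub>F n in sequentially. norm (Q (X n - x)) \<le> (form_norm q (X n - x))\<^sup>2"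
      unfolding fn by (simp add: Q_nonneg)
    show "(\<lambda>n. (form_norm q (X n - x))\<^sup>2) \<longlonglongrightarrow> 0"
      using tendsto_power[OF assms, of 2] by simp
  qed
qed

lemma closed_form_limit:
  assumes closed: "closed_form D q" and XD: "\<And>n. X n \<in> D" and lim: "X \<longlonglongrightarrow> x"
    and C: "\<And>e. e > 0 \<Longrightarrow> \<exists>N. \<forall>m\<ge>N. \<forall>n\<ge>N. Q (X m - X n) < e"
  shows "x \<in> D" "(\<lambda>n. Q (X n - x)) \<longlonglongrightarrow> 0"
proof -
  have "\<exists>N. \<forall>m\<ge>N. \<forall>n\<ge>N. form_norm q (X m - X n) < e" if e: "e > 0" for e
  proof -
    obtain N1 where N1: "\<And>m n. m \<ge> N1 \<Longrightarrow> n \<ge> N1 \<Longrightarrow> Q (X m - X n) < e\<^sup>2 / 2"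
      using C[of "e\<^sup>2 / 2"] e by auto
    have "Cauchy X" using lim by (rule LIMSEQ_imp_Cauchy)
    then obtain N2 where N2: "\<And>m n. m \<ge> N2 \<Longrightarrow> n \<ge> N2 \<Longrightarrow> norm (X m - X n) < e / 2"
      using CauchyD[of X "e / 2"] e by auto
    have "form_norm q (X m - X n) < e" if "m \<ge> max N1 N2" "n \<ge> max N1 N2" for m n
    proof -
      have "(norm (X m - X n))\<^sup>2 \<le> (e / 2)\<^sup>2"
        using N2[of m n] that by (intro power_mono) auto
      then have "Q (X m - X n) + (norm (X m - X n))\<^sup>2 < e\<^sup>2"
        using N1[of m n] that e by (simp add: power_divide) (smt (verit) zero_less_power)
      then have "sqrt (Q (X m - X n) + (norm (X m - X n))\<^sup>2) < sqrt (e\<^sup>2)"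
        by (rule real_sqrt_less_mono)
      then show ?thesis using e by (simp add: form_norm_def Q_def)
    qed
    then show ?thesis by blast
  qed
  then obtain y where y: "y \<in> D" "(\<lambda>n. form_norm q (X n - y)) \<longlonglongrightarrow> 0"
    using closed XD unfolding closed_form_def by blast
  have "x = y" using tendsto_of_form_norm(1)[OF y(2)] lim LIMSEQ_unique by blast
  then show "x \<in> D" "(\<lambda>n. Q (X n - x)) \<longlonglongrightarrow> 0" using y tendsto_of_form_norm(2) by auto
qed

text \<open>A recovery sequence is Cauchy for the form, so for a closed form it converges to \<open>x\<close> also in the
  form norm, and \<open>Q\<close> is continuous along it.\<close>

lemma closed_form_hull_value:
  assumes closed: "closed_form D q" and x: "x \<in> D"
  shows "hull_value x = Q x"
proof -
  obtain X where X: "recovers X x" using recovers_exists dom_subset_hull_dom x by blast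
  have XD: "\<And>n. X n \<in> D" and lim: "X \<longlonglongrightarrow> x" and Qlim: "(\<lambda>n. Q (X n)) \<longlonglongrightarrow> hull_value x"
    using X by (auto simp: recovers_def)
  have Q0: "(\<lambda>n. Q (X n - x)) \<longlonglongrightarrow> 0"
    using closed_form_limit(2)[OF closed XD lim] recovers_Cauchy[OF X] by blast
  have "sqrt (Q x) \<le> sqrt (hull_value x) + sqrt 0"
  proof (rule tendsto_lowerbound)
    show "(\<lambda>n. sqrt (Q (X n)) + sqrt (Q (X n - x))) \<longlonglongrightarrow> sqrt (hull_value x) + sqrt 0"
      by (intro tendsto_intros Qlim Q0)
    show "\<forall>\<^sub>F n in sequentially. sqrt (Q x) \<le> sqrt (Q (X n)) + sqrt (Q (X n - x))"
    proof (intro always_eventually allI)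
      fix n
      show "sqrt (Q x) \<le> sqrt (Q (X n)) + sqrt (Q (X n - x))"
        using sqrt_Q_add_le[OF XD[of n] diff_mem[OF x XD[of n]]] Q_minus_commute[OF x XD[of n]]
        by simp
    qed
  qed simp
  then show ?thesis using hull_value_le_Q[OF x] by simp
qed

section \<open>The absolutely continuous part of a form\<close>

definition hull_on_dom :: "'i ell2 \<Rightarrow> 'i ell2 \<Rightarrow> complex"
  where "hull_on_dom x y = (if x \<in> D \<and> y \<in> D then hull_form x y else 0)"

lemma hull_on_dom_self: "x \<in> D \<Longrightarrow> Re (hull_on_dom x x) = hull_value x"
  using hull_form_self[of x] dom_subset_hull_dom by (auto simp: hull_on_dom_def)

lemma hull_on_dom_psd: "psd_form D hull_on_dom"
proof -
  interpret H: semidefinite_form hull_dom hull_form by unfold_locales (rule hull_form_psd)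
  have sub: "x \<in> hull_dom" if "x \<in> D" for x using that dom_subset_hull_dom by blast
  show ?thesis
    unfolding psd_form_def hull_on_dom_def
    using sub by (auto simp: zero_mem add_mem scaleC_mem dense H.add_left H.add_right
        H.scaleC_left H.scaleC_right H.self_nonneg)
qed

lemma hull_on_dom_closable: "closable_form D hull_on_dom"
  unfolding closable_form_def
proof (intro conjI exI)
  show "closed_form hull_dom hull_form" by (rule hull_form_closed)
qed (simp_all add: hull_on_dom_psd dom_subset_hull_dom hull_on_dom_def)

text \<open>Passing to the hull is monotone in the form, and a closed extension of \<open>p\<close> is its own hull.\<close>

lemma closable_le_hull_value:
  assumes p: "closable_form D' p" and le: "form_le D' p D q" and x: "x \<in> D"
  shows "Re (p x x) \<le> hull_value x"
proof -
  obtain D'' p' where c: "closed_form D'' p'" "D' \<subseteq> D''" "\<forall>x\<in>D'. \<forall>y\<in>D'. p' x y = p x y"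
    using p unfolding closable_form_def by blast
  have sub: "D \<subseteq> D'" and ple: "\<And>y. y \<in> D \<Longrightarrow> Re (p y y) \<le> Q y"
    using le by (auto simp: form_le_def Q_def)
  interpret P: semidefinite_form D'' p'
    by unfold_locales (use c(1) in \<open>simp add: closed_form_def\<close>)
  have Ple: "y \<in> D'' \<and> P.Q y \<le> Q y" if "y \<in> D" for y
    using ple[OF that] sub c(2,3) that by (auto simp: P.Q_def)
  have "hull_le x (hull_value x)" using hull_le_hull_value dom_subset_hull_dom x by blast
  then have "P.hull_le x (hull_value x)"
    unfolding hull_le_def P.hull_le_def using Ple by (meson le_less_trans)
  then have "P.hull_value x \<le> hull_value x" by (rule P.hull_value_le)
  moreover have "P.hull_value x = P.Q x" using P.closed_form_hull_value[OF c(1)] Ple[OF x] by blast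
  ultimately show ?thesis using c(3) x sub by (auto simp: P.Q_def)
qed

text \<open>The theorem of Simon that the largest closable minorant exists, with its value: it is the lower
  semicontinuous hull.\<close>

lemma hull_on_dom_is_ac_part: "is_form_ac_part D q hull_on_dom"
  unfolding is_form_ac_part_def form_le_def
proof (intro conjI allI impI ballI)
  fix D' p x assume "closable_form D' p \<and> D \<subseteq> D' \<and> (\<forall>h\<in>D. Re (p h h) \<le> Re (q h h))" and x: "x \<in> D"
  then have "Re (p x x) \<le> hull_value x"
    by (intro closable_le_hull_value[of D']) (auto simp: form_le_def)
  then show "Re (p x x) \<le> Re (hull_on_dom x x)" using x by (simp add: hull_on_dom_self)
qed (use hull_on_dom_closable hull_value_le_Q in \<open>auto simp: hull_on_dom_self Q_def\<close>)

lemma form_ac_part_eq: "form_ac_part D q = hull_on_dom"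
  unfolding form_ac_part_def
proof (rule the_equality)
  fix r assume r: "is_form_ac_part D q r"
  have "form_le D r D hull_on_dom"
    using r hull_on_dom_is_ac_part unfolding is_form_ac_part_def by blast
  moreover have "form_le D hull_on_dom D r"
    using r hull_on_dom_is_ac_part unfolding is_form_ac_part_def by blast
  moreover have "psd_form D r" using r by (auto simp: is_form_ac_part_def closable_form_def)
  ultimately show "r = hull_on_dom"
    by (intro psd_form_ext[OF _ hull_on_dom_psd]) (auto simp: form_le_def intro!: antisym)
qed (rule hull_on_dom_is_ac_part)

lemma closable_form_limit:
  assumes closable: "closable_form D q" and XD: "\<And>n. X n \<in> D" and x: "x \<in> D" and lim: "X \<longlonglongrightarrow> x"
    and C: "\<And>e. e > 0 \<Longrightarrow> \<exists>N. \<forall>m\<ge>N. \<forall>n\<ge>N. Q (X m - X n) < e"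
  shows "(\<lambda>n. Q (X n - x)) \<longlonglongrightarrow> 0"
proof -
  obtain D' q' where c: "closed_form D' q'" "D \<subseteq> D'" "\<forall>x\<in>D. \<forall>y\<in>D. q' x y = q x y"
    using closable unfolding closable_form_def by blast
  interpret P: semidefinite_form D' q'
    by unfold_locales (use c(1) in \<open>simp add: closed_form_def\<close>)
  have eq: "P.Q v = Q v" if "v \<in> D" for v using that c(3) by (simp add: P.Q_def Q_def)
  have "(\<lambda>n. P.Q (X n - x)) \<longlonglongrightarrow> 0"
    by (rule P.closed_form_limit(2)[OF c(1) _ lim])
      (use XD c(2) C in \<open>auto simp: eq diff_mem\<close>)
  then show ?thesis by (simp add: eq diff_mem XD x)
qed

end

section \<open>Adjoints of operators on Fock space\<close>

lemma scaleC_op_add: "scaleC_op c (S + T) = scaleC_op c S + scaleC_op c T"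
  by (rule blinfun_eqI) (simp add: scaleC_op_apply blinfun.add_left scaleC_add_right)

lemma norm_scaleC_op_le: "norm (scaleC_op c T) \<le> cmod c * norm T"
  by (rule norm_blinfun_bound)
    (use norm_blinfun[of T] in \<open>auto simp: scaleC_op_apply norm_scaleC mult.assoc mult_left_mono\<close>)

lemma scaleC_op_minus_one: "scaleC_op (-1) T = - T"
  by (rule blinfun_eqI) (simp add: scaleC_op_apply scaleC_minus_one blinfun.minus_left)

lemma scaleC_op_one [simp]: "scaleC_op 1 T = T"
  by (rule blinfun_eqI) (simp add: scaleC_op_apply)

lemma scaleC_op_scaleC_op: "scaleC_op a (scaleC_op b T) = scaleC_op (a * b) T"
  by (rule blinfun_eqI) (simp add: scaleC_op_apply scaleC_scaleC)

lemma compose_scaleC_op_left: "scaleC_op c S o\<^sub>L T = scaleC_op c (S o\<^sub>L T)"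
  by (rule blinfun_eqI) (simp add: scaleC_op_apply)

lemma bounded_linear_scaleC_op: "bounded_linear (scaleC_op c)"
proof (rule bounded_linear_intro[where K = "cmod c"])
  show "scaleC_op c (r *\<^sub>R T) = r *\<^sub>R scaleC_op c T" for r and T :: "'d fock_op"
    by (rule blinfun_eqI)
      (simp add: scaleC_op_apply blinfun.scaleR_left scaleC_scaleC mult.commute flip: scaleC_of_real)
qed (use norm_scaleC_op_le in \<open>simp_all add: scaleC_op_add mult.commute\<close>)

lemmas tendsto_scaleC_op = bounded_linear.tendsto[OF bounded_linear_scaleC_op]

lemma tendsto_blinfun_apply_const: "(T \<longlongrightarrow> S) F \<Longrightarrow> ((\<lambda>n. blinfun_apply (T n) x) \<longlongrightarrow> blinfun_apply S x) F"
  by (rule bounded_linear.tendsto[OF blinfun.bounded_linear_left])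

lemma tendsto_compose_left: "(T \<longlongrightarrow> S) F \<Longrightarrow> ((\<lambda>n. T n o\<^sub>L R) \<longlongrightarrow> S o\<^sub>L R) F"
  by (rule bounded_linear.tendsto[OF bounded_bilinear.bounded_linear_left[OF
      bounded_bilinear_blinfun_compose]])

lemma tendsto_compose_right: "(T \<longlongrightarrow> S) F \<Longrightarrow> ((\<lambda>n. R o\<^sub>L T n) \<longlongrightarrow> R o\<^sub>L S) F"
  by (rule bounded_linear.tendsto[OF bounded_bilinear.bounded_linear_right[OF
      bounded_bilinear_blinfun_compose]])

lemma compose_add_left: "(S + T) o\<^sub>L R = (S o\<^sub>L R) + (T o\<^sub>L R)"
  by (rule blinfun_eqI) (simp add: blinfun.add_left)

lemma compose_add_right: "R o\<^sub>L (S + T) = (R o\<^sub>L S) + (R o\<^sub>L T)"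
  by (rule blinfun_eqI) (simp add: blinfun.add_left blinfun.add_right)

lemma compose_assoc: "(S o\<^sub>L T) o\<^sub>L R = S o\<^sub>L (T o\<^sub>L R)"
  by (rule blinfun_eqI) simp

lemma compose_id [simp]: "T o\<^sub>L id_blinfun = T" "id_blinfun o\<^sub>L T = T"
  by (rule blinfun_eqI, simp)+

text \<open>On a Hilbert space these are exactly the bounded complex-linear operators. They form a
  closed algebra, so membership propagates from the shifts to the free disk algebra and the free
  disk system.\<close>

definition adjointable :: "'d fock_op \<Rightarrow> bool"
  where "adjointable T \<longleftrightarrow> (\<exists>S. is_adjoint T S)"

lemma is_adjoint_unique:
  assumes "is_adjoint T S" "is_adjoint T S'"
  shows "S = S'"
proof (rule blinfun_eqI)
  fix x
  have "cinner y (blinfun_apply S x) = cinner y (blinfun_apply S' x)" for y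
    using assms cnj_cinner unfolding is_adjoint_def by metis
  then show "blinfun_apply S x = blinfun_apply S' x" by (rule cinner_ext)
qed

lemma adj_eqI: "adj T = S" if "is_adjoint T S"
  unfolding adj_def using that is_adjoint_unique by blast

lemma is_adjoint_adj: "is_adjoint T (adj T)" if "adjointable T"
  using that adj_eqI unfolding adjointable_def by metis

lemma cinner_adj_left:
  "adjointable T \<Longrightarrow> cinner (blinfun_apply (adj T) x) y = cinner x (blinfun_apply T y)"
  using is_adjoint_adj unfolding is_adjoint_def by blast

lemma cinner_adj_right:
  "adjointable T \<Longrightarrow> cinner x (blinfun_apply (adj T) y) = cinner (blinfun_apply T x) y"
  using cinner_adj_left[of T y x] cnj_cinner by metis

lemma is_adjoint_sym: "is_adjoint T S \<Longrightarrow> is_adjoint S T"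
  unfolding is_adjoint_def using cnj_cinner by metis

lemma adjointable_adj: "adjointable T \<Longrightarrow> adjointable (adj T)"
  using is_adjoint_adj is_adjoint_sym adjointable_def by blast

lemma adj_adj: "adjointable T \<Longrightarrow> adj (adj T) = T"
  by (rule adj_eqI[OF is_adjoint_sym[OF is_adjoint_adj]])

lemma is_adjoint_add: "is_adjoint T S \<Longrightarrow> is_adjoint T' S' \<Longrightarrow> is_adjoint (T + T') (S + S')"
  by (simp add: is_adjoint_def blinfun.add_left cinner_add_left cinner_add_right)

lemma is_adjoint_diff: "is_adjoint T S \<Longrightarrow> is_adjoint T' S' \<Longrightarrow> is_adjoint (T - T') (S - S')"
  by (simp add: is_adjoint_def blinfun.diff_left cinner_diff_left cinner_diff_right)

lemma is_adjoint_scaleC_op: "is_adjoint T S \<Longrightarrow> is_adjoint (scaleC_op c T) (scaleC_op (cnj c) S)"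
  by (simp add: is_adjoint_def scaleC_op_apply cinner_scaleC_left cinner_scaleC_right)

lemma is_adjoint_compose: "is_adjoint T S \<Longrightarrow> is_adjoint T' S' \<Longrightarrow> is_adjoint (T o\<^sub>L T') (S' o\<^sub>L S)"
  by (simp add: is_adjoint_def)

lemma is_adjoint_id: "is_adjoint id_blinfun id_blinfun"
  by (simp add: is_adjoint_def)

lemma adj_add: "adjointable S \<Longrightarrow> adjointable T \<Longrightarrow> adj (S + T) = adj S + adj T"
  by (intro adj_eqI is_adjoint_add is_adjoint_adj)

lemma adj_diff: "adjointable S \<Longrightarrow> adjointable T \<Longrightarrow> adj (S - T) = adj S - adj T"
  by (intro adj_eqI is_adjoint_diff is_adjoint_adj)

lemma adj_scaleC_op: "adjointable T \<Longrightarrow> adj (scaleC_op c T) = scaleC_op (cnj c) (adj T)"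
  by (intro adj_eqI is_adjoint_scaleC_op is_adjoint_adj)

lemma adj_compose: "adjointable S \<Longrightarrow> adjointable T \<Longrightarrow> adj (S o\<^sub>L T) = adj T o\<^sub>L adj S"
  by (intro adj_eqI is_adjoint_compose is_adjoint_adj)

lemma adj_id [simp]: "adj id_blinfun = id_blinfun"
  by (intro adj_eqI is_adjoint_id)

lemma adjointable_add: "adjointable S \<Longrightarrow> adjointable T \<Longrightarrow> adjointable (S + T)"
  using is_adjoint_add unfolding adjointable_def by blast

lemma adjointable_diff: "adjointable S \<Longrightarrow> adjointable T \<Longrightarrow> adjointable (S - T)"
  using is_adjoint_diff unfolding adjointable_def by blast

lemma adjointable_scaleC_op: "adjointable T \<Longrightarrow> adjointable (scaleC_op c T)"
  using is_adjoint_scaleC_op unfolding adjointable_def by blast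

lemma adjointable_compose: "adjointable S \<Longrightarrow> adjointable T \<Longrightarrow> adjointable (S o\<^sub>L T)"
  using is_adjoint_compose unfolding adjointable_def by blast

lemma adjointable_id: "adjointable id_blinfun"
  using is_adjoint_id adjointable_def by blast

lemma adjointable_apply_scaleC:
  assumes "adjointable T"
  shows "blinfun_apply T (c *\<^sub>C x) = c *\<^sub>C blinfun_apply T x"
  by (rule cinner_ext) (simp add: cinner_adj_left[OF assms, symmetric] cinner_scaleC_right)

lemma norm_is_adjoint_le: "norm S \<le> norm T" if "is_adjoint T S"
proof (rule norm_blinfun_bound)
  fix x
  let ?y = "blinfun_apply S x"
  have "(norm ?y)\<^sup>2 = cmod (cinner ?y ?y)" by (simp only: cinner_self norm_of_real) simp
  also have "\<dots> = cmod (cinner x (blinfun_apply T ?y))" using that by (simp add: is_adjoint_def)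
  also have "\<dots> \<le> norm x * norm (blinfun_apply T ?y)" by (rule cmod_cinner_le)
  also have "\<dots> \<le> norm x * (norm T * norm ?y)" by (intro mult_left_mono norm_blinfun) simp
  finally have "norm ?y * norm ?y \<le> (norm T * norm x) * norm ?y"
    by (simp add: power2_eq_square mult_ac)
  then show "norm ?y \<le> norm T * norm x"
    by (cases "norm ?y = 0") (simp_all add: mult_le_cancel_right)
qed simp

lemma norm_adj_le: "norm (adj T) \<le> norm T" if "adjointable T"
  using norm_is_adjoint_le[OF is_adjoint_adj[OF that]] .

text \<open>Taking adjoints does not increase norms, so the adjoints of a convergent sequence are Cauchy.\<close>

lemma adjointable_limit:
  assumes T: "\<And>n. adjointable (T n)" and lim: "T \<longlonglongrightarrow> T'"
  shows "adjointable T'" "(\<lambda>n. adj (T n)) \<longlonglongrightarrow> adj T'"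
proof -
  have "Cauchy (\<lambda>n. adj (T n))"
  proof (rule CauchyI)
    fix e :: real assume "e > 0"
    then obtain M where M: "\<And>m n. m \<ge> M \<Longrightarrow> n \<ge> M \<Longrightarrow> norm (T m - T n) < e"
      using CauchyD[OF LIMSEQ_imp_Cauchy[OF lim]] by metis
    have "norm (adj (T m) - adj (T n)) < e" if "m \<ge> M" "n \<ge> M" for m n
      using M[OF that] norm_adj_le[OF adjointable_diff[OF T T], of m n] by (simp add: adj_diff T)
    then show "\<exists>M. \<forall>m\<ge>M. \<forall>n\<ge>M. norm (adj (T m) - adj (T n)) < e" by blast
  qed
  then obtain S where S: "(\<lambda>n. adj (T n)) \<longlonglongrightarrow> S"
    using Cauchy_convergent_iff convergent_def by blast
  have "is_adjoint T' S"
    unfolding is_adjoint_def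
  proof (intro allI)
    fix x y
    have "(\<lambda>n. cinner (blinfun_apply (adj (T n)) x) y) \<longlonglongrightarrow> cinner (blinfun_apply S x) y"
      by (intro tendsto_cinner_left tendsto_blinfun_apply_const S)
    moreover have "(\<lambda>n. cinner x (blinfun_apply (T n) y)) \<longlonglongrightarrow> cinner x (blinfun_apply T' y)"
      by (intro tendsto_cinner_right tendsto_blinfun_apply_const lim)
    ultimately show "cinner (blinfun_apply S x) y = cinner x (blinfun_apply T' y)"
      using LIMSEQ_unique by (simp add: cinner_adj_left T)
  qed
  then show "adjointable T'" "(\<lambda>n. adj (T n)) \<longlonglongrightarrow> adj T'"
    using S adj_eqI adjointable_def by blast+
qed

lemma op_positive_conj: "op_positive (adj B o\<^sub>L (T o\<^sub>L B))" if "op_positive T" "adjointable B"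
  using that by (simp add: op_positive_def cinner_adj_right)

text \<open>The quadratic form of a self-adjoint operator is real, and by Cauchy-Schwarz its modulus is at
  most \<open>norm T\<close> times the square of the norm.\<close>

lemma op_positive_norm_minus:
  assumes T: "adjointable T" "adj T = T"
  shows "op_positive (scaleC_op (of_real (norm T)) id_blinfun - T)"
    "op_positive (scaleC_op (of_real (norm T)) id_blinfun + T)"
proof -
  define r where "r x = Re (cinner x (blinfun_apply T x))" for x
  have r: "cinner x (blinfun_apply T x) = of_real (r x)" "\<bar>r x\<bar> \<le> norm T * (norm x)\<^sup>2" for x
  proof -
    have "cnj (cinner x (blinfun_apply T x)) = cinner x (blinfun_apply T x)"
      using cinner_adj_right[OF T(1), of x x] T(2) by (simp add: cnj_cinner)
    then show "cinner x (blinfun_apply T x) = of_real (r x)"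
      by (simp add: r_def complex_eq_iff)
    have "\<bar>r x\<bar> \<le> norm x * norm (blinfun_apply T x)"
      unfolding r_def using abs_Re_le_cmod cmod_cinner_le order_trans by blast
    also have "\<dots> \<le> norm x * (norm T * norm x)" by (intro mult_left_mono norm_blinfun) simp
    finally show "\<bar>r x\<bar> \<le> norm T * (norm x)\<^sup>2"
      by (simp add: power2_eq_square mult_ac)
  qed
  have "cinner x (blinfun_apply (scaleC_op (of_real (norm T)) id_blinfun - T) x)
      = of_real (norm T * (norm x)\<^sup>2 - r x)"
    "cinner x (blinfun_apply (scaleC_op (of_real (norm T)) id_blinfun + T) x)
      = of_real (norm T * (norm x)\<^sup>2 + r x)" for x
    by (simp_all add: blinfun.diff_left blinfun.add_left scaleC_op_apply cinner_diff_right
        cinner_add_right r(1) cinner_scaleC_right cinner_self)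
  moreover have "0 \<le> norm T * (norm x)\<^sup>2 - r x" "0 \<le> norm T * (norm x)\<^sup>2 + r x" for x
    using r(2)[of x] by linarith+
  ultimately show "op_positive (scaleC_op (of_real (norm T)) id_blinfun - T)"
    "op_positive (scaleC_op (of_real (norm T)) id_blinfun + T)"
    unfolding op_positive_def by (simp_all only: nonneg_Reals_of_real_iff simp_thms)
qed

section \<open>The free disk algebra and the free disk system\<close>

abbreviation vacuum :: "'d fock"
  where "vacuum \<equiv> ell2_basis []"

lemma free_disk_algebra_props:
  shows left_shift_mem: "left_shift k \<in> free_disk_algebra"
    and unital_subalgebra_disk: "unital_subalgebra free_disk_algebra"
    and closed_disk: "closed free_disk_algebra"
proof -
  have "unital_subalgebra (\<Inter>\<A>) \<and> closed (\<Inter>\<A>)"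
    if "\<And>A. A \<in> \<A> \<Longrightarrow> unital_subalgebra A \<and> closed A" for \<A> :: "'d fock_op set set"
    using that by (auto simp: unital_subalgebra_def intro!: closed_Inter)
  then have "unital_subalgebra (free_disk_algebra :: 'd fock_op set) \<and>
      closed (free_disk_algebra :: 'd fock_op set)"
    unfolding free_disk_algebra_def by (rule hull_in) blast
  then show "unital_subalgebra (free_disk_algebra :: 'd fock_op set)"
    "closed (free_disk_algebra :: 'd fock_op set)" by auto
  show "left_shift k \<in> free_disk_algebra"
    unfolding free_disk_algebra_def by (rule subsetD[OF hull_subset]) simp
qed

lemma disk_id: "id_blinfun \<in> free_disk_algebra"
  and disk_add: "a \<in> free_disk_algebra \<Longrightarrow> b \<in> free_disk_algebra \<Longrightarrow> a + b \<in> free_disk_algebra"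
  and disk_scaleC_op: "a \<in> free_disk_algebra \<Longrightarrow> scaleC_op c a \<in> free_disk_algebra"
  and disk_compose: "a \<in> free_disk_algebra \<Longrightarrow> b \<in> free_disk_algebra \<Longrightarrow> a o\<^sub>L b \<in> free_disk_algebra"
  using unital_subalgebra_disk unfolding unital_subalgebra_def by blast+

lemma disk_diff: "a \<in> free_disk_algebra \<Longrightarrow> b \<in> free_disk_algebra \<Longrightarrow> a - b \<in> free_disk_algebra"
  using disk_add[of a "scaleC_op (-1) b"] disk_scaleC_op[of b "-1"] by (simp add: scaleC_op_minus_one)

lemma disk_zero: "0 \<in> free_disk_algebra"
  using disk_diff[OF disk_id disk_id] by simp

text \<open>The free disk algebra is the least closed unital algebra that contains the shifts. Its
  structural properties below are obtained by this induction.\<close>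

lemma disk_induct [consumes 1, case_names shift id add scaleC compose limit]:
  assumes a: "a \<in> free_disk_algebra"
    and shift: "\<And>k. P (left_shift k)"
    and id: "P id_blinfun"
    and add: "\<And>a b. a \<in> free_disk_algebra \<Longrightarrow> b \<in> free_disk_algebra \<Longrightarrow> P a \<Longrightarrow> P b \<Longrightarrow> P (a + b)"
    and scaleC: "\<And>c a. a \<in> free_disk_algebra \<Longrightarrow> P a \<Longrightarrow> P (scaleC_op c a)"
    and compose: "\<And>a b. a \<in> free_disk_algebra \<Longrightarrow> b \<in> free_disk_algebra \<Longrightarrow> P a \<Longrightarrow> P b \<Longrightarrow> P (a o\<^sub>L b)"
    and limit: "\<And>u a. (\<And>n::nat. u n \<in> free_disk_algebra) \<Longrightarrow> (\<And>n. P (u n)) \<Longrightarrow> u \<longlonglongrightarrow> a \<Longrightarrow>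
      a \<in> free_disk_algebra \<Longrightarrow> P a"
  shows "P a"
proof -
  let ?S = "{a \<in> free_disk_algebra. P a}"
  have "unital_subalgebra ?S"
    unfolding unital_subalgebra_def
    by (intro conjI ballI allI)
      (simp_all add: id add scaleC compose disk_id disk_add disk_scaleC_op disk_compose)
  moreover have "closed ?S"
    unfolding closed_sequential_limits
  proof (intro allI impI)
    fix u l assume u: "(\<forall>n. u n \<in> ?S) \<and> u \<longlonglongrightarrow> l"
    then have "l \<in> free_disk_algebra"
      using closed_sequentially[OF closed_disk] by blast
    then show "l \<in> ?S" using limit[of u l] u by blast
  qed
  moreover have "range left_shift \<subseteq> ?S" using shift left_shift_mem by auto
  ultimately have "(\<lambda>A. unital_subalgebra A \<and> closed A) hull range left_shift \<subseteq> ?S"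
    by (intro hull_minimal conjI)
  then show ?thesis using a unfolding free_disk_algebra_def[symmetric] by blast
qed

lemma infsum_Cons:
  fixes f :: "'d list \<Rightarrow> complex"
  assumes "\<And>w. w \<notin> range ((#) k) \<Longrightarrow> f w = 0"
  shows "infsum f UNIV = (\<Sum>\<^sub>\<infinity>v. f (k # v))"
proof -
  have "infsum f UNIV = infsum f (range ((#) k))"
    by (rule infsum_cong_neutral) (use assms in auto)
  then show ?thesis using infsum_reindex[of "(#) k" UNIV f] by (simp add: comp_def)
qed

text \<open>The adjoint of the left shift by \<open>k\<close>, which strips a leading letter \<open>k\<close>.\<close>

lift_definition backshift_fun :: "'d \<Rightarrow> 'd fock \<Rightarrow> 'd fock"
  is "\<lambda>k x v. x (k # v)"
proof -
  fix k :: 'd and x :: "'d list \<Rightarrow> complex"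
  assume "(\<lambda>w. (cmod (x w))\<^sup>2) summable_on UNIV"
  then have "(\<lambda>w. (cmod (x w))\<^sup>2) summable_on range ((#) k)"
    by (rule summable_on_subset_banach) simp
  then show "(\<lambda>v. (cmod (x (k # v)))\<^sup>2) summable_on UNIV"
    using summable_on_reindex[of "(#) k" UNIV "\<lambda>w. (cmod (x w))\<^sup>2"] by (simp add: comp_def)
qed

lemma norm_backshift_fun: "norm (backshift_fun k x) \<le> norm x"
proof -
  have "(\<Sum>\<^sub>\<infinity>v. (cmod (ell2_coeff x (k # v)))\<^sup>2)
      = (\<Sum>\<^sub>\<infinity>w\<in>range ((#) k). (cmod (ell2_coeff x w))\<^sup>2)"
    using infsum_reindex[of "(#) k" UNIV "\<lambda>w. (cmod (ell2_coeff x w))\<^sup>2"] by (simp add: comp_def)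
  also have "\<dots> \<le> (\<Sum>\<^sub>\<infinity>w. (cmod (ell2_coeff x w))\<^sup>2)"
    by (rule infsum_mono_neutral)
      (auto intro: summable_ell2_coeff summable_on_subset_banach[OF summable_ell2_coeff])
  finally show ?thesis
    unfolding norm_ell2_def by (simp add: backshift_fun.rep_eq)
qed

definition backshift :: "'d \<Rightarrow> 'd fock_op"
  where "backshift k = Blinfun (backshift_fun k)"

lemma backshift_apply: "blinfun_apply (backshift k) = backshift_fun k"
  unfolding backshift_def
proof (rule bounded_linear_Blinfun_apply)
  show "bounded_linear (backshift_fun k)"
  proof (rule bounded_linear_intro[where K = 1])
    show "backshift_fun k (x + y) = backshift_fun k x + backshift_fun k y" for x y
      by transfer simp
    show "backshift_fun k (r *\<^sub>R x) = r *\<^sub>R backshift_fun k x" for r x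
      by transfer simp
  qed (simp add: norm_backshift_fun)
qed

lemma is_adjoint_left_shift: "is_adjoint (left_shift k) (backshift k)"
  unfolding is_adjoint_def left_shift_apply backshift_apply
proof (intro allI)
  fix x y :: "'a fock"
  have "cinner x (shift_fun k y) = (\<Sum>\<^sub>\<infinity>v. cnj (ell2_coeff x (k # v)) * ell2_coeff (shift_fun k y) (k # v))"
    unfolding cinner_def
    by (rule infsum_Cons) (auto simp: shift_fun.rep_eq split: list.split)
  then show "cinner (backshift_fun k x) y = cinner x (shift_fun k y)"
    by (simp add: cinner_def backshift_fun.rep_eq shift_fun.rep_eq)
qed

lemma adj_left_shift: "adj (left_shift k) = backshift k"
  by (rule adj_eqI[OF is_adjoint_left_shift])

lemma adjointable_backshift: "adjointable (backshift k)"
  unfolding adjointable_def by (rule exI, rule is_adjoint_sym[OF is_adjoint_left_shift])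

lemma backshift_left_shift: "backshift k o\<^sub>L left_shift j = (if j = k then id_blinfun else 0)"
proof (rule blinfun_eqI)
  fix x :: "'a fock"
  have "backshift_fun k (shift_fun j x) = (if j = k then x else 0)"
    by (transfer fixing: j k) auto
  then show "blinfun_apply (backshift k o\<^sub>L left_shift j) x
      = blinfun_apply (if j = k then id_blinfun else 0) x"
    by (simp add: backshift_apply left_shift_apply)
qed

lemma disk_adjointable: "adjointable a" if "a \<in> free_disk_algebra"
  using that
proof (induction rule: disk_induct)
  case (shift k)
  show ?case unfolding adjointable_def using is_adjoint_left_shift by (rule exI)
next
  case (limit u a)
  show ?case by (rule adjointable_limit(1)[OF limit(4,2)])
qed (auto intro: adjointable_id adjointable_add adjointable_scaleC_op adjointable_compose)

text \<open>The vacuum is a joint eigenvector of the adjoints of the free disk algebra, since every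
  backward shift annihilates it. In particular the constant term is multiplicative.\<close>

lemma cinner_vacuum_apply:
  "cinner vacuum (blinfun_apply a x) = cinner vacuum (blinfun_apply a vacuum) * cinner vacuum x"
  if "a \<in> free_disk_algebra"
  using that
proof (induction arbitrary: x rule: disk_induct)
  case (shift k)
  show ?case by (simp add: cinner_ell2_basis left_shift_apply shift_fun.rep_eq)
next
  case id
  show ?case by (simp add: cinner_self)
next
  case (add a b)
  show ?case
    unfolding blinfun.add_left cinner_add_right add(3)[of x] add(4)[of x]
    by (simp add: distrib_right)
next
  case (scaleC c a)
  show ?case
    unfolding scaleC_op_apply cinner_scaleC_right scaleC(2)[of x] by simp
next
  case (compose a b)
  show ?case
    unfolding blinfun_apply_blinfun_compose
    by (metis (no_types) compose(3,4) mult.assoc)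
next
  case (limit u a)
  have "(\<lambda>n. cinner vacuum (blinfun_apply (u n) x)) \<longlonglongrightarrow> cinner vacuum (blinfun_apply a x)"
    by (intro tendsto_cinner_right tendsto_blinfun_apply_const limit)
  moreover have "(\<lambda>n. cinner vacuum (blinfun_apply (u n) vacuum) * cinner vacuum x)
      \<longlonglongrightarrow> cinner vacuum (blinfun_apply a vacuum) * cinner vacuum x"
    by (intro tendsto_mult_right tendsto_cinner_right tendsto_blinfun_apply_const limit)
  ultimately show ?case
    unfolding limit(4)[of _ x] by (rule LIMSEQ_unique)
qed

text \<open>After its constant term has been removed, an element of the algebra is a combination of the
  left shifts with coefficients in the algebra, and the adjoint of a shift selects a coefficient.\<close>

lemma backshift_disk:
  "backshift k o\<^sub>L (a - scaleC_op (cinner vacuum (blinfun_apply a vacuum)) id_blinfun) \<in> free_disk_algebra"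
  if "a \<in> free_disk_algebra"
  using that
proof (induction rule: disk_induct)
  case (shift j)
  have "cinner vacuum (blinfun_apply (left_shift j) vacuum) = 0"
    by (simp add: left_shift_basis cinner_ell2_basis ell2_basis.rep_eq)
  moreover have "scaleC_op 0 id_blinfun = (0 :: 'a fock_op)"
    by (rule blinfun_eqI) (simp add: scaleC_op_apply)
  ultimately show ?case by (simp add: backshift_left_shift disk_id disk_zero)
next
  case id
  have "cinner vacuum (vacuum :: 'a fock) = 1" by (simp add: cinner_self)
  moreover have "backshift k o\<^sub>L 0 = (0 :: 'a fock_op)" by (rule blinfun_eqI) simp
  ultimately show ?case by (simp add: disk_zero)
next
  case (add a b)
  have "backshift k o\<^sub>L (a + b - scaleC_op (cinner vacuum (blinfun_apply (a + b) vacuum)) id_blinfun)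
     = (backshift k o\<^sub>L (a - scaleC_op (cinner vacuum (blinfun_apply a vacuum)) id_blinfun))
      + (backshift k o\<^sub>L (b - scaleC_op (cinner vacuum (blinfun_apply b vacuum)) id_blinfun))"
    by (rule blinfun_eqI)
      (simp add: blinfun.add_left blinfun.diff_left blinfun.add_right blinfun.diff_right
        scaleC_op_apply cinner_add_right scaleC_add_left)
  then show ?case using add by (simp add: disk_add)
next
  case (scaleC c a)
  have "backshift k o\<^sub>L (scaleC_op c a
        - scaleC_op (cinner vacuum (blinfun_apply (scaleC_op c a) vacuum)) id_blinfun)
     = scaleC_op c (backshift k o\<^sub>L (a - scaleC_op (cinner vacuum (blinfun_apply a vacuum)) id_blinfun))"
  proof (rule blinfun_eqI)
    fix x
    show "blinfun_apply (backshift k o\<^sub>L (scaleC_op c a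
        - scaleC_op (cinner vacuum (blinfun_apply (scaleC_op c a) vacuum)) id_blinfun)) x
      = blinfun_apply (scaleC_op c
        (backshift k o\<^sub>L (a - scaleC_op (cinner vacuum (blinfun_apply a vacuum)) id_blinfun))) x"
      by (simp add: blinfun.diff_left blinfun.diff_right scaleC_op_apply cinner_scaleC_right
          adjointable_apply_scaleC[OF adjointable_backshift] scaleC_scaleC scaleC_diff_right)
  qed
  then show ?case using scaleC by (simp add: disk_scaleC_op)
next
  case (compose a b)
  have "backshift k o\<^sub>L ((a o\<^sub>L b)
        - scaleC_op (cinner vacuum (blinfun_apply (a o\<^sub>L b) vacuum)) id_blinfun)
     = ((backshift k o\<^sub>L (a - scaleC_op (cinner vacuum (blinfun_apply a vacuum)) id_blinfun)) o\<^sub>L b)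
      + scaleC_op (cinner vacuum (blinfun_apply a vacuum))
        (backshift k o\<^sub>L (b - scaleC_op (cinner vacuum (blinfun_apply b vacuum)) id_blinfun))"
  proof (rule blinfun_eqI)
    fix x
    have "cinner vacuum (blinfun_apply (a o\<^sub>L b) vacuum)
        = cinner vacuum (blinfun_apply a vacuum) * cinner vacuum (blinfun_apply b vacuum)"
      unfolding blinfun_apply_blinfun_compose by (rule cinner_vacuum_apply[OF compose(1)])
    then show "blinfun_apply (backshift k o\<^sub>L ((a o\<^sub>L b)
        - scaleC_op (cinner vacuum (blinfun_apply (a o\<^sub>L b) vacuum)) id_blinfun)) x
      = blinfun_apply (((backshift k o\<^sub>L
          (a - scaleC_op (cinner vacuum (blinfun_apply a vacuum)) id_blinfun)) o\<^sub>L b)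
        + scaleC_op (cinner vacuum (blinfun_apply a vacuum))
          (backshift k o\<^sub>L (b - scaleC_op (cinner vacuum (blinfun_apply b vacuum)) id_blinfun))) x"
      by (simp add: blinfun.diff_left blinfun.diff_right blinfun.add_left scaleC_op_apply
          adjointable_apply_scaleC[OF adjointable_backshift] scaleC_scaleC scaleC_diff_right)
  qed
  then show ?case using compose by (simp add: disk_add disk_scaleC_op disk_compose)
next
  case (limit u a)
  let ?c = "\<lambda>a. cinner vacuum (blinfun_apply a vacuum)"
  have c: "(\<lambda>n. ?c (u n)) \<longlonglongrightarrow> ?c a"
    by (intro tendsto_cinner_right tendsto_blinfun_apply_const limit)
  have "(\<lambda>n. scaleC_op (?c (u n)) id_blinfun) \<longlonglongrightarrow> (scaleC_op (?c a) id_blinfun :: 'a fock_op)"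
  proof (rule LIM_zero_cancel, rule Lim_null_comparison)
    have "scaleC_op (?c (u n)) id_blinfun - scaleC_op (?c a) id_blinfun
        = (scaleC_op (?c (u n) - ?c a) id_blinfun :: 'a fock_op)" for n
      by (rule blinfun_eqI) (simp add: blinfun.diff_left scaleC_op_apply scaleC_diff_left)
    then show "\<forall>\<^sub>F n in sequentially. norm (scaleC_op (?c (u n)) id_blinfun
        - (scaleC_op (?c a) id_blinfun :: 'a fock_op))
        \<le> cmod (?c (u n) - ?c a) * norm (id_blinfun :: 'a fock_op)"
      by (simp add: norm_scaleC_op_le)
    show "(\<lambda>n. cmod (?c (u n) - ?c a) * norm (id_blinfun :: 'a fock_op)) \<longlonglongrightarrow> 0"
      using tendsto_norm_zero[OF LIM_zero[OF c]] by (rule tendsto_mult_left_zero)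
  qed
  then have "(\<lambda>n. backshift k o\<^sub>L (u n - scaleC_op (?c (u n)) id_blinfun))
      \<longlonglongrightarrow> (backshift k o\<^sub>L (a - scaleC_op (?c a) id_blinfun))"
    by (intro tendsto_compose_right tendsto_diff limit)
  then show ?case by (rule closed_sequentially[OF closed_disk limit(4)])
qed

lemma not_range_snoc:
  assumes "w \<notin> range (\<lambda>v. v @ [k])"
  shows "\<not> (w \<noteq> [] \<and> last w = k)"
proof
  assume "w \<noteq> [] \<and> last w = k"
  then have "w = butlast w @ [k]" by (metis append_butlast_last_id)
  then show False using assms by blast
qed

text \<open>The right shifts commute with the left shifts, hence with the whole algebra, and they generate
  all basis vectors from the vacuum; so an element of the algebra that kills the vacuum vanishes.\<close>

lift_definition right_shift_fun :: "'d \<Rightarrow> 'd fock \<Rightarrow> 'd fock"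
  is "\<lambda>k x w. if w \<noteq> [] \<and> last w = k then x (butlast w) else 0"
proof -
  fix k :: 'd and x :: "'d list \<Rightarrow> complex"
  let ?g = "\<lambda>w. (cmod (if w \<noteq> [] \<and> last w = k then x (butlast w) else 0))\<^sup>2"
  let ?s = "\<lambda>v. v @ [k]"
  assume "(\<lambda>v. (cmod (x v))\<^sup>2) summable_on UNIV"
  moreover have "?g \<circ> ?s = (\<lambda>v. (cmod (x v))\<^sup>2)" by auto
  moreover have "inj ?s" by (simp add: inj_def)
  ultimately have "?g summable_on range ?s"
    using summable_on_reindex[of ?s UNIV ?g] by simp
  moreover have "?g w = 0" if "w \<notin> range ?s" for w
    using not_range_snoc[OF that] by auto
  ultimately show "?g summable_on UNIV"
    by (rule summable_on_cong_neutral[THEN iffD1, rotated -1]) auto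
qed

lemma norm_right_shift_fun: "norm (right_shift_fun k x) = norm x"
proof -
  let ?g = "\<lambda>w. (cmod (ell2_coeff (right_shift_fun k x) w))\<^sup>2"
  let ?s = "\<lambda>v. v @ [k]"
  have "?g w = 0" if "w \<notin> range ?s" for w
    unfolding right_shift_fun.rep_eq using not_range_snoc[OF that] by auto
  then have "infsum ?g UNIV = infsum ?g (range ?s)"
    by (intro infsum_cong_neutral) auto
  also have "\<dots> = infsum (?g \<circ> ?s) UNIV"
    by (rule infsum_reindex) (simp add: inj_def)
  also have "?g \<circ> ?s = (\<lambda>v. (cmod (ell2_coeff x v))\<^sup>2)" by (auto simp: right_shift_fun.rep_eq)
  finally show ?thesis by (simp add: norm_ell2_def)
qed

lemma bounded_linear_right_shift_fun: "bounded_linear (right_shift_fun k)"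
proof (rule bounded_linear_intro[where K = 1])
  show "right_shift_fun k (x + y) = right_shift_fun k x + right_shift_fun k y" for x y
    by transfer auto
  show "right_shift_fun k (r *\<^sub>R x) = r *\<^sub>R right_shift_fun k x" for r x
    by transfer auto
qed (simp add: norm_right_shift_fun)

lemma right_shift_scaleC: "right_shift_fun k (c *\<^sub>C x) = c *\<^sub>C right_shift_fun k x"
  by transfer auto

lemma right_shift_basis: "right_shift_fun k (ell2_basis w) = ell2_basis (w @ [k])"
proof -
  have "(if v \<noteq> [] \<and> last v = k then if butlast v = w then 1 else 0 else 0)
      = (if v = w @ [k] then 1 else (0::complex))" for v
    using append_butlast_last_id[of v] by auto
  then show ?thesis
    unfolding ell2_coeff_inject[symmetric] right_shift_fun.rep_eq ell2_basis.rep_eq by (rule ext)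
qed

lemma right_shift_left_shift:
  "right_shift_fun k (shift_fun j x) = shift_fun j (right_shift_fun k x)"
  unfolding ell2_coeff_inject[symmetric]
proof
  fix w
  show "ell2_coeff (right_shift_fun k (shift_fun j x)) w
      = ell2_coeff (shift_fun j (right_shift_fun k x)) w"
    by (cases w) (auto simp: right_shift_fun.rep_eq shift_fun.rep_eq)
qed

lemma right_shift_disk:
  "blinfun_apply a (right_shift_fun k x) = right_shift_fun k (blinfun_apply a x)"
  if "a \<in> free_disk_algebra"
  using that
proof (induction arbitrary: x rule: disk_induct)
  case (shift j)
  show ?case by (simp add: left_shift_apply right_shift_left_shift)
next
  case (add a b)
  show ?case
    by (simp add: blinfun.add_left add(3,4) linear_add[OF bounded_linear.linear[OF
          bounded_linear_right_shift_fun]])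
next
  case (scaleC c a)
  show ?case by (simp add: scaleC_op_apply scaleC(2) right_shift_scaleC)
next
  case (compose a b)
  show ?case by (simp add: compose(3,4))
next
  case (limit u a)
  have "(\<lambda>n. blinfun_apply (u n) (right_shift_fun k x)) \<longlonglongrightarrow> blinfun_apply a (right_shift_fun k x)"
    by (intro tendsto_blinfun_apply_const limit)
  moreover have "(\<lambda>n. right_shift_fun k (blinfun_apply (u n) x)) \<longlonglongrightarrow> right_shift_fun k (blinfun_apply a x)"
    by (intro bounded_linear.tendsto[OF bounded_linear_right_shift_fun] tendsto_blinfun_apply_const limit)
  ultimately show ?case unfolding limit(4)[of _ x] by (rule LIMSEQ_unique)
qed simp

lemma disk_eq_zero:
  assumes a: "a \<in> free_disk_algebra" and zero: "blinfun_apply a vacuum = 0"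
  shows "a = 0"
proof (rule blinfun_eqI)
  fix x
  have basis: "blinfun_apply a (ell2_basis w) = 0" for w
  proof (induction w rule: rev_induct)
    case (snoc k w)
    have "right_shift_fun k 0 = (0 :: 'a fock)" by transfer auto
    then show ?case using snoc right_shift_disk[OF a, of k "ell2_basis w"] by (simp add: right_shift_basis)
  qed (rule zero)
  have "cinner y (blinfun_apply a x) = cinner y 0" for y
  proof -
    have "ell2_coeff (blinfun_apply (adj a) y) w = 0" for w
      using cinner_adj_right[OF disk_adjointable[OF a], of "ell2_basis w" y]
      by (simp add: cinner_ell2_basis basis)
    then have "blinfun_apply (adj a) y = 0"
      by (simp add: ell2_coeff_inject[symmetric] zero_ell2.rep_eq fun_eq_iff)
    then show ?thesis using cinner_adj_left[OF disk_adjointable[OF a], of y x] by simp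
  qed
  then show "blinfun_apply a x = blinfun_apply 0 x" by (simp add: cinner_ext)
qed

lemma disk_operator_apply_vacuum: "disk_operator (blinfun_apply a vacuum) = a"
  if "a \<in> free_disk_algebra" for a :: "'d fock_op"
proof -
  have "inj_on (\<lambda>a. blinfun_apply a vacuum) (free_disk_algebra :: 'd fock_op set)"
  proof (rule inj_onI)
    fix a b :: "'d fock_op"
    assume ab: "a \<in> free_disk_algebra" "b \<in> free_disk_algebra"
      and eq: "blinfun_apply a vacuum = blinfun_apply b vacuum"
    have "a - b = 0" by (rule disk_eq_zero) (simp_all add: disk_diff ab blinfun.diff_left eq)
    then show "a = b" by simp
  qed
  then show ?thesis unfolding disk_operator_def using that by (rule inv_into_f_f)
qed

lemma disk_vectorsI: "a \<in> free_disk_algebra \<Longrightarrow> blinfun_apply a vacuum \<in> disk_vectors"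
  by (simp add: disk_vectors_def)

lemma disk_vectorsE:
  assumes "x \<in> disk_vectors"
  obtains a where "a \<in> free_disk_algebra" "x = blinfun_apply a vacuum"
  using assms unfolding disk_vectors_def by blast

lemma disk_operator:
  assumes "x \<in> disk_vectors"
  shows disk_operator_mem: "disk_operator x \<in> free_disk_algebra"
    and disk_operator_vacuum: "blinfun_apply (disk_operator x) vacuum = x"
  using assms by (auto elim!: disk_vectorsE simp: disk_operator_apply_vacuum)

lemma vacuum_mem: "vacuum \<in> disk_vectors"
  using disk_vectorsI[OF disk_id] by simp

lemma disk_vectors_add: "x \<in> disk_vectors \<Longrightarrow> y \<in> disk_vectors \<Longrightarrow> x + y \<in> disk_vectors"
  by (auto elim!: disk_vectorsE intro!: disk_vectorsI disk_add simp flip: blinfun.add_left)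

lemma disk_vectors_scaleC: "x \<in> disk_vectors \<Longrightarrow> c *\<^sub>C x \<in> disk_vectors"
  by (auto elim!: disk_vectorsE intro!: disk_vectorsI disk_scaleC_op simp flip: scaleC_op_apply)

lemma disk_vectors_zero: "0 \<in> disk_vectors"
  using disk_vectorsI[OF disk_zero] by simp

lemma disk_vectors_apply:
  "a \<in> free_disk_algebra \<Longrightarrow> x \<in> disk_vectors \<Longrightarrow> blinfun_apply a x \<in> disk_vectors"
  by (auto elim!: disk_vectorsE intro!: disk_vectorsI disk_compose simp flip: blinfun_apply_blinfun_compose)

lemma closure_disk_vectors: "closure disk_vectors = (UNIV :: 'd fock set)"
proof -
  have basis: "ell2_basis w \<in> disk_vectors" for w :: "'d list"
  proof (induction w)
    case (Cons k w)
    then show ?case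
      using disk_vectors_apply[OF left_shift_mem[of k]] by (simp flip: left_shift_basis)
  qed (rule vacuum_mem)
  have sum: "(\<Sum>w\<in>F. ell2_coeff x w *\<^sub>C ell2_basis w) \<in> disk_vectors" if "finite F" for F and x :: "'d fock"
    using that by (induction F rule: finite_induct)
      (simp_all add: disk_vectors_zero disk_vectors_add disk_vectors_scaleC basis)
  have "x \<in> closure disk_vectors" for x :: "'d fock"
    unfolding closure_approachable dist_norm
    using ell2_basis_sum_approx sum norm_minus_commute by metis
  then show ?thesis by blast
qed

lemma adj_zero: "adj 0 = 0"
  by (rule adj_eqI) (simp add: is_adjoint_def)

lemma system_sum: "a \<in> free_disk_algebra \<Longrightarrow> b \<in> free_disk_algebra \<Longrightarrow> a + adj b \<in> free_disk_system"
  unfolding free_disk_system_def by (rule subsetD[OF closure_subset]) blast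

lemma disk_system: "a \<in> free_disk_algebra \<Longrightarrow> a \<in> free_disk_system"
  using system_sum[OF _ disk_zero] by (simp add: adj_zero)

lemma system_limit: "(\<And>n. T n \<in> free_disk_system) \<Longrightarrow> T \<longlonglongrightarrow> S \<Longrightarrow> S \<in> free_disk_system"
  using closed_sequentially[of free_disk_system] unfolding free_disk_system_def by auto

lemma system_induct [consumes 1, case_names sum limit]:
  assumes T: "T \<in> free_disk_system"
    and sum: "\<And>a b. a \<in> free_disk_algebra \<Longrightarrow> b \<in> free_disk_algebra \<Longrightarrow> P (a + adj b)"
    and limit: "\<And>u S. (\<And>n::nat. u n \<in> free_disk_system) \<Longrightarrow> (\<And>n. P (u n)) \<Longrightarrow> u \<longlonglongrightarrow> S \<Longrightarrow>
      S \<in> free_disk_system \<Longrightarrow> P S"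
  shows "P T"
proof -
  obtain u where u: "\<And>n. u n \<in> {a + adj b | a b. a \<in> free_disk_algebra \<and> b \<in> free_disk_algebra}"
    "u \<longlonglongrightarrow> T"
    using T unfolding free_disk_system_def closure_sequential by blast
  have "u n \<in> free_disk_system \<and> P (u n)" for n
    using u(1)[of n] system_sum sum by auto
  then show ?thesis using limit[of u T] u(2) T by blast
qed

lemma system_adjointable: "adjointable T" if "T \<in> free_disk_system"
  using that
proof (induction rule: system_induct)
  case (sum a b)
  then show ?case by (intro adjointable_add adjointable_adj disk_adjointable)
next
  case (limit u S)
  show ?case by (rule adjointable_limit(1)[OF limit(4,2)])
qed

lemma system_adj: "adj T \<in> free_disk_system" if "T \<in> free_disk_system"
  using that
proof (induction rule: system_induct)
  case (sum a b)
  have "adj (a + adj b) = b + adj a"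
    using sum by (simp add: adj_add disk_adjointable adjointable_adj adj_adj add.commute)
  then show ?case using sum by (simp add: system_sum)
next
  case (limit u S)
  show ?case
    by (rule system_limit[OF limit(4)]) (rule adjointable_limit(2)[OF system_adjointable[OF limit(1)] limit(2)])
qed

lemma system_scaleC_op: "scaleC_op c T \<in> free_disk_system" if "T \<in> free_disk_system"
  using that
proof (induction rule: system_induct)
  case (sum a b)
  have "scaleC_op c (a + adj b) = scaleC_op c a + adj (scaleC_op (cnj c) b)"
    using sum by (simp add: scaleC_op_add adj_scaleC_op disk_adjointable)
  then show ?case using sum by (simp add: system_sum disk_scaleC_op)
next
  case (limit u S)
  show ?case by (rule system_limit[OF limit(4)]) (rule tendsto_scaleC_op[OF limit(2)])
qed

lemma system_add: "S + T \<in> free_disk_system" if "S \<in> free_disk_system" "T \<in> free_disk_system"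
  using that
proof (induction arbitrary: T rule: system_induct)
  case (sum a b)
  show ?case
    using sum(3)
  proof (induction rule: system_induct)
    case (sum a' b')
    have eq: "a + adj b + (a' + adj b') = (a + a') + adj (b + b')"
      using sum \<open>b \<in> free_disk_algebra\<close> by (simp add: adj_add disk_adjointable add_ac)
    show ?case
      unfolding eq using sum \<open>a \<in> free_disk_algebra\<close> \<open>b \<in> free_disk_algebra\<close>
      by (intro system_sum disk_add)
  next
    case (limit u S)
    show ?case
      by (rule system_limit[OF limit(4)]) (rule tendsto_add[OF tendsto_const limit(2)])
  qed
next
  case (limit u S)
  show ?case
    by (rule system_limit[OF limit(4)[OF limit(5)]]) (rule tendsto_add[OF limit(2) tendsto_const])
qed

lemma system_diff: "S \<in> free_disk_system \<Longrightarrow> T \<in> free_disk_system \<Longrightarrow> S - T \<in> free_disk_system"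
  using system_add[of S "scaleC_op (-1) T"] system_scaleC_op[of T "-1"]
  by (simp add: scaleC_op_minus_one)

text \<open>For a shift this holds since, by \<open>backshift_disk\<close>, left multiplication by \<open>adj (left_shift k)\<close> maps
  the algebra into the sum of the algebra and the multiples of \<open>adj (left_shift k)\<close>. Taking all of
  the system for \<open>T\<close>, rather than the algebra only, lets the induction pass to products.\<close>

lemma adj_compose_system:
  "adj b o\<^sub>L T \<in> free_disk_system" if "b \<in> free_disk_algebra" "T \<in> free_disk_system"
  using that
proof (induction arbitrary: T rule: disk_induct)
  case (shift k)
  then show ?case
  proof (induction rule: system_induct)
    case (sum a b)
    let ?c = "cinner vacuum (blinfun_apply a vacuum)"
    have "adj (left_shift k) o\<^sub>L (a + adj b)
      = (backshift k o\<^sub>L (a - scaleC_op ?c id_blinfun))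
        + adj (scaleC_op (cnj ?c) (left_shift k) + (b o\<^sub>L left_shift k))"
    proof -
      have *: "adj (scaleC_op (cnj ?c) (left_shift k) + (b o\<^sub>L left_shift k))
          = scaleC_op ?c (backshift k) + (backshift k o\<^sub>L adj b)"
        using sum left_shift_mem[of k]
        by (simp add: adj_add adj_scaleC_op adj_compose disk_adjointable adjointable_scaleC_op
            adjointable_compose adj_left_shift)
      show ?thesis
        unfolding * adj_left_shift
        by (rule blinfun_eqI)
          (simp add: blinfun.add_left blinfun.diff_left blinfun.add_right blinfun.diff_right
            scaleC_op_apply adjointable_apply_scaleC[OF adjointable_backshift])
    qed
    then show ?case
      using sum by (simp add: system_sum backshift_disk disk_add disk_scaleC_op disk_compose left_shift_mem)
  next
    case (limit u S)
    show ?case by (rule system_limit[OF limit(4)]) (rule tendsto_compose_right[OF limit(2)])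
  qed
next
  case (add a b)
  then show ?case
    by (simp add: adj_add disk_adjointable compose_add_left system_add)
next
  case (scaleC c a)
  then show ?case
    by (simp add: adj_scaleC_op disk_adjointable compose_scaleC_op_left system_scaleC_op)
next
  case (compose a b)
  then show ?case
    by (simp add: adj_compose disk_adjointable compose_assoc)
next
  case (limit u a)
  show ?case
    by (rule system_limit[OF limit(4)[OF limit(5)]])
      (rule tendsto_compose_left[OF adjointable_limit(2)[OF disk_adjointable[OF limit(1)] limit(2)]])
qed simp

lemma system_compose: "T o\<^sub>L b \<in> free_disk_system" if "b \<in> free_disk_algebra" "T \<in> free_disk_system"
proof -
  have "T o\<^sub>L b = adj (adj b o\<^sub>L adj T)"
    using that by (simp add: adj_compose adjointable_adj adj_adj disk_adjointable system_adjointable)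
  then show ?thesis using that by (simp add: adj_compose_system system_adj)
qed

lemma system_real_imaginary:
  assumes T: "T \<in> free_disk_system"
  obtains H K where "H \<in> free_disk_system" "adj H = H" "norm H \<le> norm T"
    "K \<in> free_disk_system" "adj K = K" "norm K \<le> norm T" "T = H + scaleC_op \<i> K"
proof
  note adj = system_adjointable[OF T]
  note sys = system_adj[OF T]
  let ?H = "scaleC_op (1/2) (T + adj T)" and ?K = "scaleC_op (-\<i>/2) (T - adj T)"
  have le: "norm (adj T) \<le> norm T" by (rule norm_adj_le[OF adj])
  show "?H \<in> free_disk_system" "?K \<in> free_disk_system"
    using T sys by (simp_all add: system_scaleC_op system_add system_diff)
  show "adj ?H = ?H"
    using adj by (simp add: adj_scaleC_op adj_add adj_adj adjointable_add adjointable_adj add.commute)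
  have "adj ?K = scaleC_op (\<i>/2) (adj T - T)"
    using adj by (simp add: adj_scaleC_op adj_diff adj_adj adjointable_diff adjointable_adj)
  also have "\<dots> = scaleC_op (\<i>/2) (scaleC_op (-1) (T - adj T))"
    by (simp add: scaleC_op_minus_one)
  also have "\<dots> = ?K"
    unfolding scaleC_op_scaleC_op by simp
  finally show "adj ?K = ?K" .
  show "norm ?H \<le> norm T"
    using norm_scaleC_op_le[of "1/2" "T + adj T"] norm_triangle_ineq[of T "adj T"] le
    by (simp add: norm_divide)
  show "norm ?K \<le> norm T"
    using norm_scaleC_op_le[of "-\<i>/2" "T - adj T"] norm_triangle_ineq4[of T "adj T"] le
    by (simp add: norm_divide)
  show "T = ?H + scaleC_op \<i> ?K"
  proof (rule blinfun_eqI)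
    fix x
    let ?u = "blinfun_apply T x" and ?v = "blinfun_apply (adj T) x"
    have "(1/2) *\<^sub>C (?u + ?v) + \<i> *\<^sub>C (-\<i>/2) *\<^sub>C (?u - ?v) = (1/2 + 1/2) *\<^sub>C ?u"
      by (simp only: scaleC_scaleC scaleC_add_right scaleC_diff_right scaleC_add_left) simp
    then show "blinfun_apply T x = blinfun_apply (?H + scaleC_op \<i> ?K) x"
      by (simp add: scaleC_op_apply blinfun.diff_left blinfun.add_left)
  qed
qed

section \<open>The form of a positive functional on the free disk system\<close>

lemma op_positive_id: "op_positive id_blinfun"
  by (simp add: op_positive_def cinner_self flip: of_real_power)

lemma op_positive_diff_of_norm_le:
  assumes d: "adjointable d" and z: "adjointable z"
    and le: "\<And>x. norm (blinfun_apply z x) \<le> norm (blinfun_apply d x)"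
  shows "op_positive ((adj d o\<^sub>L d) - (adj z o\<^sub>L z))"
  unfolding op_positive_def
proof
  fix x
  have "cinner x (blinfun_apply ((adj d o\<^sub>L d) - (adj z o\<^sub>L z)) x)
      = of_real ((norm (blinfun_apply d x))\<^sup>2 - (norm (blinfun_apply z x))\<^sup>2)"
    by (simp add: blinfun.diff_left cinner_diff_right cinner_adj_right d z cinner_self)
  moreover have "0 \<le> (norm (blinfun_apply d x))\<^sup>2 - (norm (blinfun_apply z x))\<^sup>2"
    using le[of x] by (simp add: power_mono)
  ultimately show "cinner x (blinfun_apply ((adj d o\<^sub>L d) - (adj z o\<^sub>L z)) x) \<in> \<real>\<^sub>\<ge>\<^sub>0"
    by (simp only: nonneg_Reals_of_real_iff)
qed

lemma adj_compose_disk: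
  "a \<in> free_disk_algebra \<Longrightarrow> b \<in> free_disk_algebra \<Longrightarrow> adj a o\<^sub>L b \<in> free_disk_system"
  by (intro adj_compose_system disk_system)

lemma sandwich_system:
  "b \<in> free_disk_algebra \<Longrightarrow> c \<in> free_disk_algebra \<Longrightarrow> T \<in> free_disk_system \<Longrightarrow>
    adj b o\<^sub>L (T o\<^sub>L c) \<in> free_disk_system"
  by (intro adj_compose_system system_compose)

locale positive_nc_measure =
  fixes \<mu> :: "'d fock_op \<Rightarrow> complex"
  assumes measure: "nc_measure \<mu>"
begin

lemma mu_add: "S \<in> free_disk_system \<Longrightarrow> T \<in> free_disk_system \<Longrightarrow> \<mu> (S + T) = \<mu> S + \<mu> T"
  and mu_scaleC_op: "T \<in> free_disk_system \<Longrightarrow> \<mu> (scaleC_op c T) = c * \<mu> T"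
  and mu_nonneg: "T \<in> free_disk_system \<Longrightarrow> op_positive T \<Longrightarrow> \<mu> T \<in> \<real>\<^sub>\<ge>\<^sub>0"
  and mu_outside: "T \<notin> free_disk_system \<Longrightarrow> \<mu> T = 0"
  using measure unfolding nc_measure_def linear_on_system_def positive_on_system_def by auto

lemma mu_diff: "S \<in> free_disk_system \<Longrightarrow> T \<in> free_disk_system \<Longrightarrow> \<mu> (S - T) = \<mu> S - \<mu> T"
  using mu_add[of S "scaleC_op (-1) T"] mu_scaleC_op[of T "-1"] system_scaleC_op[of T "-1"]
  by (simp add: scaleC_op_minus_one)

lemma nc_form_apply:
  "a \<in> free_disk_algebra \<Longrightarrow> b \<in> free_disk_algebra \<Longrightarrow>
    nc_form \<mu> (blinfun_apply a vacuum) (blinfun_apply b vacuum) = \<mu> (adj a o\<^sub>L b)"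
  by (simp add: nc_form_def disk_vectorsI disk_operator_apply_vacuum)

lemma nc_form_psd: "psd_form disk_vectors (nc_form \<mu>)"
proof -
  have add: "nc_form \<mu> (x + y) z = nc_form \<mu> x z + nc_form \<mu> y z \<and>
      nc_form \<mu> z (x + y) = nc_form \<mu> z x + nc_form \<mu> z y"
    if mem: "x \<in> disk_vectors" "y \<in> disk_vectors" "z \<in> disk_vectors" for x y z
  proof -
    obtain a where a: "a \<in> free_disk_algebra" "x = blinfun_apply a vacuum"
      using mem(1) by (rule disk_vectorsE)
    obtain b where b: "b \<in> free_disk_algebra" "y = blinfun_apply b vacuum"
      using mem(2) by (rule disk_vectorsE)
    obtain c where c: "c \<in> free_disk_algebra" "z = blinfun_apply c vacuum"
      using mem(3) by (rule disk_vectorsE)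
    show ?thesis
      unfolding a(2) b(2) c(2) blinfun.add_left[symmetric]
      using a(1) b(1) c(1) by (simp add: nc_form_apply disk_add adj_add disk_adjointable compose_add_left
          compose_add_right mu_add adj_compose_disk)
  qed
  have scale: "nc_form \<mu> (c *\<^sub>C x) y = cnj c * nc_form \<mu> x y \<and> nc_form \<mu> x (c *\<^sub>C y) = c * nc_form \<mu> x y"
    if mem: "x \<in> disk_vectors" "y \<in> disk_vectors" for c x y
  proof -
    obtain a where a: "a \<in> free_disk_algebra" "x = blinfun_apply a vacuum"
      using mem(1) by (rule disk_vectorsE)
    obtain b where b: "b \<in> free_disk_algebra" "y = blinfun_apply b vacuum"
      using mem(2) by (rule disk_vectorsE)
    have "adj a o\<^sub>L scaleC_op c b = scaleC_op c (adj a o\<^sub>L b)"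
      by (rule blinfun_eqI) (simp add: scaleC_op_apply adjointable_apply_scaleC adjointable_adj
          disk_adjointable a(1))
    then show ?thesis
      unfolding a(2) b(2) scaleC_op_apply[symmetric]
      using a(1) b(1) by (simp add: nc_form_apply disk_scaleC_op adj_scaleC_op disk_adjointable
          compose_scaleC_op_left mu_scaleC_op adj_compose_disk)
  qed
  have pos: "nc_form \<mu> x x \<in> \<real>\<^sub>\<ge>\<^sub>0" if mem: "x \<in> disk_vectors" for x
  proof -
    obtain a where a: "a \<in> free_disk_algebra" "x = blinfun_apply a vacuum"
      using mem by (rule disk_vectorsE)
    have "op_positive (adj a o\<^sub>L a)"
      using op_positive_conj[OF op_positive_id disk_adjointable[OF a(1)]] by simp
    then show ?thesis using a by (simp add: nc_form_apply mu_nonneg adj_compose_disk)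
  qed
  have outside: "nc_form \<mu> x y = 0" if "x \<notin> disk_vectors \<or> y \<notin> disk_vectors" for x y
    using that by (auto simp: nc_form_def)
  show ?thesis
    unfolding psd_form_def
    using add scale pos outside
    by (intro conjI) (simp_all add: disk_vectors_zero disk_vectors_add disk_vectors_scaleC
        closure_disk_vectors)
qed

sublocale form: semidefinite_form disk_vectors "nc_form \<mu>"
  by unfold_locales (rule nc_form_psd)

lemma mu_adj_compose_self: "a \<in> free_disk_algebra \<Longrightarrow> \<mu> (adj a o\<^sub>L a) = of_real (form.Q (blinfun_apply a vacuum))"
  by (simp add: form.q_self[symmetric] nc_form_apply)

text \<open>The hypothesis is the operator inequality \<open>adj z z \<le> adj d d\<close>, and \<open>\<mu>\<close> is positive. One may take
  for \<open>z\<close> a backward shift of \<open>d\<close> that lies in the algebra, although the backward shift itself does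
  not.\<close>

lemma Q_mono:
  assumes "d \<in> free_disk_algebra" "z \<in> free_disk_algebra"
    and "\<And>x. norm (blinfun_apply z x) \<le> norm (blinfun_apply d x)"
  shows "form.Q (blinfun_apply z vacuum) \<le> form.Q (blinfun_apply d vacuum)"
proof -
  have "\<mu> ((adj d o\<^sub>L d) - (adj z o\<^sub>L z)) \<in> \<real>\<^sub>\<ge>\<^sub>0"
    using assms by (intro mu_nonneg system_diff adj_compose_disk op_positive_diff_of_norm_le disk_adjointable)
  then have "of_real (form.Q (blinfun_apply d vacuum) - form.Q (blinfun_apply z vacuum)) \<in> (\<real>\<^sub>\<ge>\<^sub>0 :: complex set)"
    using assms by (simp add: mu_diff adj_compose_disk mu_adj_compose_self)
  then show ?thesis by (simp only: nonneg_Reals_of_real_iff diff_ge_0_iff_ge)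
qed

lemma Q_apply_le:
  assumes a: "a \<in> free_disk_algebra" and x: "x \<in> disk_vectors"
  shows "form.Q (blinfun_apply a x) \<le> (norm a)\<^sup>2 * form.Q x"
proof -
  obtain b where b: "b \<in> free_disk_algebra" "x = blinfun_apply b vacuum"
    using x by (rule disk_vectorsE)
  have "form.Q (blinfun_apply (a o\<^sub>L b) vacuum)
      \<le> form.Q (blinfun_apply (scaleC_op (of_real (norm a)) b) vacuum)"
    using a b by (intro Q_mono disk_compose disk_scaleC_op)
      (simp_all add: scaleC_op_apply norm_scaleC norm_blinfun)
  then show ?thesis using x b by (simp add: scaleC_op_apply form.Q_scaleC)
qed

lemma Q_left_shift:
  assumes x: "x \<in> disk_vectors"
  shows "form.Q (blinfun_apply (left_shift k) x) = form.Q x"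
proof -
  obtain b where b: "b \<in> free_disk_algebra" "x = blinfun_apply b vacuum"
    using x by (rule disk_vectorsE)
  have "form.Q (blinfun_apply (left_shift k o\<^sub>L b) vacuum) = form.Q (blinfun_apply b vacuum)"
    using b by (intro antisym Q_mono disk_compose left_shift_mem)
      (simp_all add: left_shift_apply norm_shift_fun)
  then show ?thesis using b by simp
qed

text \<open>For self-adjoint \<open>H\<close>, both \<open>norm H \<plusminus> H\<close> are positive, and remain so when they are multiplied by
  \<open>adj b\<close> and \<open>b\<close>; the factor \<open>2\<close> comes from splitting \<open>T\<close> into its real and imaginary parts.\<close>

lemma sandwich_bound:
  assumes b: "b \<in> free_disk_algebra" and T: "T \<in> free_disk_system"
  shows "cmod (\<mu> (adj b o\<^sub>L (T o\<^sub>L b))) \<le> 2 * norm T * form.Q (blinfun_apply b vacuum)"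
proof -
  let ?q = "form.Q (blinfun_apply b vacuum)"
  have self: "cmod (\<mu> (adj b o\<^sub>L (H o\<^sub>L b))) \<le> norm H * ?q"
    if H: "H \<in> free_disk_system" "adj H = H" for H
  proof -
    let ?h = "complex_of_real (norm H)" and ?m = "\<mu> (adj b o\<^sub>L (H o\<^sub>L b))"
    have adjb: "adjointable (adj b)" by (simp add: adjointable_adj disk_adjointable b)
    have eq: "adj b o\<^sub>L ((scaleC_op ?h id_blinfun - H) o\<^sub>L b) = scaleC_op ?h (adj b o\<^sub>L b) - (adj b o\<^sub>L (H o\<^sub>L b))"
      "adj b o\<^sub>L ((scaleC_op ?h id_blinfun + H) o\<^sub>L b) = scaleC_op ?h (adj b o\<^sub>L b) + (adj b o\<^sub>L (H o\<^sub>L b))"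
      by (rule blinfun_eqI, simp add: blinfun.diff_left blinfun.diff_right blinfun.add_left
          blinfun.add_right scaleC_op_apply adjointable_apply_scaleC[OF adjb])+
    have sys: "adj b o\<^sub>L b \<in> free_disk_system" "adj b o\<^sub>L (H o\<^sub>L b) \<in> free_disk_system"
      using b H by (simp_all add: adj_compose_disk sandwich_system)
    have "\<mu> (scaleC_op ?h (adj b o\<^sub>L b) - (adj b o\<^sub>L (H o\<^sub>L b))) \<in> \<real>\<^sub>\<ge>\<^sub>0"
      using b H sys op_positive_conj[OF op_positive_norm_minus(1)[OF system_adjointable[OF H(1)] H(2)]
          disk_adjointable[OF b]]
      unfolding eq by (intro mu_nonneg system_diff system_scaleC_op)
    then have 1: "?h * of_real ?q - ?m \<in> \<real>\<^sub>\<ge>\<^sub>0"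
      using b sys by (simp add: mu_diff mu_scaleC_op system_scaleC_op mu_adj_compose_self)
    have "\<mu> (scaleC_op ?h (adj b o\<^sub>L b) + (adj b o\<^sub>L (H o\<^sub>L b))) \<in> \<real>\<^sub>\<ge>\<^sub>0"
      using b H sys op_positive_conj[OF op_positive_norm_minus(2)[OF system_adjointable[OF H(1)] H(2)]
          disk_adjointable[OF b]]
      unfolding eq by (intro mu_nonneg system_add system_scaleC_op)
    then have 2: "?h * of_real ?q + ?m \<in> \<real>\<^sub>\<ge>\<^sub>0"
      using b sys by (simp add: mu_add mu_scaleC_op system_scaleC_op mu_adj_compose_self)
    have "Im ?m = 0" "\<bar>Re ?m\<bar> \<le> norm H * ?q"
      using 1 2 by (auto simp: complex_nonneg_Reals_iff)
    then show ?thesis by (simp add: cmod_eq_Re)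
  qed
  obtain H K where HK: "H \<in> free_disk_system" "adj H = H" "norm H \<le> norm T"
    "K \<in> free_disk_system" "adj K = K" "norm K \<le> norm T" "T = H + scaleC_op \<i> K"
    using system_real_imaginary[OF T] by blast
  have "adj b o\<^sub>L (T o\<^sub>L b) = (adj b o\<^sub>L (H o\<^sub>L b)) + scaleC_op \<i> (adj b o\<^sub>L (K o\<^sub>L b))"
    unfolding HK(7)
    by (rule blinfun_eqI) (simp add: blinfun.add_left blinfun.add_right scaleC_op_apply
        adjointable_apply_scaleC adjointable_adj disk_adjointable b)
  then have "\<mu> (adj b o\<^sub>L (T o\<^sub>L b)) = \<mu> (adj b o\<^sub>L (H o\<^sub>L b)) + \<i> * \<mu> (adj b o\<^sub>L (K o\<^sub>L b))"
    using b HK(1,4) by (simp add: mu_add mu_scaleC_op sandwich_system system_scaleC_op)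
  then have "cmod (\<mu> (adj b o\<^sub>L (T o\<^sub>L b))) \<le> cmod (\<mu> (adj b o\<^sub>L (H o\<^sub>L b))) + cmod (\<mu> (adj b o\<^sub>L (K o\<^sub>L b)))"
    using norm_triangle_ineq[of "\<mu> (adj b o\<^sub>L (H o\<^sub>L b))" "\<i> * \<mu> (adj b o\<^sub>L (K o\<^sub>L b))"]
    by (simp add: norm_mult)
  also have "\<dots> \<le> norm T * ?q + norm T * ?q"
    using self[OF HK(1,2)] self[OF HK(4,5)] HK(3,6) form.Q_nonneg
    by (intro add_mono) (meson mult_right_mono order_trans)+
  finally show ?thesis by simp
qed

lemma sandwich_linear:
  assumes "b \<in> free_disk_algebra" "S \<in> free_disk_system" "T \<in> free_disk_system"
  shows "\<mu> (adj b o\<^sub>L ((S + T) o\<^sub>L b)) = \<mu> (adj b o\<^sub>L (S o\<^sub>L b)) + \<mu> (adj b o\<^sub>L (T o\<^sub>L b))"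
    "\<mu> (adj b o\<^sub>L ((S - T) o\<^sub>L b)) = \<mu> (adj b o\<^sub>L (S o\<^sub>L b)) - \<mu> (adj b o\<^sub>L (T o\<^sub>L b))"
    "\<mu> (adj b o\<^sub>L (scaleC_op c S o\<^sub>L b)) = c * \<mu> (adj b o\<^sub>L (S o\<^sub>L b))"
proof -
  have "adj b o\<^sub>L ((S + T) o\<^sub>L b) = (adj b o\<^sub>L (S o\<^sub>L b)) + (adj b o\<^sub>L (T o\<^sub>L b))"
    "adj b o\<^sub>L ((S - T) o\<^sub>L b) = (adj b o\<^sub>L (S o\<^sub>L b)) - (adj b o\<^sub>L (T o\<^sub>L b))"
    "adj b o\<^sub>L (scaleC_op c S o\<^sub>L b) = scaleC_op c (adj b o\<^sub>L (S o\<^sub>L b))"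
    by (rule blinfun_eqI, simp add: blinfun.diff_left blinfun.diff_right blinfun.add_left
        blinfun.add_right scaleC_op_apply adjointable_apply_scaleC adjointable_adj
        disk_adjointable assms)+
  then show "\<mu> (adj b o\<^sub>L ((S + T) o\<^sub>L b)) = \<mu> (adj b o\<^sub>L (S o\<^sub>L b)) + \<mu> (adj b o\<^sub>L (T o\<^sub>L b))"
    "\<mu> (adj b o\<^sub>L ((S - T) o\<^sub>L b)) = \<mu> (adj b o\<^sub>L (S o\<^sub>L b)) - \<mu> (adj b o\<^sub>L (T o\<^sub>L b))"
    "\<mu> (adj b o\<^sub>L (scaleC_op c S o\<^sub>L b)) = c * \<mu> (adj b o\<^sub>L (S o\<^sub>L b))"
    using assms by (simp_all add: mu_add mu_diff mu_scaleC_op sandwich_system)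
qed

lemma sandwich_disk:
  assumes b: "b \<in> free_disk_algebra" and c: "c \<in> free_disk_algebra" and a: "a \<in> free_disk_algebra"
  shows "\<mu> (adj b o\<^sub>L (a o\<^sub>L c))
      = nc_form \<mu> (blinfun_apply b vacuum) (blinfun_apply a (blinfun_apply c vacuum))"
    "\<mu> (adj b o\<^sub>L (adj a o\<^sub>L c))
      = nc_form \<mu> (blinfun_apply a (blinfun_apply b vacuum)) (blinfun_apply c vacuum)"
  using nc_form_apply[OF b disk_compose[OF a c]] nc_form_apply[OF disk_compose[OF a b] c] a b
  by (simp_all add: adj_compose disk_adjointable compose_assoc)

section \<open>The free disk algebra preserves recovery sequences\<close>

text \<open>The shift preserves \<open>Q\<close>, so the claim is that the hull takes the same value at \<open>x\<close> and at its
  shift. One inequality is obtained by shifting \<open>X\<close>. For the other, take a recovery sequence \<open>Y\<close> of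
  the shifted vector and shift it back. The constant terms of \<open>Y\<close> tend to the vacuum coefficient of
  the limit, which is \<open>0\<close>; once they are removed, the backward shift stays in the algebra and, being
  a contraction, does not increase \<open>Q\<close>.\<close>

lemma recovers_left_shift:
  assumes X: "form.recovers X x" and x: "x \<in> disk_vectors"
  shows "form.recovers (\<lambda>n. blinfun_apply (left_shift k) (X n)) (blinfun_apply (left_shift k) x)"
proof -
  let ?L = "blinfun_apply (left_shift k)" and ?B = "blinfun_apply (backshift k)"
  have XD: "\<And>n. X n \<in> disk_vectors" and lim: "X \<longlonglongrightarrow> x"
    and Qlim: "(\<lambda>n. form.Q (X n)) \<longlonglongrightarrow> form.hull_value x"
    using X by (auto simp: form.recovers_def)
  have LXD: "?L (X n) \<in> disk_vectors" for n by (rule disk_vectors_apply[OF left_shift_mem XD])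
  have Lx: "?L x \<in> form.hull_dom"
    using disk_vectors_apply[OF left_shift_mem x] form.dom_subset_hull_dom by blast
  have Llim: "(\<lambda>n. ?L (X n)) \<longlonglongrightarrow> ?L x" by (intro blinfun.tendsto tendsto_const lim)
  have QL: "(\<lambda>n. form.Q (?L (X n))) \<longlonglongrightarrow> form.hull_value x"
    using Qlim by (simp add: Q_left_shift XD)
  have "form.hull_value (?L x) \<le> form.hull_value x"
  proof (rule field_le_epsilon)
    fix e :: real assume e: "e > 0"
    have "form.hull_value (?L x) - e \<le> form.hull_value x"
    proof (rule tendsto_lowerbound[OF QL])
      show "\<forall>\<^sub>F n in sequentially. form.hull_value (?L x) - e \<le> form.Q (?L (X n))"
        using form.hull_value_lower_bound_seq[OF LXD Llim e] by eventually_elim simp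
    qed simp
    then show "form.hull_value (?L x) \<le> form.hull_value x + e" by simp
  qed
  moreover have "form.hull_value x \<le> form.hull_value (?L x)"
  proof -
    obtain Y where Y: "form.recovers Y (?L x)" using form.recovers_exists[OF Lx] by blast
    have YD: "\<And>n. Y n \<in> disk_vectors" and Ylim: "Y \<longlonglongrightarrow> ?L x"
      and QY: "(\<lambda>n. form.Q (Y n)) \<longlonglongrightarrow> form.hull_value (?L x)"
      using Y by (auto simp: form.recovers_def)
    define c where "c n = cinner vacuum (Y n)" for n
    define b where "b n = disk_operator (Y n) - scaleC_op (c n) id_blinfun" for n
    have bD: "b n \<in> free_disk_algebra" for n
      by (simp add: b_def disk_diff disk_operator_mem YD disk_scaleC_op disk_id)
    have bv: "blinfun_apply (b n) vacuum = Y n - c n *\<^sub>C vacuum" for n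
      by (simp add: b_def blinfun.diff_left scaleC_op_apply disk_operator_vacuum YD)
    have zD: "backshift k o\<^sub>L b n \<in> free_disk_algebra" for n
      using backshift_disk[OF disk_operator_mem[OF YD[of n]], of k]
      by (simp add: b_def c_def disk_operator_vacuum YD)
    define Z where "Z n = blinfun_apply (backshift k o\<^sub>L b n) vacuum" for n
    have ZD: "Z n \<in> disk_vectors" for n unfolding Z_def by (rule disk_vectorsI[OF zD])
    have vac: "vacuum \<in> disk_vectors" by (rule vacuum_mem)
    have "c \<longlonglongrightarrow> cinner vacuum (?L x)"
      unfolding c_def by (intro tendsto_cinner_right Ylim)
    also have "cinner vacuum (?L x) = 0"
      by (simp add: cinner_ell2_basis left_shift_apply shift_fun.rep_eq)
    finally have c0: "c \<longlonglongrightarrow> 0" .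
    have cv: "(\<lambda>n. c n *\<^sub>C (vacuum :: 'd fock)) \<longlonglongrightarrow> 0"
    proof (rule tendsto_norm_zero_cancel)
      show "(\<lambda>n. norm (c n *\<^sub>C (vacuum :: 'd fock))) \<longlonglongrightarrow> 0"
        unfolding norm_scaleC norm_ell2_basis mult_1_right by (rule tendsto_norm_zero[OF c0])
    qed
    have "Z = (\<lambda>n. ?B (Y n - c n *\<^sub>C vacuum))" by (rule ext) (simp add: Z_def bv)
    moreover have "(\<lambda>n. ?B (Y n - c n *\<^sub>C vacuum)) \<longlonglongrightarrow> ?B (?L x - 0)"
      by (intro blinfun.tendsto tendsto_const tendsto_diff Ylim cv)
    moreover have "?B (?L x - 0) = x"
      using arg_cong[OF backshift_left_shift[of k k], of "\<lambda>T. blinfun_apply T x"] by simp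
    ultimately have Zlim: "Z \<longlonglongrightarrow> x" by simp
    have QZ: "sqrt (form.Q (Z n)) \<le> sqrt (form.Q (Y n)) + cmod (c n) * sqrt (form.Q vacuum)" for n
    proof -
      have "form.Q (Z n) \<le> form.Q (blinfun_apply (b n) vacuum)"
        unfolding Z_def
      proof (rule Q_mono[OF bD zD])
        show "norm (blinfun_apply (backshift k o\<^sub>L b n) v) \<le> norm (blinfun_apply (b n) v)" for v
          by (simp add: backshift_apply norm_backshift_fun)
      qed
      then have "sqrt (form.Q (Z n)) \<le> sqrt (form.Q (Y n + (- c n) *\<^sub>C vacuum))"
        by (simp add: bv diff_eq_add_scaleC scaleC_scaleC)
      also have "\<dots> \<le> sqrt (form.Q (Y n)) + sqrt (form.Q ((- c n) *\<^sub>C vacuum))"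
        by (intro form.sqrt_Q_add_le YD disk_vectors_scaleC vac)
      finally show ?thesis by (simp add: form.Q_scaleC vac real_sqrt_mult)
    qed
    have lim_sq: "(\<lambda>n. (sqrt (form.Q (Y n)) + cmod (c n) * sqrt (form.Q vacuum))\<^sup>2)
        \<longlonglongrightarrow> (sqrt (form.hull_value (?L x)) + 0 * sqrt (form.Q vacuum))\<^sup>2"
      by (intro tendsto_intros QY tendsto_norm_zero c0)
    show ?thesis
    proof (rule field_le_epsilon)
      fix e :: real assume e: "e > 0"
      have "form.hull_value x - e \<le> (sqrt (form.hull_value (?L x)) + 0 * sqrt (form.Q vacuum))\<^sup>2"
      proof (rule tendsto_lowerbound[OF lim_sq])
        show "\<forall>\<^sub>F n in sequentially.
            form.hull_value x - e \<le> (sqrt (form.Q (Y n)) + cmod (c n) * sqrt (form.Q vacuum))\<^sup>2"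
          using form.hull_value_lower_bound_seq[of Z, OF ZD Zlim e]
        proof eventually_elim
          case (elim n)
          have "form.Q (Z n) = (sqrt (form.Q (Z n)))\<^sup>2" by (simp add: form.Q_nonneg)
          also have "\<dots> \<le> (sqrt (form.Q (Y n)) + cmod (c n) * sqrt (form.Q vacuum))\<^sup>2"
            using QZ[of n] by (intro power_mono) (simp_all add: form.Q_nonneg)
          finally show ?case using elim by simp
        qed
      qed simp
      then show "form.hull_value x \<le> form.hull_value (?L x) + e"
        using form.hull_value_nonneg[OF Lx] by simp
    qed
  qed
  ultimately show ?thesis
    using QL Lx LXD Llim by (simp add: form.recovers_def)
qed

text \<open>For norm limits of elements of the algebra the characterization of recovery sequences by
  orthogonality is used, which is stable under uniformly small perturbations.\<close>

lemma recovers_apply: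
  "form.recovers (\<lambda>n. blinfun_apply a (X n)) (blinfun_apply a x)"
  if "a \<in> free_disk_algebra" "form.recovers X x" "x \<in> disk_vectors"
  using that
proof (induction arbitrary: X x rule: disk_induct)
  case (shift k)
  then show ?case by (rule recovers_left_shift)
next
  case (add a b)
  have "form.recovers (\<lambda>n. blinfun_apply a (X n) + blinfun_apply b (X n))
      (blinfun_apply a x + blinfun_apply b x)"
    by (intro form.recovers_add add(3,4)[OF add(5,6)])
  then show ?case by (simp add: blinfun.add_left)
next
  case (scaleC c a)
  have "form.recovers (\<lambda>n. c *\<^sub>C blinfun_apply a (X n)) (c *\<^sub>C blinfun_apply a x)"
    by (intro form.recovers_scaleC scaleC(2)[OF scaleC(3,4)])
  then show ?case by (simp add: scaleC_op_apply)
next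
  case (compose a b)
  have "form.recovers (\<lambda>n. blinfun_apply a (blinfun_apply b (X n))) (blinfun_apply a (blinfun_apply b x))"
    by (intro compose(3)[OF compose(4)[OF compose(5,6)]] disk_vectors_apply compose)
  then show ?case by simp
next
  case (limit u a)
  have XD: "\<And>n. X n \<in> disk_vectors" and lim: "X \<longlonglongrightarrow> x"
    using limit(5) by (auto simp: form.recovers_def)
  obtain M where M: "M > 0" "\<And>n. form.Q (X n) \<le> M" using form.recovers_bounded[OF limit(5)] by blast
  show ?case
  proof (rule form.recoversI)
    show "blinfun_apply a (X n) \<in> disk_vectors" for n by (rule disk_vectors_apply[OF limit(3) XD])
    show "(\<lambda>n. blinfun_apply a (X n)) \<longlonglongrightarrow> blinfun_apply a x"
      by (intro blinfun.tendsto tendsto_const lim)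
    show "form.Q (blinfun_apply a (X n)) \<le> (norm a)\<^sup>2 * M" for n
      using Q_apply_le[OF limit(3) XD[of n]] mult_left_mono[OF M(2)[of n], of "(norm a)\<^sup>2"] by simp
    fix W assume W: "form.bounded_null W"
    then obtain K where WD: "\<And>n. W n \<in> disk_vectors" and K: "\<And>n. form.Q (W n) \<le> K"
      by (auto simp: form.bounded_null_def)
    define C where "C = sqrt M * sqrt K + 1"
    have "K \<ge> 0" using K[of 0] form.Q_nonneg[of "W 0"] by linarith
    then have C: "C > 0" using M(1) by (simp add: C_def add_nonneg_pos)
    show "(\<lambda>n. nc_form \<mu> (blinfun_apply a (X n)) (W n)) \<longlonglongrightarrow> 0"
    proof (rule LIMSEQ_I)
      fix r :: real assume r: "r > 0"
      have "r / (2 * C) > 0" using r C by simp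
      then obtain k where k: "norm (u k - a) < r / (2 * C)"
        using LIMSEQ_D[OF limit(2)] by blast
      have "(\<lambda>n. nc_form \<mu> (blinfun_apply (u k) (X n)) (W n)) \<longlonglongrightarrow> 0"
        by (rule form.recovers_orthogonal[OF limit(4)[OF limit(5,6)] W])
      then obtain N where N: "\<And>n. n \<ge> N \<Longrightarrow> cmod (nc_form \<mu> (blinfun_apply (u k) (X n)) (W n)) < r / 2"
        using LIMSEQ_D[OF _ half_gt_zero[OF r]] by fastforce
      have "norm (nc_form \<mu> (blinfun_apply a (X n)) (W n) - 0) < r" if n: "n \<ge> N" for n
      proof -
        have dD: "u k - a \<in> free_disk_algebra" by (rule disk_diff[OF limit(1,3)])
        have "nc_form \<mu> (blinfun_apply a (X n)) (W n)
            = nc_form \<mu> (blinfun_apply (u k) (X n)) (W n) - nc_form \<mu> (blinfun_apply (u k - a) (X n)) (W n)"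
          by (simp add: blinfun.diff_left form.diff_left disk_vectors_apply limit(1,3) XD WD)
        then have "cmod (nc_form \<mu> (blinfun_apply a (X n)) (W n))
            \<le> cmod (nc_form \<mu> (blinfun_apply (u k) (X n)) (W n))
              + cmod (nc_form \<mu> (blinfun_apply (u k - a) (X n)) (W n))"
          by (simp add: norm_triangle_ineq4)
        also have "cmod (nc_form \<mu> (blinfun_apply (u k - a) (X n)) (W n))
            \<le> sqrt (form.Q (blinfun_apply (u k - a) (X n))) * sqrt (form.Q (W n))"
          by (rule form.cmod_q_le)
        also have "\<dots> \<le> (norm (u k - a) * sqrt M) * sqrt K"
        proof (rule mult_mono)
          have "form.Q (blinfun_apply (u k - a) (X n)) \<le> (norm (u k - a))\<^sup>2 * M"
            using Q_apply_le[OF dD XD[of n]] mult_left_mono[OF M(2)[of n], of "(norm (u k - a))\<^sup>2"] by simp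
          then show "sqrt (form.Q (blinfun_apply (u k - a) (X n))) \<le> norm (u k - a) * sqrt M"
            using real_sqrt_le_mono by (fastforce simp: real_sqrt_mult)
        qed (use K M(1) in \<open>auto simp: form.Q_nonneg\<close>)
        also have "\<dots> \<le> norm (u k - a) * C" by (simp add: C_def distrib_left mult.assoc)
        also have "\<dots> < r / 2" using k C by (simp add: field_simps)
        finally show ?thesis using N[OF n] by simp
      qed
      then show "\<exists>no. \<forall>n\<ge>no. norm (nc_form \<mu> (blinfun_apply a (X n)) (W n) - 0) < r" by blast
    qed
  qed
qed simp

end

section \<open>Compressions along a recovery sequence of the vacuum\<close>

text \<open>Uniformly Lipschitz sequences of functionals on the system are controlled by their values on the
  sums \<open>a + adj b\<close>, which are dense.\<close>

lemma system_tendsto_zero: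
  fixes F :: "nat \<Rightarrow> 'd fock_op \<Rightarrow> complex"
  assumes T: "T \<in> free_disk_system"
    and lip: "\<And>n S T. S \<in> free_disk_system \<Longrightarrow> T \<in> free_disk_system \<Longrightarrow>
      cmod (F n S - F n T) \<le> C * norm (S - T)"
    and lim: "\<And>a b. a \<in> free_disk_algebra \<Longrightarrow> b \<in> free_disk_algebra \<Longrightarrow>
      (\<lambda>n. F n (a + adj b)) \<longlonglongrightarrow> 0"
  shows "(\<lambda>n. F n T) \<longlonglongrightarrow> 0"
  using T
proof (induction rule: system_induct)
  case (limit u S)
  show ?case
  proof (rule LIMSEQ_I)
    fix r :: real assume r: "r > 0"
    have "r / (2 * (\<bar>C\<bar> + 1)) > 0" using r by (simp add: add_nonneg_pos)
    then obtain k where k: "norm (u k - S) < r / (2 * (\<bar>C\<bar> + 1))"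
      using LIMSEQ_D[OF limit(2)] by blast
    obtain N where N: "\<And>n. n \<ge> N \<Longrightarrow> norm (F n (u k) - 0) < r / 2"
      using LIMSEQ_D[OF limit(4) half_gt_zero[OF r]] by blast
    have "norm (F n S - 0) < r" if n: "n \<ge> N" for n
    proof -
      have "cmod (F n (u k) - F n S) \<le> C * norm (u k - S)" by (rule lip[OF limit(1,3)])
      also have "\<dots> \<le> (\<bar>C\<bar> + 1) * norm (u k - S)" by (intro mult_right_mono) auto
      also have "\<dots> < r / 2" using k by (simp add: field_simps)
      finally have "cmod (F n S - F n (u k)) < r / 2" by (simp add: norm_minus_commute)
      then show ?thesis
        using N[OF n] norm_triangle_ineq[of "F n S - F n (u k)" "F n (u k)"] by simp
    qed
    then show "\<exists>no. \<forall>n\<ge>no. norm (F n S - 0) < r" by blast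
  qed
qed (rule lim)

lemma system_convergent:
  fixes F :: "nat \<Rightarrow> 'd fock_op \<Rightarrow> complex"
  assumes T: "T \<in> free_disk_system"
    and lip: "\<And>n S T. S \<in> free_disk_system \<Longrightarrow> T \<in> free_disk_system \<Longrightarrow>
      cmod (F n S - F n T) \<le> C * norm (S - T)"
    and lim: "\<And>a b. a \<in> free_disk_algebra \<Longrightarrow> b \<in> free_disk_algebra \<Longrightarrow>
      convergent (\<lambda>n. F n (a + adj b))"
  shows "convergent (\<lambda>n. F n T)"
  using T
proof (induction rule: system_induct)
  case (limit u S)
  have "Cauchy (\<lambda>n. F n S)"
  proof (rule CauchyI)
    fix r :: real assume r: "r > 0"
    have "r / (3 * (\<bar>C\<bar> + 1)) > 0" using r by (simp add: add_nonneg_pos)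
    then obtain k where k: "norm (u k - S) < r / (3 * (\<bar>C\<bar> + 1))"
      using LIMSEQ_D[OF limit(2)] by blast
    have near: "cmod (F n (u k) - F n S) < r / 3" for n
    proof -
      have "cmod (F n (u k) - F n S) \<le> C * norm (u k - S)" by (rule lip[OF limit(1,3)])
      also have "\<dots> \<le> (\<bar>C\<bar> + 1) * norm (u k - S)" by (intro mult_right_mono) auto
      also have "\<dots> < r / 3" using k by (simp add: field_simps)
      finally show ?thesis .
    qed
    have "Cauchy (\<lambda>n. F n (u k))" using limit(4) by (rule convergent_Cauchy)
    then obtain N where N: "\<And>m n. m \<ge> N \<Longrightarrow> n \<ge> N \<Longrightarrow> norm (F m (u k) - F n (u k)) < r / 3"
      using CauchyD[of _ "r / 3"] r by fastforce
    have "norm (F m S - F n S) < r" if mn: "m \<ge> N" "n \<ge> N" for m n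
    proof -
      have eq: "F m S - F n S = (F m (u k) - F n (u k)) - (F m (u k) - F m S) + (F n (u k) - F n S)"
        by simp
      have "norm (F m S - F n S) \<le> norm (F m (u k) - F n (u k)) + norm (F m (u k) - F m S)
          + norm (F n (u k) - F n S)"
        unfolding eq by (intro norm_triangle_le add_right_mono norm_triangle_ineq4)
      then show ?thesis using N[OF mn] near[of m] near[of n] by linarith
    qed
    then show "\<exists>M. \<forall>m\<ge>M. \<forall>n\<ge>M. norm (F m S - F n S) < r" by blast
  qed
  then show ?case by (simp add: Cauchy_convergent_iff)
qed (rule lim)

context positive_nc_measure
begin

text \<open>In the Gelfand-Naimark-Segal space of \<open>\<mu>\<close> the sequence \<open>near_vacuum\<close> converges to a projection of
  the cyclic vector, and \<open>ac_part\<close> below is the vector functional of this limit.\<close>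

definition near_vacuum :: "nat \<Rightarrow> 'd fock"
  where "near_vacuum = (SOME Y. form.recovers Y vacuum)"

definition near_one :: "nat \<Rightarrow> 'd fock_op"
  where "near_one n = disk_operator (near_vacuum n)"

lemma near_vacuum_recovers: "form.recovers near_vacuum vacuum"
proof -
  have "vacuum \<in> form.hull_dom" using vacuum_mem form.dom_subset_hull_dom by blast
  then have "\<exists>Y. form.recovers Y vacuum" using form.recovers_exists by metis
  then show ?thesis unfolding near_vacuum_def by (rule someI_ex)
qed

lemma near_vacuum_mem: "near_vacuum n \<in> disk_vectors"
  and near_vacuum_lim: "near_vacuum \<longlonglongrightarrow> vacuum"
  using near_vacuum_recovers by (auto simp: form.recovers_def)

lemma near_one_mem: "near_one n \<in> free_disk_algebra"
  and near_one_vacuum: "blinfun_apply (near_one n) vacuum = near_vacuum n"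
  by (simp_all add: near_one_def disk_operator_mem disk_operator_vacuum near_vacuum_mem)

definition near_vacuum_bound :: real
  where "near_vacuum_bound = (SOME M. \<forall>n. form.Q (near_vacuum n) \<le> M)"

lemma Q_near_vacuum_le: "form.Q (near_vacuum n) \<le> near_vacuum_bound"
proof -
  have "\<exists>M. \<forall>n. form.Q (near_vacuum n) \<le> M"
    using form.recovers_bounded[OF near_vacuum_recovers] by metis
  from someI_ex[OF this] show ?thesis unfolding near_vacuum_bound_def by blast
qed

definition compression :: "nat \<Rightarrow> 'd fock_op \<Rightarrow> complex"
  where "compression n T = \<mu> (adj (near_one n) o\<^sub>L (T o\<^sub>L near_one n))"

definition ac_part :: "'d fock_op \<Rightarrow> complex"
  where "ac_part T = (if T \<in> free_disk_system then lim (\<lambda>n. compression n T) else 0)"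

definition singular_part :: "'d fock_op \<Rightarrow> complex"
  where "singular_part T = \<mu> T - ac_part T"

lemma sandwich_lipschitz:
  assumes "b \<in> free_disk_algebra" "form.Q (blinfun_apply b vacuum) \<le> M"
    and "S \<in> free_disk_system" "T \<in> free_disk_system"
  shows "cmod (\<mu> (adj b o\<^sub>L (S o\<^sub>L b)) - \<mu> (adj b o\<^sub>L (T o\<^sub>L b))) \<le> (2 * M) * norm (S - T)"
proof -
  have "cmod (\<mu> (adj b o\<^sub>L ((S - T) o\<^sub>L b))) \<le> 2 * norm (S - T) * form.Q (blinfun_apply b vacuum)"
    using assms by (intro sandwich_bound system_diff)
  also have "\<dots> \<le> 2 * norm (S - T) * M" using assms(2) by (intro mult_left_mono) auto
  finally show ?thesis using assms by (simp add: sandwich_linear(2) mult_ac)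
qed

lemma recovers_apply_near_vacuum:
  "a \<in> free_disk_algebra \<Longrightarrow>
    form.recovers (\<lambda>n. blinfun_apply a (near_vacuum n)) (blinfun_apply a vacuum)"
  by (rule recovers_apply[OF _ near_vacuum_recovers vacuum_mem])

lemma compression_disk:
  assumes "a \<in> free_disk_algebra"
  shows "compression n a = nc_form \<mu> (near_vacuum n) (blinfun_apply a (near_vacuum n))"
    "compression n (adj a) = nc_form \<mu> (blinfun_apply a (near_vacuum n)) (near_vacuum n)"
  using sandwich_disk[OF near_one_mem near_one_mem assms]
  by (simp_all add: compression_def near_one_vacuum)

lemma compression_add: "S \<in> free_disk_system \<Longrightarrow> T \<in> free_disk_system \<Longrightarrow>
    compression n (S + T) = compression n S + compression n T"
  by (simp add: compression_def sandwich_linear near_one_mem)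

lemma compression_tendsto:
  assumes "T \<in> free_disk_system"
  shows "(\<lambda>n. compression n T) \<longlonglongrightarrow> ac_part T"
proof -
  have "convergent (\<lambda>n. compression n T)"
  proof (rule system_convergent[OF assms])
    show "cmod (compression n S - compression n T) \<le> (2 * near_vacuum_bound) * norm (S - T)"
      if "S \<in> free_disk_system" "T \<in> free_disk_system" for n S T
      unfolding compression_def
      using that by (intro sandwich_lipschitz near_one_mem) (simp_all add: near_one_vacuum Q_near_vacuum_le)
    fix a b :: "'d fock_op" assume a: "a \<in> free_disk_algebra" and b: "b \<in> free_disk_algebra"
    have "(\<lambda>n. compression n a + compression n (adj b))
        \<longlonglongrightarrow> form.hull_form vacuum (blinfun_apply a vacuum) + form.hull_form (blinfun_apply b vacuum) vacuum"
      unfolding compression_disk[OF a] compression_disk[OF b]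
      by (intro tendsto_add form.recovers_tendsto near_vacuum_recovers recovers_apply_near_vacuum a b)
    then show "convergent (\<lambda>n. compression n (a + adj b))"
      using a b by (auto simp: compression_add disk_system system_adj convergent_def)
  qed
  then show ?thesis using assms by (simp add: ac_part_def convergent_LIMSEQ_iff)
qed

lemma op_positive_compression:
  "T \<in> free_disk_system \<Longrightarrow> op_positive T \<Longrightarrow> compression n T \<in> \<real>\<^sub>\<ge>\<^sub>0"
  unfolding compression_def
  by (intro mu_nonneg sandwich_system near_one_mem op_positive_conj disk_adjointable)

lemma ac_part_measure: "nc_measure ac_part"
  unfolding nc_measure_def linear_on_system_def positive_on_system_def
proof (intro conjI ballI allI impI)
  fix S T :: "'d fock_op" assume S: "S \<in> free_disk_system" and T: "T \<in> free_disk_system"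
  have "(\<lambda>n. compression n (S + T)) \<longlonglongrightarrow> ac_part S + ac_part T"
    unfolding compression_add[OF S T] by (intro tendsto_add compression_tendsto S T)
  then show "ac_part (S + T) = ac_part S + ac_part T"
    using compression_tendsto[OF system_add[OF S T]] LIMSEQ_unique by blast
next
  fix c and T :: "'d fock_op" assume T: "T \<in> free_disk_system"
  have "compression n (scaleC_op c T) = c * compression n T" for n
    by (simp add: compression_def sandwich_linear(3)[OF near_one_mem T T])
  then have "(\<lambda>n. compression n (scaleC_op c T)) \<longlonglongrightarrow> c * ac_part T"
    by (simp add: tendsto_mult_left compression_tendsto[OF T])
  then show "ac_part (scaleC_op c T) = c * ac_part T"
    using compression_tendsto[OF system_scaleC_op[OF T]] LIMSEQ_unique by blast
next
  fix T :: "'d fock_op" assume "T \<in> free_disk_system" "op_positive T"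
  then show "ac_part T \<in> \<real>\<^sub>\<ge>\<^sub>0"
    using closed_sequentially[OF closed_nonneg_Reals_complex _ compression_tendsto]
      op_positive_compression by blast
qed (simp add: ac_part_def)

text \<open>Expanding \<open>\<mu> T\<close> along \<open>1 = near_one n + (1 - near_one n)\<close> leaves two mixed terms. For \<open>T\<close> in the
  algebra or the adjoint of such an element, each of them pairs a recovery sequence with a bounded
  null sequence; hence they tend to \<open>0\<close>.\<close>

lemma singular_part_tendsto:
  assumes T: "T \<in> free_disk_system"
  shows "(\<lambda>n. \<mu> (adj (id_blinfun - near_one n) o\<^sub>L (T o\<^sub>L (id_blinfun - near_one n)))) \<longlonglongrightarrow> singular_part T"
proof -
  define z where "z n = id_blinfun - near_one n" for n
  define Z where "Z n = blinfun_apply (z n) vacuum" for n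
  have z: "z n \<in> free_disk_algebra" for n by (simp add: z_def disk_diff disk_id near_one_mem)
  have Zeq: "Z n = vacuum - near_vacuum n" for n
    by (simp add: Z_def z_def blinfun.diff_left near_one_vacuum)
  have ZD: "Z n \<in> disk_vectors" for n unfolding Z_def by (rule disk_vectorsI[OF z])
  define M where "M = 2 * form.Q vacuum + 2 * near_vacuum_bound"
  have QZ: "form.Q (Z n) \<le> M" for n
    using form.Q_diff_le[OF vacuum_mem near_vacuum_mem[of n]] Q_near_vacuum_le[of n]
    by (simp add: Zeq M_def)
  have null: "form.bounded_null (\<lambda>n. blinfun_apply a (Z n))" if a: "a \<in> free_disk_algebra" for a
    unfolding form.bounded_null_def
  proof (intro conjI allI exI)
    show "blinfun_apply a (Z n) \<in> disk_vectors" for n by (rule disk_vectors_apply[OF a ZD])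
    have "(\<lambda>n. blinfun_apply a (vacuum - near_vacuum n)) \<longlonglongrightarrow> blinfun_apply a (vacuum - vacuum)"
      by (intro blinfun.tendsto tendsto_const tendsto_diff near_vacuum_lim)
    then show "(\<lambda>n. blinfun_apply a (Z n)) \<longlonglongrightarrow> 0" by (simp add: Zeq)
    show "form.Q (blinfun_apply a (Z n)) \<le> (norm a)\<^sup>2 * M" for n
      using Q_apply_le[OF a ZD[of n]] mult_left_mono[OF QZ[of n], of "(norm a)\<^sup>2"] by simp
  qed
  \<comment> \<open>The sum of the two mixed terms.\<close>
  define E where "E n T = \<mu> T - compression n T - \<mu> (adj (z n) o\<^sub>L (T o\<^sub>L z n))" for n T
  have "(\<lambda>n. E n T) \<longlonglongrightarrow> 0"
  proof (rule system_tendsto_zero[OF T])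
    fix n and S T :: "'d fock_op" assume ST: "S \<in> free_disk_system" "T \<in> free_disk_system"
    have "E n S - E n T = (\<mu> S - \<mu> T) - (compression n S - compression n T)
        - (\<mu> (adj (z n) o\<^sub>L (S o\<^sub>L z n)) - \<mu> (adj (z n) o\<^sub>L (T o\<^sub>L z n)))"
      by (simp add: E_def)
    then have "cmod (E n S - E n T) \<le> cmod (\<mu> S - \<mu> T) + cmod (compression n S - compression n T)
        + cmod (\<mu> (adj (z n) o\<^sub>L (S o\<^sub>L z n)) - \<mu> (adj (z n) o\<^sub>L (T o\<^sub>L z n)))"
      by (metis (no_types, lifting) norm_triangle_ineq4 norm_triangle_le_diff order_trans add_right_mono)
    also have "cmod (\<mu> S - \<mu> T) \<le> (2 * form.Q vacuum) * norm (S - T)"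
      using sandwich_lipschitz[OF disk_id _ ST, of "form.Q vacuum"] by simp
    also have "cmod (compression n S - compression n T) \<le> (2 * near_vacuum_bound) * norm (S - T)"
      unfolding compression_def
      using ST by (intro sandwich_lipschitz near_one_mem) (simp_all add: near_one_vacuum Q_near_vacuum_le)
    also have "cmod (\<mu> (adj (z n) o\<^sub>L (S o\<^sub>L z n)) - \<mu> (adj (z n) o\<^sub>L (T o\<^sub>L z n))) \<le> (2 * M) * norm (S - T)"
      using QZ[of n] ST by (intro sandwich_lipschitz z) (simp_all add: Z_def)
    finally show "cmod (E n S - E n T)
        \<le> (2 * form.Q vacuum + 2 * near_vacuum_bound + 2 * M) * norm (S - T)"
      by (simp add: algebra_simps)
  next
    fix a b :: "'d fock_op" assume a: "a \<in> free_disk_algebra" and b: "b \<in> free_disk_algebra"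
    let ?q = "nc_form \<mu>" and ?Y = near_vacuum
    have vac: "vacuum = ?Y n + Z n" for n by (simp add: Zeq)
    have Ea: "E n a = ?q (?Y n) (blinfun_apply a (Z n)) + ?q (Z n) (blinfun_apply a (?Y n))" for n
    proof -
      have "\<mu> a = ?q (?Y n + Z n) (blinfun_apply a (?Y n) + blinfun_apply a (Z n))"
        using nc_form_apply[OF disk_id a] by (simp add: vac[of n, symmetric] flip: blinfun.add_right)
      also have "\<dots> = ?q (?Y n) (blinfun_apply a (?Y n)) + ?q (?Y n) (blinfun_apply a (Z n))
          + ?q (Z n) (blinfun_apply a (?Y n)) + ?q (Z n) (blinfun_apply a (Z n))"
        using ZD[of n] near_vacuum_mem[of n] a
        by (simp add: form.add_left form.add_right disk_vectors_apply disk_vectors_add)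
      finally show ?thesis
        using sandwich_disk(1)[OF z z a, of n n] by (simp add: E_def compression_disk a Z_def)
    qed
    have Eb: "E n (adj b) = ?q (blinfun_apply b (?Y n)) (Z n) + ?q (blinfun_apply b (Z n)) (?Y n)" for n
    proof -
      have "\<mu> (adj b) = ?q (blinfun_apply b (?Y n) + blinfun_apply b (Z n)) (?Y n + Z n)"
        using nc_form_apply[OF b disk_id] by (simp add: vac[of n, symmetric] flip: blinfun.add_right)
      also have "\<dots> = ?q (blinfun_apply b (?Y n)) (?Y n) + ?q (blinfun_apply b (?Y n)) (Z n)
          + ?q (blinfun_apply b (Z n)) (?Y n) + ?q (blinfun_apply b (Z n)) (Z n)"
        using ZD[of n] near_vacuum_mem[of n] b
        by (simp add: form.add_left form.add_right disk_vectors_apply disk_vectors_add)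
      finally show ?thesis
        using sandwich_disk(2)[OF z z b, of n n] by (simp add: E_def compression_disk b Z_def)
    qed
    have flip: "(\<lambda>n. ?q (V n) (W n)) \<longlonglongrightarrow> 0" if "(\<lambda>n. ?q (W n) (V n)) \<longlonglongrightarrow> 0" for V W
      using tendsto_cnj[OF that] by (simp flip: form.hermitian)
    have nZ: "form.bounded_null Z" using null[OF disk_id] by simp
    have "(\<lambda>n. (?q (?Y n) (blinfun_apply a (Z n)) + ?q (Z n) (blinfun_apply a (?Y n)))
        + (?q (blinfun_apply b (?Y n)) (Z n) + ?q (blinfun_apply b (Z n)) (?Y n)))
      \<longlonglongrightarrow> (0 + 0) + (0 + 0)"
      by (intro tendsto_add form.recovers_orthogonal[OF near_vacuum_recovers null[OF a]]
          flip[OF form.recovers_orthogonal[OF recovers_apply_near_vacuum[OF a] nZ]]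
          form.recovers_orthogonal[OF recovers_apply_near_vacuum[OF b] nZ]
          flip[OF form.recovers_orthogonal[OF near_vacuum_recovers null[OF b]]])
    moreover have "E n (a + adj b) = E n a + E n (adj b)" for n
      using a b z[of n]
      by (simp add: E_def compression_add sandwich_linear mu_add disk_system system_adj)
    ultimately show "(\<lambda>n. E n (a + adj b)) \<longlonglongrightarrow> 0" by (simp add: Ea Eb)
  qed
  moreover have "(\<lambda>n. \<mu> T - compression n T) \<longlonglongrightarrow> \<mu> T - ac_part T"
    by (intro tendsto_diff tendsto_const compression_tendsto T)
  ultimately have "(\<lambda>n. (\<mu> T - compression n T) - E n T) \<longlonglongrightarrow> (\<mu> T - ac_part T) - 0"
    by (rule tendsto_diff[rotated])
  then show ?thesis by (simp add: E_def z_def singular_part_def)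
qed

lemma singular_part_measure: "nc_measure singular_part"
proof -
  interpret ac: positive_nc_measure ac_part by unfold_locales (rule ac_part_measure)
  have "singular_part T \<in> \<real>\<^sub>\<ge>\<^sub>0" if T: "T \<in> free_disk_system" "op_positive T" for T
  proof (rule closed_sequentially[OF closed_nonneg_Reals_complex _ singular_part_tendsto[OF T(1)]])
    show "\<mu> (adj (id_blinfun - near_one n) o\<^sub>L (T o\<^sub>L (id_blinfun - near_one n))) \<in> \<real>\<^sub>\<ge>\<^sub>0" for n
      using T by (intro mu_nonneg sandwich_system op_positive_conj disk_adjointable disk_diff
          disk_id near_one_mem)
  qed
  then show ?thesis
    unfolding nc_measure_def linear_on_system_def positive_on_system_def
    by (auto simp: singular_part_def mu_add ac.mu_add mu_scaleC_op ac.mu_scaleC_op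
        mu_outside ac.mu_outside right_diff_distrib)
qed

section \<open>The two parts are absolutely continuous and singular\<close>

text \<open>The compression of \<open>adj a a\<close> is \<open>Q\<close> at \<open>a (near_vacuum n)\<close>, and these vectors recover \<open>a vacuum\<close>.\<close>

lemma nc_form_ac_part: "nc_form ac_part = form.hull_on_dom"
proof -
  interpret ac: positive_nc_measure ac_part by unfold_locales (rule ac_part_measure)
  show ?thesis
  proof (rule psd_form_ext[OF ac.nc_form_psd form.hull_on_dom_psd])
    fix x :: "'d fock" assume x: "x \<in> disk_vectors"
    then obtain a where a: "a \<in> free_disk_algebra" "x = blinfun_apply a vacuum" by (rule disk_vectorsE)
    have "compression n (adj a o\<^sub>L a) = of_real (form.Q (blinfun_apply a (near_vacuum n)))" for n
      using nc_form_apply[OF disk_compose[OF a(1) near_one_mem] disk_compose[OF a(1) near_one_mem], of n n]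
      by (simp add: compression_def adj_compose disk_adjointable a(1) near_one_mem compose_assoc
          near_one_vacuum form.q_self)
    then have "(\<lambda>n. of_real (form.Q (blinfun_apply a (near_vacuum n)))) \<longlonglongrightarrow> ac_part (adj a o\<^sub>L a)"
      using compression_tendsto[OF adj_compose_disk[OF a(1) a(1)]] by simp
    moreover have "(\<lambda>n. form.Q (blinfun_apply a (near_vacuum n))) \<longlonglongrightarrow> form.hull_value x"
      using recovers_apply_near_vacuum[OF a(1)] by (simp add: form.recovers_def a(2))
    then have "(\<lambda>n. complex_of_real (form.Q (blinfun_apply a (near_vacuum n)))) \<longlonglongrightarrow> of_real (form.hull_value x)"
      by (rule tendsto_of_real)
    ultimately have "ac_part (adj a o\<^sub>L a) = of_real (form.hull_value x)"
      by (rule LIMSEQ_unique)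
    then show "Re (nc_form ac_part x x) = Re (form.hull_on_dom x x)"
      using x a by (simp add: ac.nc_form_apply form.hull_on_dom_self)
  qed
qed

lemma ac_part_absolutely_continuous: "nc_absolutely_continuous ac_part"
  unfolding nc_absolutely_continuous_def nc_form_ac_part by (rule form.hull_on_dom_closable)

text \<open>The form of the singular part is \<open>Q\<close> minus its hull. At \<open>y\<close> near \<open>x\<close> with \<open>Q y\<close> near the hull at
  \<open>x\<close> it is small, because by lower semicontinuity the hull at \<open>y\<close> is nearly as large as at \<open>x\<close>; so
  the hull of this form vanishes.\<close>

lemma singular_part_singular: "nc_singular singular_part"
proof -
  interpret s: positive_nc_measure singular_part by unfold_locales (rule singular_part_measure)
  interpret ac: positive_nc_measure ac_part by unfold_locales (rule ac_part_measure)
  have sQ: "s.form.Q x = form.Q x - form.hull_value x" if x: "x \<in> disk_vectors" for x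
  proof -
    obtain a where a: "a \<in> free_disk_algebra" "x = blinfun_apply a vacuum"
      using x by (rule disk_vectorsE)
    have "nc_form singular_part x x = nc_form \<mu> x x - nc_form ac_part x x"
      using a by (simp add: s.nc_form_apply nc_form_apply ac.nc_form_apply singular_part_def)
    then show ?thesis
      using x by (simp add: s.form.Q_def form.Q_def nc_form_ac_part form.hull_on_dom_self)
  qed
  have zero: "s.form.hull_value x = 0" if x: "x \<in> disk_vectors" for x
  proof -
    have xd: "x \<in> form.hull_dom" using x form.dom_subset_hull_dom by blast
    have "s.form.hull_le x 0"
      unfolding s.form.hull_le_def
    proof (intro allI impI)
      fix e :: real assume e: "e > 0"
      obtain d where d: "d > 0" "\<And>y. y \<in> form.hull_dom \<Longrightarrow> norm (y - x) < d \<Longrightarrow>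
          form.hull_value x - e / 2 < form.hull_value y"
        using form.hull_value_lsc[of "e / 2" x] e by auto
      have r: "min (min d e) (e / 2) > 0" using d(1) e by simp
      obtain y where y: "y \<in> disk_vectors" "norm (y - x) < min (min d e) (e / 2)"
        "form.Q y < form.hull_value x + min (min d e) (e / 2)"
        using form.hull_le_hull_value[OF xd] r unfolding form.hull_le_def by blast
      have "form.hull_value x - e / 2 < form.hull_value y"
        using y d(2) form.dom_subset_hull_dom by auto
      then have "s.form.Q y < 0 + e" using y by (simp add: sQ)
      then show "\<exists>y\<in>disk_vectors. norm (y - x) < e \<and> s.form.Q y < 0 + e"
        using y by auto
    qed
    then show ?thesis
      using s.form.hull_value_le s.form.hull_value_nonneg x s.form.dom_subset_hull_dom
      by (meson antisym subsetD)
  qed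
  have "psd_form disk_vectors (\<lambda>(x :: 'd fock) y. 0)"
    unfolding psd_form_def
    by (simp add: disk_vectors_zero disk_vectors_add disk_vectors_scaleC closure_disk_vectors)
  then have "s.form.hull_on_dom = (\<lambda>x y. 0)"
    by (rule psd_form_ext[OF s.form.hull_on_dom_psd]) (simp add: s.form.hull_on_dom_self zero)
  then show ?thesis
    unfolding nc_singular_def s.form.form_ac_part_eq by simp
qed

text \<open>The sequence \<open>near_vacuum\<close> is Cauchy for the form of \<open>\<mu>\<close>, hence for the smaller form of \<open>\<kappa>\<close>; as the
  latter is closable, the sequence converges to the vacuum for it. So \<open>\<kappa> T\<close> is the limit of the
  compressions of \<open>\<kappa>\<close>, which for positive \<open>T\<close> are at most those of \<open>\<mu>\<close>. The order of the forms alone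
  would give the inequality only for \<open>T = adj a a\<close>.\<close>

lemma ac_part_maximal:
  assumes \<kappa>: "nc_measure \<kappa>" "nc_absolutely_continuous \<kappa>" and le: "nc_le \<kappa> \<mu>"
  shows "nc_le \<kappa> ac_part"
  unfolding nc_le_def positive_on_system_def
proof (intro ballI impI)
  interpret k: positive_nc_measure \<kappa> by unfold_locales (rule \<kappa>(1))
  fix T :: "'d fock_op" assume T: "T \<in> free_disk_system" "op_positive T"
  have kQ: "k.form.Q x \<le> form.Q x" if x: "x \<in> disk_vectors" for x
  proof -
    obtain a where a: "a \<in> free_disk_algebra" "x = blinfun_apply a vacuum"
      using x by (rule disk_vectorsE)
    have "op_positive (adj a o\<^sub>L a)"
      using op_positive_conj[OF op_positive_id disk_adjointable[OF a(1)]] by simp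
    then have "\<mu> (adj a o\<^sub>L a) - \<kappa> (adj a o\<^sub>L a) \<in> \<real>\<^sub>\<ge>\<^sub>0"
      using le adj_compose_disk[OF a(1) a(1)] unfolding nc_le_def positive_on_system_def by blast
    then show ?thesis
      using a by (simp add: mu_adj_compose_self k.mu_adj_compose_self complex_nonneg_Reals_iff)
  qed
  have Y0: "(\<lambda>n. k.form.Q (near_vacuum n - vacuum)) \<longlonglongrightarrow> 0"
  proof (rule k.form.closable_form_limit[OF _ near_vacuum_mem vacuum_mem near_vacuum_lim])
    show "closable_form disk_vectors (nc_form \<kappa>)"
      using \<kappa>(2) by (simp add: nc_absolutely_continuous_def)
    fix e :: real assume "e > 0"
    then show "\<exists>N. \<forall>m\<ge>N. \<forall>n\<ge>N. k.form.Q (near_vacuum m - near_vacuum n) < e"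
      using form.recovers_Cauchy[OF near_vacuum_recovers] kQ form.diff_mem near_vacuum_mem
      by (meson le_less_trans)
  qed
  define F where "F n T = \<kappa> T - \<kappa> (adj (near_one n) o\<^sub>L (T o\<^sub>L near_one n))" for n T
  have F0: "(\<lambda>n. F n T) \<longlonglongrightarrow> 0"
  proof (rule system_tendsto_zero[OF T(1)])
    fix n and S T :: "'d fock_op" assume ST: "S \<in> free_disk_system" "T \<in> free_disk_system"
    have "F n S - F n T = (\<kappa> S - \<kappa> T) - (\<kappa> (adj (near_one n) o\<^sub>L (S o\<^sub>L near_one n))
        - \<kappa> (adj (near_one n) o\<^sub>L (T o\<^sub>L near_one n)))"
      by (simp add: F_def)
    then have "cmod (F n S - F n T) \<le> cmod (\<kappa> S - \<kappa> T)
        + cmod (\<kappa> (adj (near_one n) o\<^sub>L (S o\<^sub>L near_one n)) - \<kappa> (adj (near_one n) o\<^sub>L (T o\<^sub>L near_one n)))"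
      by (metis norm_triangle_ineq4)
    also have "cmod (\<kappa> S - \<kappa> T) \<le> (2 * k.form.Q vacuum) * norm (S - T)"
      using k.sandwich_lipschitz[OF disk_id _ ST, of "k.form.Q vacuum"] by simp
    also have "cmod (\<kappa> (adj (near_one n) o\<^sub>L (S o\<^sub>L near_one n)) - \<kappa> (adj (near_one n) o\<^sub>L (T o\<^sub>L near_one n)))
        \<le> (2 * near_vacuum_bound) * norm (S - T)"
      using ST kQ[OF near_vacuum_mem[of n]] Q_near_vacuum_le[of n]
      by (intro k.sandwich_lipschitz near_one_mem) (simp_all add: near_one_vacuum)
    finally show "cmod (F n S - F n T) \<le> (2 * k.form.Q vacuum + 2 * near_vacuum_bound) * norm (S - T)"
      by (simp add: algebra_simps)
  next
    fix a b :: "'d fock_op" assume a: "a \<in> free_disk_algebra" and b: "b \<in> free_disk_algebra"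
    let ?q = "nc_form \<kappa>" and ?Y = near_vacuum
    have apply0: "(\<lambda>n. k.form.Q (blinfun_apply c (?Y n) - blinfun_apply c vacuum)) \<longlonglongrightarrow> 0"
      if c: "c \<in> free_disk_algebra" for c
    proof (rule Lim_null_comparison)
      show "\<forall>\<^sub>F n in sequentially. norm (k.form.Q (blinfun_apply c (?Y n) - blinfun_apply c vacuum))
          \<le> (norm c)\<^sup>2 * k.form.Q (?Y n - vacuum)"
        using k.Q_apply_le[OF c k.form.diff_mem[OF near_vacuum_mem vacuum_mem]]
        by (simp add: blinfun.diff_right k.form.Q_nonneg)
      show "(\<lambda>n. (norm c)\<^sup>2 * k.form.Q (?Y n - vacuum)) \<longlonglongrightarrow> 0"
        by (rule tendsto_mult_right_zero[OF Y0])
    qed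
    have "(\<lambda>n. (?q vacuum (blinfun_apply a vacuum) - ?q (?Y n) (blinfun_apply a (?Y n)))
        + (?q (blinfun_apply b vacuum) vacuum - ?q (blinfun_apply b (?Y n)) (?Y n)))
      \<longlonglongrightarrow> (?q vacuum (blinfun_apply a vacuum) - ?q vacuum (blinfun_apply a vacuum))
        + (?q (blinfun_apply b vacuum) vacuum - ?q (blinfun_apply b vacuum) vacuum)"
      by (intro tendsto_add tendsto_diff tendsto_const k.form.q_tendsto near_vacuum_mem vacuum_mem
          disk_vectors_apply a b Y0 apply0)
    moreover have "F n (a + adj b) = (?q vacuum (blinfun_apply a vacuum) - ?q (?Y n) (blinfun_apply a (?Y n)))
        + (?q (blinfun_apply b vacuum) vacuum - ?q (blinfun_apply b (?Y n)) (?Y n))" for n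
    proof -
      have "F n (a + adj b) = F n a + F n (adj b)"
        using a b near_one_mem[of n]
        by (simp add: F_def k.sandwich_linear k.mu_add disk_system system_adj)
      moreover have "F n a = ?q vacuum (blinfun_apply a vacuum) - ?q (?Y n) (blinfun_apply a (?Y n))"
        using k.sandwich_disk(1)[OF disk_id disk_id a] k.sandwich_disk(1)[OF near_one_mem near_one_mem a, of n n]
        by (simp add: F_def near_one_vacuum)
      moreover have "F n (adj b) = ?q (blinfun_apply b vacuum) vacuum - ?q (blinfun_apply b (?Y n)) (?Y n)"
        using k.sandwich_disk(2)[OF disk_id disk_id b] k.sandwich_disk(2)[OF near_one_mem near_one_mem b, of n n]
        by (simp add: F_def near_one_vacuum)
      ultimately show ?thesis by simp
    qed
    ultimately show "(\<lambda>n. F n (a + adj b)) \<longlonglongrightarrow> 0" by simp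
  qed
  have "(\<lambda>n. compression n T - (\<kappa> T - F n T)) \<longlonglongrightarrow> ac_part T - (\<kappa> T - 0)"
    by (intro tendsto_diff tendsto_const compression_tendsto T F0)
  moreover have "compression n T - (\<kappa> T - F n T) \<in> \<real>\<^sub>\<ge>\<^sub>0" for n
  proof -
    have "op_positive (adj (near_one n) o\<^sub>L (T o\<^sub>L near_one n))"
      by (rule op_positive_conj[OF T(2) disk_adjointable[OF near_one_mem]])
    then show ?thesis
      using le sandwich_system[OF near_one_mem near_one_mem T(1), of n n]
      unfolding nc_le_def positive_on_system_def by (simp add: compression_def F_def)
  qed
  ultimately have "ac_part T - (\<kappa> T - 0) \<in> \<real>\<^sub>\<ge>\<^sub>0"
    by (rule closed_sequentially[OF closed_nonneg_Reals_complex, rotated])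
  then show "ac_part T - \<kappa> T \<in> \<real>\<^sub>\<ge>\<^sub>0" by simp
qed

end

text \<open>The positive elements span the system: a self-adjoint \<open>H\<close> is \<open>(norm H + H) - norm H\<close>.\<close>

lemma nc_le_antisym:
  fixes \<kappa> \<nu> :: "'d fock_op \<Rightarrow> complex"
  assumes \<kappa>: "nc_measure \<kappa>" and \<nu>: "nc_measure \<nu>" and le: "nc_le \<kappa> \<nu>" "nc_le \<nu> \<kappa>"
  shows "\<kappa> = \<nu>"
proof
  interpret k: positive_nc_measure \<kappa> by unfold_locales (rule \<kappa>)
  interpret l: positive_nc_measure \<nu> by unfold_locales (rule \<nu>)
  fix T
  have pos: "\<kappa> P = \<nu> P" if P: "P \<in> free_disk_system" "op_positive P" for P
  proof -
    have "\<nu> P - \<kappa> P \<in> \<real>\<^sub>\<ge>\<^sub>0" "\<kappa> P - \<nu> P \<in> \<real>\<^sub>\<ge>\<^sub>0"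
      using le P unfolding nc_le_def positive_on_system_def by blast+
    then show ?thesis by (auto simp: complex_nonneg_Reals_iff complex_eq_iff)
  qed
  have self: "\<kappa> H = \<nu> H" if H: "H \<in> free_disk_system" "adj H = H" for H
  proof -
    let ?I = "scaleC_op (of_real (norm H)) id_blinfun :: 'd fock_op"
    have I: "?I \<in> free_disk_system" by (intro system_scaleC_op disk_system disk_id)
    have "\<kappa> id_blinfun = \<nu> id_blinfun" by (rule pos[OF disk_system[OF disk_id] op_positive_id])
    moreover have "\<kappa> (?I + H) = \<nu> (?I + H)"
      by (intro pos system_add I H op_positive_norm_minus(2) system_adjointable)
    ultimately show ?thesis
      using I H by (simp add: k.mu_add l.mu_add k.mu_scaleC_op l.mu_scaleC_op disk_system disk_id)
  qed
  show "\<kappa> T = \<nu> T"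
  proof (cases "T \<in> free_disk_system")
    case True
    obtain H K where "H \<in> free_disk_system" "adj H = H" "K \<in> free_disk_system" "adj K = K"
      "T = H + scaleC_op \<i> K"
      using system_real_imaginary[OF True] by blast
    then show ?thesis
      using self by (simp add: k.mu_add l.mu_add k.mu_scaleC_op l.mu_scaleC_op system_scaleC_op)
  qed (simp add: k.mu_outside l.mu_outside)
qed

section \<open>The Lebesgue decomposition\<close>

theorem theorem5p6:
  fixes \<mu> :: "'d::finite fock_op \<Rightarrow> complex"
  assumes "nc_measure \<mu>"
  shows "\<exists>!(\<mu>ac, \<mu>s).
    nc_measure \<mu>ac \<and> nc_measure \<mu>s \<and> nc_le \<mu>ac \<mu> \<and> nc_le \<mu>s \<mu> \<and>
    (\<forall>T. \<mu> T = \<mu>ac T + \<mu>s T) \<and>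
    nc_absolutely_continuous \<mu>ac \<and>
    (\<forall>\<kappa>. nc_measure \<kappa> \<and> nc_absolutely_continuous \<kappa> \<and> nc_le \<kappa> \<mu> \<longrightarrow> nc_le \<kappa> \<mu>ac) \<and>
    nc_singular \<mu>s"
proof -
  interpret positive_nc_measure \<mu> by unfold_locales (rule assms)
  interpret ac: positive_nc_measure ac_part by unfold_locales (rule ac_part_measure)
  interpret s: positive_nc_measure singular_part by unfold_locales (rule singular_part_measure)
  have split: "\<mu> T = ac_part T + singular_part T" for T by (simp add: singular_part_def)
  have ac_le: "nc_le ac_part \<mu>" and s_le: "nc_le singular_part \<mu>"
    using ac.mu_nonneg s.mu_nonneg by (auto simp: nc_le_def positive_on_system_def split)
  show ?thesis
  proof (rule ex1I[of _ "(ac_part, singular_part)"])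
    show "case (ac_part, singular_part) of (\<mu>ac, \<mu>s) \<Rightarrow>
      nc_measure \<mu>ac \<and> nc_measure \<mu>s \<and> nc_le \<mu>ac \<mu> \<and> nc_le \<mu>s \<mu> \<and>
      (\<forall>T. \<mu> T = \<mu>ac T + \<mu>s T) \<and>
      nc_absolutely_continuous \<mu>ac \<and>
      (\<forall>\<kappa>. nc_measure \<kappa> \<and> nc_absolutely_continuous \<kappa> \<and> nc_le \<kappa> \<mu> \<longrightarrow> nc_le \<kappa> \<mu>ac) \<and>
      nc_singular \<mu>s"
      using ac_part_measure singular_part_measure ac_le s_le split ac_part_absolutely_continuous
        ac_part_maximal singular_part_singular by auto
  next
    fix p
    assume p: "case p of (\<mu>ac, \<mu>s) \<Rightarrow>
      nc_measure \<mu>ac \<and> nc_measure \<mu>s \<and> nc_le \<mu>ac \<mu> \<and> nc_le \<mu>s \<mu> \<and>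
      (\<forall>T. \<mu> T = \<mu>ac T + \<mu>s T) \<and>
      nc_absolutely_continuous \<mu>ac \<and>
      (\<forall>\<kappa>. nc_measure \<kappa> \<and> nc_absolutely_continuous \<kappa> \<and> nc_le \<kappa> \<mu> \<longrightarrow> nc_le \<kappa> \<mu>ac) \<and>
      nc_singular \<mu>s"
    obtain \<alpha> \<beta> where ab: "p = (\<alpha>, \<beta>)" by (cases p)
    have \<alpha>: "nc_measure \<alpha>" "nc_le \<alpha> \<mu>" "nc_absolutely_continuous \<alpha>"
      and sum: "\<And>T. \<mu> T = \<alpha> T + \<beta> T"
      and max: "\<And>\<kappa>. nc_measure \<kappa> \<Longrightarrow> nc_absolutely_continuous \<kappa> \<Longrightarrow> nc_le \<kappa> \<mu> \<Longrightarrow> nc_le \<kappa> \<alpha>"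
      using p unfolding ab by auto
    have "nc_le ac_part \<alpha>" by (rule max[OF ac_part_measure ac_part_absolutely_continuous ac_le])
    moreover have "nc_le \<alpha> ac_part" by (rule ac_part_maximal[OF \<alpha>(1,3,2)])
    ultimately have "\<alpha> = ac_part" by (intro nc_le_antisym \<alpha> ac_part_measure)
    moreover have "\<beta> T = singular_part T" for T
      using sum[of T] split[of T] \<open>\<alpha> = ac_part\<close> by simp
    ultimately show "p = (ac_part, singular_part)" by (simp add: ab fun_eq_iff)
  qed
qed

end
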